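(* Let $T>0$ and let $H_1,H_2\colon[0,T]\to(1/2,1)$ be continuous functions. Put $\hat H_i=\min_{t\in[0,T]}H_i(t)$, $\check H_i=\max_{t\in[0,T]}H_i(t)$ for $i=1,2$, $\hat H=(\hat H_1+\hat H_2)/2$ and $\check H=(\check H_1+\check H_2)/2$. Assume that there exists $\gamma>\check H$ such that $|H_i(t)-H_i(s)|\le|t-s|^\gamma$ for $i=1,2$ and all $t,s\in[0,T]$. Let $X=\{X_t,\ t\in[0,T]\}$, $X_t=Y_t^{H_1(t),H_2(t)}$, be the multifractional generalized Rosenblatt process. Then for any $\alpha\in(0,\hat H)$ the process $X$ has a modification whose paths are Hölder continuous of order $\alpha$ on $[0,T]$.
   Context: $W$ is the standard Wiener (Gaussian white noise) measure on $\mathbb{R}$: a random measure with independent values on disjoint sets such that, for every Borel set $A$ of finite Lebesgue measure $\lambda(A)$, $W(A)$ is centered Gaussian with variance $\lambda(A)$. For a symmetric $f\in L^2(\mathbb{R}^2)$, the double Itô–Wiener integral $I_2(f)=\iint_{\mathbb{R}^2}f(x,y)\,W(dx)W(dy)$ is defined as follows. For simple $f(x,y)=\sum_{k,j=1}^n a_{kj}\mathbf{1}_{A_k}(x)\mathbf{1}_{A_j}(y)$, with $A_1,\dots,A_n$ disjoint of finite Lebesgue measure, $a_{kj}=a_{jk}$ and $a_{kk}=0$, set $I_2(f)=\sum_{k,j}a_{kj}W(A_k)W(A_j)$. Then extend to all symmetric $f\in L^2(\mathbb{R}^2)$ by linearity and continuity into $L^2(\Omega)$ (one has $\mathsf{E}[I_2(f)^2]=2\|f\|^2_{L^2(\mathbb{R}^2)}$).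 For $a\in\mathbb{R}$, $u_+^{a}=u^a$ if $u>0$ and $u_+^a=0$ if $u\le0$. For $h_1,h_2\in(1/2,1)$ define $$K_{h_1,h_2}(s,x,y)=(s-x)_+^{h_1/2-1}(s-y)_+^{h_2/2-1}+(s-x)_+^{h_2/2-1}(s-y)_+^{h_1/2-1},$$ and the generalized Rosenblatt process $$Y_t^{h_1,h_2}=\iint_{\mathbb{R}^2}\int_0^tK_{h_1,h_2}(s,x,y)\,ds\,W(dx)W(dy),\quad t\ge0.$$ The multifractional generalized Rosenblatt process is $$X_t=Y_t^{H_1(t),H_2(t)}=\iint_{\mathbb{R}^2}\int_0^tK_{H_1(t),H_2(t)}(s,x,y)\,ds\,W(dx)W(dy),\quad t\in[0,T],$$ with the same $W$ for all $t$. *)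

theory Defs
  imports "HOL-Probability.Probability"
begin

text \<open>
  A white noise is indexed by the Borel sets of finite Lebesgue measure; its values on all other
  sets are irrelevant. Sets of measure 0 need a separate clause because
  \<^term>\<open>normal_density 0 0\<close> is not the density of the point mass at 0. Finite disjoint
  families are covered by padding with the empty set.
\<close>

locale white_noise = prob_space M for M :: "'a measure" +
  fixes W :: "real set \<Rightarrow> 'a \<Rightarrow> real"
  assumes gaussian:
    "\<And>A. A \<in> sets borel \<Longrightarrow> 0 < emeasure lborel A \<Longrightarrow> emeasure lborel A < \<infinity> \<Longrightarrow>
       distributed M lborel (W A) (normal_density 0 (sqrt (measure lborel A)))"
  and null:
    "\<And>A. A \<in> sets borel \<Longrightarrow> emeasure lborel A = 0 \<Longrightarrow>
       random_variable borel (W A) \<and> (AE \<omega> in M. W A \<omega> = 0)"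
  and independent:
    "\<And>A :: nat \<Rightarrow> real set.
       disjoint_family A \<Longrightarrow> (\<And>n. A n \<in> sets borel) \<Longrightarrow> (\<And>n. emeasure lborel (A n) < \<infinity>) \<Longrightarrow>
       indep_vars (\<lambda>_. borel) (\<lambda>n. W (A n)) UNIV"
  and additive:
    "\<And>A :: nat \<Rightarrow> real set.
       disjoint_family A \<Longrightarrow> (\<And>n. A n \<in> sets borel) \<Longrightarrow> emeasure lborel (\<Union>n. A n) < \<infinity> \<Longrightarrow>
       AE \<omega> in M. (\<lambda>n. W (A n) \<omega>) sums W (\<Union>n. A n) \<omega>"

definition symmetric_L2 :: "(real \<times> real \<Rightarrow> real) \<Rightarrow> bool" where
  "symmetric_L2 f \<longleftrightarrow>
     f \<in> borel_measurable borel \<and> integrable lborel (\<lambda>z. (f z)\<^sup>2) \<and> (\<forall>x y. f (x, y) = f (y, x))"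

text \<open>
  A symmetric simple function vanishing on the diagonal blocks is handled through its
  representation by \<open>n\<close>, the coefficients \<open>a\<close> and the sets \<open>A\<close>, with indices in \<open>{..<n}\<close>.
\<close>

definition simple_rep :: "nat \<Rightarrow> (nat \<Rightarrow> nat \<Rightarrow> real) \<Rightarrow> (nat \<Rightarrow> real set) \<Rightarrow> bool" where
  "simple_rep n a A \<longleftrightarrow>
     disjoint_family_on A {..<n} \<and>
     (\<forall>k<n. A k \<in> sets borel \<and> emeasure lborel (A k) < \<infinity>) \<and>
     (\<forall>k<n. \<forall>j<n. a k j = a j k) \<and> (\<forall>k<n. a k k = 0)"

definition simple_fun :: "nat \<Rightarrow> (nat \<Rightarrow> nat \<Rightarrow> real) \<Rightarrow> (nat \<Rightarrow> real set) \<Rightarrow> real \<times> real \<Rightarrow> real" where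
  "simple_fun n a A = (\<lambda>(x, y). \<Sum>k<n. \<Sum>j<n. a k j * indicator (A k) x * indicator (A j) y)"

definition simple_I2 ::
    "(real set \<Rightarrow> 'a \<Rightarrow> real) \<Rightarrow> nat \<Rightarrow> (nat \<Rightarrow> nat \<Rightarrow> real) \<Rightarrow> (nat \<Rightarrow> real set) \<Rightarrow> 'a \<Rightarrow> real" where
  "simple_I2 W n a A = (\<lambda>\<omega>. \<Sum>k<n. \<Sum>j<n. a k j * W (A k) \<omega> * W (A j) \<omega>)"

text \<open>
  The continuous extension is expressed by its graph, the \<open>L\<^sup>2 \<times> L\<^sup>2\<close>-closure of the graph on simple
  functions. It determines the integral up to almost sure equality, and \<open>I2\<close> picks one version.
\<close>

definition has_I2 ::
    "'a measure \<Rightarrow> (real set \<Rightarrow> 'a \<Rightarrow> real) \<Rightarrow> (real \<times> real \<Rightarrow> real) \<Rightarrow> ('a \<Rightarrow> real) \<Rightarrow> bool" where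
  "has_I2 M W f Z \<longleftrightarrow>
     symmetric_L2 f \<and> Z \<in> borel_measurable M \<and> integrable M (\<lambda>\<omega>. (Z \<omega>)\<^sup>2) \<and>
     (\<exists>n a A. (\<forall>m :: nat. simple_rep (n m) (a m) (A m)) \<and>
        (\<lambda>m. \<integral>\<^sup>+ z. ennreal ((simple_fun (n m) (a m) (A m) z - f z)\<^sup>2) \<partial>lborel) \<longlonglongrightarrow> 0 \<and>
        (\<lambda>m. \<integral>\<^sup>+ \<omega>. ennreal ((simple_I2 W (n m) (a m) (A m) \<omega> - Z \<omega>)\<^sup>2) \<partial>M) \<longlonglongrightarrow> 0)"

definition I2 ::
    "'a measure \<Rightarrow> (real set \<Rightarrow> 'a \<Rightarrow> real) \<Rightarrow> (real \<times> real \<Rightarrow> real) \<Rightarrow> 'a \<Rightarrow> real" where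
  "I2 M W f = (SOME Z. has_I2 M W f Z)"

definition pos_powr :: "real \<Rightarrow> real \<Rightarrow> real" where
  "pos_powr u a = (if u > 0 then u powr a else 0)"

definition rosenblatt_K :: "real \<Rightarrow> real \<Rightarrow> real \<Rightarrow> real \<Rightarrow> real \<Rightarrow> real" where
  "rosenblatt_K h1 h2 s x y =
     pos_powr (s - x) (h1 / 2 - 1) * pos_powr (s - y) (h2 / 2 - 1) +
     pos_powr (s - x) (h2 / 2 - 1) * pos_powr (s - y) (h1 / 2 - 1)"

text \<open>
  The inner integral diverges at the points \<open>(x, x)\<close> with \<open>0 \<le> x < t\<close>, where the Lebesgue integral
  takes the value 0 by convention. This is a null set of the plane.
\<close>

definition rosenblatt_kernel :: "real \<Rightarrow> real \<Rightarrow> real \<Rightarrow> real \<times> real \<Rightarrow> real" where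
  "rosenblatt_kernel h1 h2 t = (\<lambda>(x, y). LBINT s:{0..t}. rosenblatt_K h1 h2 s x y)"

definition gen_rosenblatt ::
    "'a measure \<Rightarrow> (real set \<Rightarrow> 'a \<Rightarrow> real) \<Rightarrow> real \<Rightarrow> real \<Rightarrow> real \<Rightarrow> 'a \<Rightarrow> real" where
  "gen_rosenblatt M W h1 h2 t = I2 M W (rosenblatt_kernel h1 h2 t)"

definition multifractional_rosenblatt ::
    "'a measure \<Rightarrow> (real set \<Rightarrow> 'a \<Rightarrow> real) \<Rightarrow> (real \<Rightarrow> real) \<Rightarrow> (real \<Rightarrow> real) \<Rightarrow> real \<Rightarrow> 'a \<Rightarrow> real" where
  "multifractional_rosenblatt M W H1 H2 t = gen_rosenblatt M W (H1 t) (H2 t) t"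

definition modification_on ::
    "'a measure \<Rightarrow> real set \<Rightarrow> (real \<Rightarrow> 'a \<Rightarrow> real) \<Rightarrow> (real \<Rightarrow> 'a \<Rightarrow> real) \<Rightarrow> bool" where
  "modification_on M S X X' \<longleftrightarrow>
     (\<forall>t\<in>S. X' t \<in> borel_measurable M \<and> (AE \<omega> in M. X' t \<omega> = X t \<omega>))"

definition holder_continuous_on :: "real \<Rightarrow> real set \<Rightarrow> (real \<Rightarrow> real) \<Rightarrow> bool" where
  "holder_continuous_on \<alpha> S f \<longleftrightarrow>
     (\<exists>C. \<forall>s\<in>S. \<forall>t\<in>S. \<bar>f t - f s\<bar> \<le> C * \<bar>t - s\<bar> powr \<alpha>)"

end

theory Submission
  imports Defs "HOL-Real_Asymp.Real_Asymp"
begin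

text \<open>
  Hypercontractivity of the second Wiener chaos turns \<open>L\<^sup>2\<close> bounds on the kernels into bounds on all
  even moments of \<open>X\<^sub>t - X\<^sub>s\<close>. For simple integrands it is proved by adding one Gaussian at a time:
  with \<open>\<xi>\<close> independent of \<open>(R, L)\<close>, the binomial formula gives
  \<open>E (R + \<xi> L)\<^sup>2\<^sup>p \<le> E (R\<^sup>2 + K v L\<^sup>2)\<^sup>p\<close>, and Minkowski's inequality separates the two terms; Fatou's lemma
  carries the estimate over to the closure.

  On the kernel side, let \<open>l\<^sub>i\<close> and \<open>u\<^sub>i\<close> be slightly smaller and larger than all exponents
  \<open>H\<^sub>i(t)/2 - 1\<close>. Powers with these exponents, and the difference quotients in \<open>H\<^sub>i\<close>, whose logarithm
  is absorbed by the margin, are all dominated by \<open>w\<^bsup>l\<^esup> + w\<^bsup>u\<^esup>\<close> with the matching index. Hence only the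
  finitely many kernels \<open>(s-x)\<^sup>a (s-y)\<^sup>b\<close> with \<open>a, b\<close> among \<open>l\<^sub>i, u\<^sub>i\<close> matter, and Tonelli's theorem bounds
  their energy over \<open>[s, t]\<close> by \<open>C (t - s)\<^bsup>2a+2b+4\<^esup>\<close>. Since \<open>\<gamma>\<close> exceeds the largest index, the variation
  of \<open>H\<^sub>i\<close> contributes no more than that. Kolmogorov's criterion with a high moment yields every order
  below the smallest index.
\<close>

section \<open>Moments of Gaussian quadratic forms\<close>

text \<open>Second moments alone are too weak: if \<open>E (X_t - X_s)^2\<close> is of order
  \<open>|t - s|^q\<close>, with \<open>q\<close> close to twice the smallest index, Kolmogorov's
  criterion only yields orders below \<open>(q - 1) / 2\<close>. Moments of order \<open>2p\<close>
  yield \<open>(q - 1/p) / 2\<close>, and the loss vanishes as \<open>p\<close> grows. The integral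
  is chosen from the closure of a graph, so its existence and its linearity have to be earned.
  Existence rests on the density of off-diagonal simple functions, proved for nonnegative
  integrands, which covers the Rosenblatt kernels. Linearity is bypassed: the moment bound is proved
  directly for the difference of two integrals. For simple integrands over unrelated families of
  sets this takes a common refinement into atoms, under which the integral is unchanged almost
  surely. The exponents \<open>a\<close>, \<open>b\<close> stay in \<open>(-3/4, -1/2)\<close>:
  below \<open>-1/2\<close> the function \<open>w^(2a)\<close> is integrable at infinity, above
  \<open>-3/4\<close> the function \<open>|u - v|^(2a + 2b + 2)\<close> is integrable across
  \<open>u = v\<close>.\<close>

lemma convex_power_ineq:
  fixes a b x y :: real
  assumes "0 \<le> a" "0 \<le> b" "0 < x" "0 < y"
  shows "(a + b) ^ p \<le> (x + y) ^ p * (x / (x + y) * (a / x) ^ p + y / (x + y) * (b / y) ^ p)"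
proof (cases "p = 0")
  case True
  then show ?thesis using assms by (simp add: add_divide_distrib[symmetric])
next
  case False
  have c: "convex_on {0..} (\<lambda>u::real. u ^ p)"
  proof (rule f''_ge0_imp_convex)
    show "((\<lambda>u::real. u ^ p) has_real_derivative real p * u ^ (p - 1)) (at u)" for u
      by (auto intro!: derivative_eq_intros)
    show "((\<lambda>u::real. real p * u ^ (p - 1)) has_real_derivative real p * (real (p - 1) * u ^ (p - 1 - 1))) (at u)" for u
      by (auto intro!: derivative_eq_intros)
  qed auto
  \<comment> \<open>Convexity is applied at the points \<open>a / x\<close> and \<open>b / y\<close>
    with weights \<open>x / (x + y)\<close> and \<open>y / (x + y)\<close>; their weighted mean is
    \<open>(a + b) / (x + y)\<close>.\<close>
  have "(x / (x + y) * (a / x) + y / (x + y) * (b / y)) ^ p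
      \<le> x / (x + y) * (a / x) ^ p + y / (x + y) * (b / y) ^ p"
    using convex_onD[OF c, of "y / (x + y)" "a / x" "b / y"] assms
    by (simp add: field_simps) 
  moreover have "x / (x + y) * (a / x) + y / (x + y) * (b / y) = (a + b) / (x + y)"
    using assms by (simp add: add_divide_distrib)
  ultimately have "(a + b) ^ p / (x + y) ^ p \<le> x / (x + y) * (a / x) ^ p + y / (x + y) * (b / y) ^ p"
    by (simp add: power_divide)
  then show ?thesis
    using assms by (subst (asm) pos_divide_le_eq) (auto simp: mult.commute)
qed

lemma nn_integral_power_zero_imp_AE:
  assumes [measurable]: "U \<in> borel_measurable M" and "(\<integral>\<^sup>+x. ennreal (U x ^ p) \<partial>M) \<le> ennreal (0 ^ p)"
    and "p > 0" "\<And>x. 0 \<le> (U x :: real)"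
  shows "AE x in M. U x = 0"
proof -
  have "(\<integral>\<^sup>+x. ennreal (U x ^ p) \<partial>M) = 0"
    using assms by (simp add: power_0_left)
  then have "AE x in M. ennreal (U x ^ p) = 0"
    by (subst (asm) nn_integral_0_iff_AE) auto
  then show ?thesis
    using assms(3,4) by (auto simp: ennreal_eq_0_iff power_le_zero_eq intro: antisym)
qed

text \<open>Minkowski's inequality in \<open>L^p\<close>, with \<open>A\<close> and \<open>B\<close>
  as bounds for the two norms; writing the bounds as powers avoids roots and integrability
  assumptions. The pointwise convexity inequality is used with the constants \<open>A\<close> and
  \<open>B\<close> as weights, so that it integrates term by term.\<close>

lemma nn_integral_Minkowski_power:
  fixes U V :: "'a \<Rightarrow> real"
  assumes [measurable]: "U \<in> borel_measurable M" "V \<in> borel_measurable M"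
    and nonneg: "\<And>x. 0 \<le> U x" "\<And>x. 0 \<le> V x" "0 \<le> A" "0 \<le> B" and "0 < p"
    and U: "(\<integral>\<^sup>+x. ennreal (U x ^ p) \<partial>M) \<le> ennreal (A ^ p)"
    and V: "(\<integral>\<^sup>+x. ennreal (V x ^ p) \<partial>M) \<le> ennreal (B ^ p)"
  shows "(\<integral>\<^sup>+x. ennreal ((U x + V x) ^ p) \<partial>M) \<le> ennreal ((A + B) ^ p)"
proof -
  consider "A = 0" | "B = 0" | "0 < A" "0 < B" using nonneg by fastforce
  then show ?thesis
  proof cases
    case 1
    then have "AE x in M. U x = 0"
      using nn_integral_power_zero_imp_AE[of U M p] U nonneg \<open>0 < p\<close> by auto
    then have "(\<integral>\<^sup>+x. ennreal ((U x + V x) ^ p) \<partial>M) = (\<integral>\<^sup>+x. ennreal (V x ^ p) \<partial>M)"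
      by (intro nn_integral_cong_AE) auto
    with V 1 show ?thesis by simp
  next
    case 2
    then have "AE x in M. V x = 0"
      using nn_integral_power_zero_imp_AE[of V M p] V nonneg \<open>0 < p\<close> by auto
    then have "(\<integral>\<^sup>+x. ennreal ((U x + V x) ^ p) \<partial>M) = (\<integral>\<^sup>+x. ennreal (U x ^ p) \<partial>M)"
      by (intro nn_integral_cong_AE) auto
    with U 2 show ?thesis by simp
  next
    case 3
    \<comment> \<open>These are the coefficients of \<open>U x ^ p\<close> and
      \<open>V x ^ p\<close> when \<open>convex_power_ineq\<close> is used with weights
      \<open>A\<close> and \<open>B\<close>. They satisfy
      \<open>c * A ^ p + d * B ^ p = (A + B) ^ p\<close>. The division by \<open>A\<close> and
      \<open>B\<close> is why a vanishing bound is treated separately.\<close>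
    define c where "c = (A + B) ^ p * (A / (A + B)) / A ^ p"
    define d where "d = (A + B) ^ p * (B / (A + B)) / B ^ p"
    have cd: "0 \<le> c" "0 \<le> d" using 3 by (auto simp: c_def d_def)
    have "(U x + V x) ^ p \<le> c * U x ^ p + d * V x ^ p" for x
      using convex_power_ineq[OF nonneg(1,2) 3, of x x p]
      by (simp add: c_def d_def algebra_simps power_divide)
    then have "(\<integral>\<^sup>+x. ennreal ((U x + V x) ^ p) \<partial>M) \<le> (\<integral>\<^sup>+x. ennreal (c * U x ^ p + d * V x ^ p) \<partial>M)"
      by (intro nn_integral_mono) (auto intro!: ennreal_leI)
    also have "\<dots> = (\<integral>\<^sup>+x. ennreal c * ennreal (U x ^ p) + ennreal d * ennreal (V x ^ p) \<partial>M)"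
      using cd nonneg by (intro nn_integral_cong) (auto simp: ennreal_mult ennreal_plus)
    also have "\<dots> = ennreal c * (\<integral>\<^sup>+x. ennreal (U x ^ p) \<partial>M) + ennreal d * (\<integral>\<^sup>+x. ennreal (V x ^ p) \<partial>M)"
      by (subst nn_integral_add) (auto simp: nn_integral_cmult)
    also have "\<dots> \<le> ennreal c * ennreal (A ^ p) + ennreal d * ennreal (B ^ p)"
      by (intro add_mono mult_left_mono U V) auto
    also have "\<dots> = ennreal (c * A ^ p + d * B ^ p)"
      using cd 3 by (simp add: ennreal_mult ennreal_plus)
    also have "c * A ^ p + d * B ^ p = (A + B) ^ p * (A / (A + B) + B / (A + B))"
      using 3 by (simp add: c_def d_def distrib_left)
    also have "\<dots> = (A + B) ^ p"
      using 3 by (simp add: add_divide_distrib[symmetric])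
    finally show ?thesis .
  qed
qed

text \<open>Only the moments of the centred Gaussian law are recorded;
  \<open>fact (2 * k) / (2 ^ k * fact k)\<close> is the double factorial \<open>(2k - 1)!!\<close>.
  This form includes \<open>v = 0\<close>, so sets of measure zero obey the same estimates as all
  others.\<close>

definition gaussian_moments :: "'a measure \<Rightarrow> real \<Rightarrow> ('a \<Rightarrow> real) \<Rightarrow> bool" where
  "gaussian_moments M v X \<longleftrightarrow> X \<in> borel_measurable M \<and> 0 \<le> v \<and>
     (\<forall>k. has_bochner_integral M (\<lambda>\<omega>. X \<omega> ^ (2 * k)) (fact (2 * k) / (2 ^ k * fact k) * v ^ k)) \<and>
     (\<forall>k. has_bochner_integral M (\<lambda>\<omega>. X \<omega> ^ (2 * k + 1)) 0)"

text \<open>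
  A crude constant: all that is used is \<open>1 \<le> K\<close> and that \<open>K\<close> dominates each
  \<open>(2p choose 2k) E N\<^sup>2\<^sup>k\<close> for a standard Gaussian \<open>N\<close>.
\<close>

definition hyper_const :: "nat \<Rightarrow> real" where
  "hyper_const p = (\<Sum>k\<le>p. real ((2 * p) choose (2 * k)) * (fact (2 * k) / (2 ^ k * fact k)))"

lemma sum_even_terms:
  fixes f :: "nat \<Rightarrow> 'b::comm_monoid_add"
  assumes "\<And>k. f (2 * k + 1) = 0"
  shows "(\<Sum>j\<le>2 * p. f j) = (\<Sum>k\<le>p. f (2 * k))"
proof (induction p)
  case (Suc p)
  have "(\<Sum>j\<le>2 * Suc p. f j) = (\<Sum>j\<le>2 * p. f j) + f (2 * p + 1) + f (2 * Suc p)"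
    by (simp add: add.assoc)
  then show ?case using Suc assms by simp
qed simp

lemma hyper_const_ge: "k \<le> p \<Longrightarrow> real ((2 * p) choose (2 * k)) * (fact (2 * k) / (2 ^ k * fact k)) \<le> hyper_const p"
  unfolding hyper_const_def by (intro member_le_sum) auto

lemma hyper_const_ge_1: "1 \<le> hyper_const p"
  using hyper_const_ge[of 0 p] by simp

text \<open>Odd moments vanish, so the expansion of the left side keeps only its even terms. These
  are compared one by one with the binomial expansion of the right side, whose \<open>k\<close>-th
  term carries \<open>(p choose k) * hyper_const p ^ k\<close>.\<close>

lemma gaussian_moments_binomial:
  assumes X: "gaussian_moments M v X"
  shows "(\<integral>\<^sup>+\<omega>. ennreal ((r + X \<omega> * l) ^ (2 * p)) \<partial>M) \<le> ennreal ((r\<^sup>2 + hyper_const p * v * l\<^sup>2) ^ p)"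
proof -
  define m where "m j = (if even j then fact j / (2 ^ (j div 2) * fact (j div 2)) * v ^ (j div 2) else 0 :: real)" for j
  have hb: "has_bochner_integral M (\<lambda>\<omega>. X \<omega> ^ j) (m j)" for j
  proof (cases "even j")
    case True
    then obtain k where "j = 2 * k" by (auto elim: evenE)
    then show ?thesis using X by (simp add: gaussian_moments_def m_def)
  next
    case False
    then obtain k where "j = 2 * k + 1" by (auto elim: oddE)
    then show ?thesis using X by (simp add: gaussian_moments_def m_def)
  qed
  have v: "0 \<le> v" using X by (simp add: gaussian_moments_def)
  define c where "c j = real ((2 * p) choose j) * l ^ j * r ^ (2 * p - j)" for j
  have "has_bochner_integral M (\<lambda>\<omega>. \<Sum>j\<le>2 * p. c j * X \<omega> ^ j) (\<Sum>j\<le>2 * p. c j * m j)"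
    by (intro has_bochner_integral_sum has_bochner_integral_mult_right hb)
  also have "(\<lambda>\<omega>. \<Sum>j\<le>2 * p. c j * X \<omega> ^ j) = (\<lambda>\<omega>. (r + X \<omega> * l) ^ (2 * p))"
    by (subst add.commute, subst binomial_ring) (simp add: c_def power_mult_distrib ac_simps)
  finally have "(\<integral>\<^sup>+\<omega>. ennreal ((r + X \<omega> * l) ^ (2 * p)) \<partial>M) = ennreal (\<Sum>j\<le>2 * p. c j * m j)"
    by (subst nn_integral_eq_integral)
       (auto simp: has_bochner_integral_iff power_mult)
  also have "(\<Sum>j\<le>2 * p. c j * m j) = (\<Sum>k\<le>p. c (2 * k) * m (2 * k))"
    by (rule sum_even_terms) (simp add: m_def)
  also have "\<dots> \<le> (\<Sum>k\<le>p. real (p choose k) * (hyper_const p * v * l\<^sup>2) ^ k * (r\<^sup>2) ^ (p - k))"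
  proof (rule sum_mono)
    fix k assume k: "k \<in> {..p}"
    define q where "q = real ((2 * p) choose (2 * k)) * (fact (2 * k) / (2 ^ k * fact k))"
    \<comment> \<open>For \<open>k > 0\<close> the constant is below its own \<open>k\<close>-th
      power, being at least 1. For \<open>k = 0\<close> that comparison may fail, but both sides
      equal 1.\<close>
    have q: "q \<le> real (p choose k) * hyper_const p ^ k"
    proof (cases "k = 0")
      case True then show ?thesis by (simp add: q_def)
    next
      case False
      have "q \<le> hyper_const p" using k hyper_const_ge[of k p] by (simp add: q_def)
      also have "\<dots> \<le> hyper_const p ^ k"
        using False hyper_const_ge_1[of p] by (intro self_le_power) auto
      also have "\<dots> \<le> real (p choose k) * hyper_const p ^ k"
        using k hyper_const_ge_1[of p] by (auto intro!: mult_right_mono[of 1, simplified] simp: Suc_le_eq)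
      finally show ?thesis .
    qed
    have "c (2 * k) * m (2 * k) = q * (v ^ k * l\<^sup>2 ^ k * r\<^sup>2 ^ (p - k))"
      by (simp add: c_def m_def q_def power_mult[symmetric] right_diff_distrib')
    also have "\<dots> \<le> (real (p choose k) * hyper_const p ^ k) * (v ^ k * l\<^sup>2 ^ k * r\<^sup>2 ^ (p - k))"
      using v by (intro mult_right_mono q) auto
    finally show "c (2 * k) * m (2 * k) \<le> real (p choose k) * (hyper_const p * v * l\<^sup>2) ^ k * (r\<^sup>2) ^ (p - k)"
      by (simp add: power_mult_distrib mult.assoc)
  qed
  also have "\<dots> = (hyper_const p * v * l\<^sup>2 + r\<^sup>2) ^ p"
    by (subst binomial_ring) simp
  finally show ?thesis by (simp add: add.commute ennreal_leI)
qed

section \<open>Adding independent Gaussians one at a time\<close>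

context prob_space
begin

text \<open>The joint law of independent variables is a product measure, so Tonelli's theorem allows
  \<open>X\<close> to be integrated out first, with \<open>Y\<close> frozen.\<close>

lemma nn_integral_indep_pair:
  assumes ind: "indep_var N Y N' X" and F[measurable]: "F \<in> borel_measurable (N \<Otimes>\<^sub>M N')"
  shows "(\<integral>\<^sup>+\<omega>. F (Y \<omega>, X \<omega>) \<partial>M) = (\<integral>\<^sup>+\<omega>. (\<integral>\<^sup>+\<omega>'. F (Y \<omega>, X \<omega>') \<partial>M) \<partial>M)"
proof -
  from ind have [measurable]: "random_variable N Y" "random_variable N' X"
    and eq: "distr M N Y \<Otimes>\<^sub>M distr M N' X = distr M (N \<Otimes>\<^sub>M N') (\<lambda>x. (Y x, X x))"
    by (auto simp: indep_var_distribution_eq)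
  interpret X: prob_space "distr M N' X" by (rule prob_space_distr) simp
  have "(\<integral>\<^sup>+\<omega>. F (Y \<omega>, X \<omega>) \<partial>M) = (\<integral>\<^sup>+z. F z \<partial>distr M (N \<Otimes>\<^sub>M N') (\<lambda>x. (Y x, X x)))"
    by (subst nn_integral_distr) auto
  also have "\<dots> = (\<integral>\<^sup>+z. F z \<partial>(distr M N Y \<Otimes>\<^sub>M distr M N' X))"
    by (simp add: eq)
  also have "\<dots> = (\<integral>\<^sup>+y. \<integral>\<^sup>+x. F (y, x) \<partial>distr M N' X \<partial>distr M N Y)"
    by (subst X.nn_integral_fst[symmetric]) (auto cong: measurable_cong_sets)
  also have "\<dots> = (\<integral>\<^sup>+y. \<integral>\<^sup>+\<omega>'. F (y, X \<omega>') \<partial>M \<partial>distr M N Y)"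
    by (intro nn_integral_cong, subst nn_integral_distr) auto
  also have "\<dots> = (\<integral>\<^sup>+\<omega>. (\<integral>\<^sup>+\<omega>'. F (Y \<omega>, X \<omega>') \<partial>M) \<partial>M)"
    by (subst nn_integral_distr) auto
  finally show ?thesis .
qed

text \<open>\<open>Y\<close> carries the Gaussians already treated and \<open>Z\<close> the new one.
  Integrating out \<open>Z\<close> leaves \<open>R^2 + c L^2\<close> with
  \<open>c = hyper_const p * v\<close>. The hypotheses say that \<open>R^2\<close> and
  \<open>L^2\<close> have \<open>L^p\<close> norms at most \<open>A\<close> and \<open>B\<close>, so
  Minkowski's inequality for these squares gives \<open>A + c B\<close>.\<close>

lemma hypercontractive_step:
  assumes ind: "indep_var N Y N' Z" and X: "gaussian_moments M v (\<lambda>\<omega>. X (Z \<omega>))"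
    and [measurable]: "X \<in> borel_measurable N'" "R \<in> borel_measurable N" "L \<in> borel_measurable N"
    and AB: "0 \<le> A" "0 \<le> B" and "0 < p"
    and R: "(\<integral>\<^sup>+\<omega>. ennreal (R (Y \<omega>) ^ (2 * p)) \<partial>M) \<le> ennreal (A ^ p)"
    and L: "(\<integral>\<^sup>+\<omega>. ennreal (L (Y \<omega>) ^ (2 * p)) \<partial>M) \<le> ennreal (B ^ p)"
  shows "(\<integral>\<^sup>+\<omega>. ennreal ((R (Y \<omega>) + X (Z \<omega>) * L (Y \<omega>)) ^ (2 * p)) \<partial>M)
       \<le> ennreal ((A + hyper_const p * v * B) ^ p)"
proof -
  from ind have [measurable]: "random_variable N Y" "random_variable N' Z"
    by (auto simp: indep_var_distribution_eq)
  define c where "c = hyper_const p * v"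
  have c: "0 \<le> c"
    using X hyper_const_ge_1[of p] by (simp add: gaussian_moments_def c_def)
  have "(\<integral>\<^sup>+\<omega>. ennreal ((R (Y \<omega>) + X (Z \<omega>) * L (Y \<omega>)) ^ (2 * p)) \<partial>M)
      = (\<integral>\<^sup>+\<omega>. (\<integral>\<^sup>+\<omega>'. ennreal ((R (Y \<omega>) + X (Z \<omega>') * L (Y \<omega>)) ^ (2 * p)) \<partial>M) \<partial>M)"
    using nn_integral_indep_pair[OF ind, of "\<lambda>(y, x). ennreal ((R y + X x * L y) ^ (2 * p))"] by simp
  also have "\<dots> \<le> (\<integral>\<^sup>+\<omega>. ennreal (((R (Y \<omega>))\<^sup>2 + c * (L (Y \<omega>))\<^sup>2) ^ p) \<partial>M)"
    unfolding c_def by (intro nn_integral_mono gaussian_moments_binomial X)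
  also have "\<dots> \<le> ennreal ((A + c * B) ^ p)"
  proof (rule nn_integral_Minkowski_power)
    show "(\<integral>\<^sup>+\<omega>. ennreal ((R (Y \<omega>))\<^sup>2 ^ p) \<partial>M) \<le> ennreal (A ^ p)"
      using R by (simp add: power_mult)
    have "(\<integral>\<^sup>+\<omega>. ennreal ((c * (L (Y \<omega>))\<^sup>2) ^ p) \<partial>M)
        = ennreal (c ^ p) * (\<integral>\<^sup>+\<omega>. ennreal (L (Y \<omega>) ^ (2 * p)) \<partial>M)"
      using c by (subst nn_integral_cmult[symmetric])
        (auto simp: power_mult_distrib ennreal_mult power_mult)
    also have "\<dots> \<le> ennreal (c ^ p) * ennreal (B ^ p)"
      by (intro mult_left_mono L) auto
    finally show "(\<integral>\<^sup>+\<omega>. ennreal ((c * (L (Y \<omega>))\<^sup>2) ^ p) \<partial>M) \<le> ennreal ((c * B) ^ p)"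
      using c AB by (simp add: power_mult_distrib ennreal_mult)
  qed (use AB c \<open>0 < p\<close> in auto)
  finally show ?thesis by (simp add: c_def)
qed

text \<open>Induction on the number of Gaussians with the constant function \<open>L = b n\<close>:
  each step adds \<open>hyper_const p * v n * (b n)\<^sup>2\<close>. The bound is needed for the
  factor multiplying the new Gaussian in a quadratic form.\<close>

lemma gaussian_linear_moment:
  fixes X :: "nat \<Rightarrow> 'a \<Rightarrow> real"
  assumes ind: "indep_vars (\<lambda>_. borel) X UNIV" and X: "\<And>k. gaussian_moments M (v k) (X k)" and "0 < p"
  shows "(\<integral>\<^sup>+\<omega>. ennreal ((\<Sum>k<n. b k * X k \<omega>) ^ (2 * p)) \<partial>M)
       \<le> ennreal ((hyper_const p * (\<Sum>k<n. (b k)\<^sup>2 * v k)) ^ p)"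
proof (induction n)
  case 0
  then show ?case using \<open>0 < p\<close> by (simp add: power_0_left)
next
  case (Suc n)
  have v: "0 \<le> v k" for k using X[of k] by (simp add: gaussian_moments_def)
  have K: "0 \<le> hyper_const p" using hyper_const_ge_1[of p] by simp
  have "(\<integral>\<^sup>+\<omega>. ennreal (((\<lambda>f. \<Sum>k<n. b k * f k) (\<lambda>i\<in>{..<n}. X i \<omega>)
        + (\<lambda>i\<in>{n}. X i \<omega>) n * (\<lambda>f. b n) (\<lambda>i\<in>{..<n}. X i \<omega>)) ^ (2 * p)) \<partial>M)
      \<le> ennreal ((hyper_const p * (\<Sum>k<n. (b k)\<^sup>2 * v k) + hyper_const p * v n * (b n)\<^sup>2) ^ p)"
  proof (rule hypercontractive_step[OF indep_var_restrict[OF ind, of "{..<n}" "{n}"], where X = "\<lambda>f. f n" and v = "v n" and p = p])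
    show "(\<integral>\<^sup>+\<omega>. ennreal ((\<Sum>k<n. b k * (\<lambda>i\<in>{..<n}. X i \<omega>) k) ^ (2 * p)) \<partial>M)
       \<le> ennreal ((hyper_const p * (\<Sum>k<n. (b k)\<^sup>2 * v k)) ^ p)"
      using Suc by simp
    show "(\<integral>\<^sup>+\<omega>. ennreal (b n ^ (2 * p)) \<partial>M) \<le> ennreal ((b n)\<^sup>2 ^ p)"
      by (simp add: power_mult emeasure_space_1)
  qed (use v K X[of n] \<open>0 < p\<close> in \<open>auto intro!: mult_nonneg_nonneg sum_nonneg borel_measurable_sum\<close>)
  then show ?case by (simp add: algebra_simps)
qed

text \<open>Because the diagonal vanishes, the form is affine in the last Gaussian, with slope
  \<open>L = 2 * (\<Sum>k<n. a k n * X k)\<close>. The linear bound for \<open>L\<close> makes the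
  induction step add \<open>4 * K\<^sup>2 * v n * (\<Sum>k<n. (a k n)\<^sup>2 * v k)\<close> for
  \<open>K = hyper_const p\<close>. The symmetric double sum on the right grows by twice that last
  sum times \<open>v n\<close>, which is where the constant \<open>2 * K\<^sup>2\<close> comes
  from.\<close>

lemma gaussian_quadratic_moment:
  fixes X :: "nat \<Rightarrow> 'a \<Rightarrow> real"
  assumes ind: "indep_vars (\<lambda>_. borel) X UNIV" and X: "\<And>k. gaussian_moments M (v k) (X k)" and "0 < p"
    and sym: "\<And>k j. k < n \<Longrightarrow> j < n \<Longrightarrow> a k j = a j k" and diag: "\<And>k. k < n \<Longrightarrow> a k k = 0"
  shows "(\<integral>\<^sup>+\<omega>. ennreal ((\<Sum>k<n. \<Sum>j<n. a k j * X k \<omega> * X j \<omega>) ^ (2 * p)) \<partial>M)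
       \<le> ennreal ((2 * (hyper_const p)\<^sup>2 * (\<Sum>k<n. \<Sum>j<n. (a k j)\<^sup>2 * v k * v j)) ^ p)"
  using sym diag
proof (induction n)
  case 0
  then show ?case using \<open>0 < p\<close> by (simp add: power_0_left)
next
  case (Suc n)
  have v: "0 \<le> v k" for k using X[of k] by (simp add: gaussian_moments_def)
  have K: "0 \<le> hyper_const p" using hyper_const_ge_1[of p] by simp
  have rv: "X k \<in> borel_measurable M" for k using X[of k] by (simp add: gaussian_moments_def)
  let ?R = "\<lambda>f :: nat \<Rightarrow> real. \<Sum>k<n. \<Sum>j<n. a k j * f k * f j"
  let ?L = "\<lambda>f :: nat \<Rightarrow> real. \<Sum>k<n. 2 * a k n * f k"
  let ?S = "\<Sum>k<n. \<Sum>j<n. (a k j)\<^sup>2 * v k * v j"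
  have sum0: "(\<Sum>k<Suc n. \<Sum>j<Suc n. g k j) = (\<Sum>k<n. \<Sum>j<n. g k j) + (2 * (\<Sum>k<n. g k n))"
    if "\<And>k. k < n \<Longrightarrow> g n k = g k n" "g n n = 0" for g :: "nat \<Rightarrow> nat \<Rightarrow> real"
  proof -
    have "(\<Sum>j<n. g n j) = (\<Sum>k<n. g k n)" using that by (intro sum.cong) auto
    then show ?thesis using that(2) by (simp add: sum.distrib)
  qed
  have "(\<integral>\<^sup>+\<omega>. ennreal ((?R (\<lambda>i\<in>{..<n}. X i \<omega>)
        + (\<lambda>i\<in>{n}. X i \<omega>) n * ?L (\<lambda>i\<in>{..<n}. X i \<omega>)) ^ (2 * p)) \<partial>M)
      \<le> ennreal ((2 * (hyper_const p)\<^sup>2 * ?S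
          + hyper_const p * v n * (hyper_const p * (\<Sum>k<n. (2 * a k n)\<^sup>2 * v k))) ^ p)"
  proof (rule hypercontractive_step[OF indep_var_restrict[OF ind, of "{..<n}" "{n}"], where X = "\<lambda>f. f n" and v = "v n" and p = p])
    show "(\<integral>\<^sup>+\<omega>. ennreal (?R (\<lambda>i\<in>{..<n}. X i \<omega>) ^ (2 * p)) \<partial>M)
       \<le> ennreal ((2 * (hyper_const p)\<^sup>2 * ?S) ^ p)"
      using Suc by simp
    show "(\<integral>\<^sup>+\<omega>. ennreal (?L (\<lambda>i\<in>{..<n}. X i \<omega>) ^ (2 * p)) \<partial>M)
       \<le> ennreal ((hyper_const p * (\<Sum>k<n. (2 * a k n)\<^sup>2 * v k)) ^ p)"
      using gaussian_linear_moment[OF ind X \<open>0 < p\<close>, of "\<lambda>k. 2 * a k n" n] by simp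
    show "?R \<in> borel_measurable (\<Pi>\<^sub>M i\<in>{..<n}. borel)" "?L \<in> borel_measurable (\<Pi>\<^sub>M i\<in>{..<n}. borel)"
      by measurable
  qed (use v K X[of n] \<open>0 < p\<close> in \<open>auto intro!: mult_nonneg_nonneg sum_nonneg\<close>)
  also have "(\<lambda>\<omega>. ?R (\<lambda>i\<in>{..<n}. X i \<omega>) + (\<lambda>i\<in>{n}. X i \<omega>) n * ?L (\<lambda>i\<in>{..<n}. X i \<omega>))
      = (\<lambda>\<omega>. \<Sum>k<Suc n. \<Sum>j<Suc n. a k j * X k \<omega> * X j \<omega>)"
    using Suc.prems by (subst sum0) (auto simp: sum_distrib_left mult_ac intro!: sum.cong)
  also have "2 * (hyper_const p)\<^sup>2 * ?S
          + hyper_const p * v n * (hyper_const p * (\<Sum>k<n. (2 * a k n)\<^sup>2 * v k))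
      = 2 * (hyper_const p)\<^sup>2 * (\<Sum>k<Suc n. \<Sum>j<Suc n. (a k j)\<^sup>2 * v k * v j)"
    using Suc.prems by (subst sum0) (auto simp: sum_distrib_left power2_eq_square algebra_simps)
  finally show ?case .
qed

end

section \<open>Simple integrals\<close>

abbreviation (input) L2sq :: "'a measure \<Rightarrow> ('a \<Rightarrow> real) \<Rightarrow> ennreal" where
  "L2sq N f \<equiv> (\<integral>\<^sup>+x. ennreal ((f x)\<^sup>2) \<partial>N)"

text \<open>At a given point at most one of the indicators is nonzero, so all cross terms
  vanish.\<close>

lemma sum_indicator_disjoint_square:
  fixes c :: "nat \<Rightarrow> real"
  assumes "disjoint_family_on A {..<n}"
  shows "(\<Sum>k<n. c k * indicator (A k) x)\<^sup>2 = (\<Sum>k<n. (c k)\<^sup>2 * indicator (A k) x)"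
proof (cases "\<exists>i<n. x \<in> A i")
  case True
  then obtain i where i: "i < n" "x \<in> A i" by blast
  have "(\<Sum>k<n. d k * indicator (A k) x) = d i" for d :: "nat \<Rightarrow> real"
  proof -
    have "d k * indicator (A k) x = (if k = i then d k else 0)" if "k \<in> {..<n}" for k
    proof (cases "k = i")
      case False
      then have "A k \<inter> A i = {}"
        using disjoint_family_onD[OF assms that, of i] i by simp
      then show ?thesis using i False by (auto simp: indicator_def disjoint_iff)
    qed (use i in simp)
    then have "(\<Sum>k<n. d k * indicator (A k) x) = (\<Sum>k<n. if k = i then d k else 0)"
      by (intro sum.cong refl) blast
    then show ?thesis using i by simp
  qed
  then show ?thesis by simp
next
  case False
  have "(\<Sum>k<n. d k * indicator (A k) x) = 0" for d :: "nat \<Rightarrow> real"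
    using False by (intro sum.neutral ballI) (simp add: indicator_def)
  then show ?thesis by simp
qed

lemma sum_sum_factor:
  fixes a :: "'i \<Rightarrow> 'j \<Rightarrow> real"
  shows "(\<Sum>k\<in>I. \<Sum>j\<in>J. a k j * u k * v j) = (\<Sum>k\<in>I. (\<Sum>j\<in>J. a k j * v j) * u k)"
  by (intro sum.cong refl, subst sum_distrib_right, intro sum.cong refl) (simp add: mult_ac)

lemma simple_fun_square:
  assumes "simple_rep n a A"
  shows "(simple_fun n a A (x, y))\<^sup>2 = (\<Sum>k<n. \<Sum>j<n. (a k j)\<^sup>2 * indicator (A k) x * indicator (A j) y)"
proof -
  have d: "disjoint_family_on A {..<n}" using assms by (simp add: simple_rep_def)
  have eq: "simple_fun n a A (x, y) = (\<Sum>k<n. (\<Sum>j<n. a k j * indicator (A j) y) * indicator (A k) x)"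
    unfolding simple_fun_def prod.case by (rule sum_sum_factor)
  have "(simple_fun n a A (x, y))\<^sup>2 = (\<Sum>k<n. (\<Sum>j<n. (a k j)\<^sup>2 * indicator (A j) y) * indicator (A k) x)"
    unfolding eq sum_indicator_disjoint_square[OF d] ..
  then show ?thesis unfolding sum_sum_factor[of _ "\<lambda>k. indicator (A k) x"] .
qed

lemma emeasure_lborel_eq_measure:
  "emeasure lborel A < \<infinity> \<Longrightarrow> emeasure lborel A = ennreal (measure lborel A)"
  by (simp add: emeasure_eq_ennreal_measure less_top)

lemma nn_integral_rectangle:
  assumes [measurable]: "A \<in> sets borel" "B \<in> sets borel"
  shows "(\<integral>\<^sup>+z. indicator (A \<times> B) z \<partial>(lborel :: (real \<times> real) measure)) = emeasure lborel A * emeasure lborel B"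
  by (simp add: lborel_prod[symmetric] lborel.emeasure_pair_measure_Times)

lemma borel_prod_real: "(borel :: (real \<times> real) measure) = borel \<Otimes>\<^sub>M borel"
  by (rule borel_prod[symmetric])

lemma simple_fun_measurable:
  assumes "simple_rep n a A"
  shows "simple_fun n a A \<in> borel_measurable borel"
proof -
  have [measurable]: "k < n \<Longrightarrow> A k \<in> sets borel" for k using assms by (simp add: simple_rep_def)
  show ?thesis unfolding simple_fun_def borel_prod_real case_prod_beta
    by (intro borel_measurable_sum borel_measurable_times borel_measurable_const) auto
qed

text \<open>It identifies the variance sum in \<open>gaussian_quadratic_moment\<close>, taken with
  \<open>v k = measure lborel (A k)\<close>, as the squared norm of the integrand.\<close>

lemma nn_integral_simple_fun_square:
  assumes rep: "simple_rep n a A"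
  shows "(L2sq lborel (\<lambda>z. simple_fun n a A z))
    = ennreal (\<Sum>k<n. \<Sum>j<n. (a k j)\<^sup>2 * measure lborel (A k) * measure lborel (A j))"
proof -
  have A[measurable]: "A k \<in> sets borel" and fin: "emeasure lborel (A k) < \<infinity>" if "k < n" for k
    using that rep by (auto simp: simple_rep_def)
  have "ennreal ((simple_fun n a A z)\<^sup>2) = (\<Sum>k<n. \<Sum>j<n. ennreal ((a k j)\<^sup>2) * indicator (A k \<times> A j) z)" for z
  proof (cases z)
    case (Pair x y)
    have "ennreal ((simple_fun n a A z)\<^sup>2)
        = (\<Sum>k<n. \<Sum>j<n. ennreal ((a k j)\<^sup>2 * indicator (A k) x * indicator (A j) y))"
      unfolding Pair simple_fun_square[OF rep] by (subst sum_ennreal[symmetric]; auto intro!: sum_nonneg sum.cong sum_ennreal[symmetric])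
    also have "\<dots> = (\<Sum>k<n. \<Sum>j<n. ennreal ((a k j)\<^sup>2) * indicator (A k \<times> A j) z)"
      by (intro sum.cong refl) (auto simp: Pair indicator_def)
    finally show ?thesis .
  qed
  then have "(L2sq lborel (\<lambda>z. simple_fun n a A z))
      = (\<integral>\<^sup>+z. (\<Sum>k<n. \<Sum>j<n. ennreal ((a k j)\<^sup>2) * indicator (A k \<times> A j) z) \<partial>lborel)"
    by simp
  also have "\<dots> = (\<Sum>k<n. \<Sum>j<n. \<integral>\<^sup>+z. ennreal ((a k j)\<^sup>2) * indicator (A k \<times> A j) z \<partial>lborel)"
    by (subst nn_integral_sum, force intro!: borel_measurable_sum borel_measurable_times simp: borel_prod_real,
        intro sum.cong refl nn_integral_sum) (auto intro!: borel_measurable_times_ennreal borel_measurable_indicator simp: borel_prod_real)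
  also have "\<dots> = (\<Sum>k<n. \<Sum>j<n. ennreal ((a k j)\<^sup>2 * measure lborel (A k) * measure lborel (A j)))"
  proof (intro sum.cong refl)
    fix k j assume "k \<in> {..<n}" "j \<in> {..<n}"
    then have kj: "k < n" "j < n" by auto
    have m: "(indicator (A k \<times> A j) :: _ \<Rightarrow> ennreal) \<in> borel_measurable lborel"
      using kj by (intro borel_measurable_indicator) (simp add: borel_prod_real A)
    show "(\<integral>\<^sup>+z. ennreal ((a k j)\<^sup>2) * indicator (A k \<times> A j) z \<partial>lborel)
        = ennreal ((a k j)\<^sup>2 * measure lborel (A k) * measure lborel (A j))"
      using kj by (subst nn_integral_cmult[OF m], subst nn_integral_rectangle)
        (auto simp: A emeasure_lborel_eq_measure[OF fin] ennreal_mult mult.assoc)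
  qed
  also have "\<dots> = ennreal (\<Sum>k<n. \<Sum>j<n. (a k j)\<^sup>2 * measure lborel (A k) * measure lborel (A j))"
    by (subst sum_ennreal[symmetric]; auto intro!: sum_nonneg sum.cong sum_ennreal)
  finally show ?thesis .
qed

section \<open>Moments and additivity of the white noise\<close>

context white_noise
begin

lemma W_gaussian_moments:
  assumes A: "A \<in> sets borel" "emeasure lborel A < \<infinity>"
  shows "gaussian_moments M (measure lborel A) (W A)"
proof (cases "emeasure lborel A = 0")
  case True
  then have [measurable]: "W A \<in> borel_measurable M" and AE: "AE \<omega> in M. W A \<omega> = 0"
    using null[OF A(1)] by auto
  have m: "measure lborel A = 0" using True by (simp add: measure_def)
  have "has_bochner_integral M (\<lambda>\<omega>. W A \<omega> ^ k) (0 ^ k)" for k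
  proof -
    have "has_bochner_integral M (\<lambda>\<omega>. 0 ^ k :: real) (0 ^ k)"
      by (auto simp: has_bochner_integral_iff prob_space)
    then show ?thesis
      by (subst has_bochner_integral_cong_AE[where g = "\<lambda>_. 0 ^ k"]) (use AE in auto)
  qed
  note h = this
  \<comment> \<open>For \<open>k = 0\<close> both sides of the first equation are
    \<open>0 ^ 0 = 1\<close>, the total mass; for \<open>k > 0\<close> both vanish.\<close>
  have z: "(0::real) ^ (2 * k) = fact (2 * k) / (2 ^ k * fact k) * 0 ^ k" "(0::real) ^ (2 * k + 1) = 0" for k
    by (cases k) simp_all
  have "has_bochner_integral M (\<lambda>\<omega>. W A \<omega> ^ (2 * k)) (fact (2 * k) / (2 ^ k * fact k) * 0 ^ k)"
    "has_bochner_integral M (\<lambda>\<omega>. W A \<omega> ^ (2 * k + 1)) 0" for k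
    using h[of "2 * k"] h[of "2 * k + 1"] unfolding z[of k] .
  then show ?thesis unfolding gaussian_moments_def m by simp
next
  case False
  define \<sigma> where "\<sigma> = sqrt (measure lborel A)"
  have "measure lborel A > 0"
    using False A by (simp add: emeasure_lborel_eq_measure zero_less_measure_iff)
  then have \<sigma>: "0 < \<sigma>" "\<sigma>\<^sup>2 = measure lborel A" by (auto simp: \<sigma>_def)
  have D: "distributed M lborel (W A) (normal_density 0 \<sigma>)"
    unfolding \<sigma>_def using gaussian[OF A(1) _ A(2)] False by (simp add: zero_less_iff_neq_zero)
  have h: "has_bochner_integral M (\<lambda>\<omega>. W A \<omega> ^ k) c"
    if "has_bochner_integral lborel (\<lambda>x. normal_density 0 \<sigma> x * (x - 0) ^ k) c" for k c
    using that distributed_integrable[OF D, of "\<lambda>x. x ^ k"] distributed_integral[OF D, of "\<lambda>x. x ^ k"]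
    by (simp add: has_bochner_integral_iff)
  have "fact (2 * k) / ((2 / \<sigma>\<^sup>2) ^ k * fact k) = fact (2 * k) / (2 ^ k * fact k) * measure lborel A ^ k" for k
    using \<sigma> by (simp add: power_divide)
  then show ?thesis
    unfolding gaussian_moments_def
    using h[OF normal_moment_even[OF \<sigma>(1)]] h[OF normal_moment_odd[OF \<sigma>(1)]] distributed_measurable[OF D] by auto
qed

lemma W_measurable: "A \<in> sets borel \<Longrightarrow> emeasure lborel A < \<infinity> \<Longrightarrow> W A \<in> borel_measurable M"
  using W_gaussian_moments[of A] by (simp add: gaussian_moments_def)

lemma W_empty: "AE \<omega> in M. W {} \<omega> = 0"
  by (rule conjunct2[OF null]) simp_all

lemma simple_I2_measurable:
  assumes "simple_rep n a A"
  shows "simple_I2 W n a A \<in> borel_measurable M"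
  unfolding simple_I2_def using assms
  by (intro borel_measurable_sum borel_measurable_times borel_measurable_const W_measurable)
    (auto simp: simple_rep_def)

lemma simple_I2_moment:
  assumes rep: "simple_rep n a A" and p: "0 < p"
  shows "(\<integral>\<^sup>+\<omega>. ennreal (simple_I2 W n a A \<omega> ^ (2 * p)) \<partial>M)
    \<le> (ennreal (2 * (hyper_const p)\<^sup>2) * (L2sq lborel (\<lambda>z. simple_fun n a A z))) ^ p"
proof -
  define B where "B k = (if k < n then A k else {})" for k
  have B: "B k \<in> sets borel" "emeasure lborel (B k) < \<infinity>" for k
    using rep by (auto simp: simple_rep_def B_def)
  have "disjoint_family B"
    using rep by (auto simp: simple_rep_def B_def disjoint_family_on_def)
  then have ind: "indep_vars (\<lambda>_. borel) (\<lambda>k. W (B k)) UNIV"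
    using B by (intro independent) auto
  have "(\<integral>\<^sup>+\<omega>. ennreal ((\<Sum>k<n. \<Sum>j<n. a k j * W (B k) \<omega> * W (B j) \<omega>) ^ (2 * p)) \<partial>M)
       \<le> ennreal ((2 * (hyper_const p)\<^sup>2 * (\<Sum>k<n. \<Sum>j<n. (a k j)\<^sup>2 * measure lborel (B k) * measure lborel (B j))) ^ p)"
    using rep W_gaussian_moments[OF B]
    by (intro gaussian_quadratic_moment[OF ind _ p]) (auto simp: simple_rep_def)
  also have "(\<lambda>\<omega>. \<Sum>k<n. \<Sum>j<n. a k j * W (B k) \<omega> * W (B j) \<omega>) = simple_I2 W n a A"
    by (auto simp: fun_eq_iff simple_I2_def B_def intro!: sum.cong)
  also have "(\<Sum>k<n. \<Sum>j<n. (a k j)\<^sup>2 * measure lborel (B k) * measure lborel (B j))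
      = (\<Sum>k<n. \<Sum>j<n. (a k j)\<^sup>2 * measure lborel (A k) * measure lborel (A j))"
    by (auto simp: B_def intro!: sum.cong)
  finally show ?thesis
    unfolding nn_integral_simple_fun_square[OF rep]
    by (subst ennreal_mult[symmetric]; (subst ennreal_power)?) (auto intro!: sum_nonneg mult_nonneg_nonneg)
qed

text \<open>Countable additivity is applied to the sequence \<open>A, B, {}, {}, ...\<close>; almost
  surely the terms from the third on are 0, so the series is a finite sum.\<close>

lemma W_additive2:
  assumes "A \<in> sets borel" "emeasure lborel A < \<infinity>" "B \<in> sets borel" "emeasure lborel B < \<infinity>"
    and "A \<inter> B = {}"
  shows "AE \<omega> in M. W (A \<union> B) \<omega> = W A \<omega> + W B \<omega>"
proof -
  define F where "F = (\<lambda>n :: nat. if n = 0 then A else if n = 1 then B else {})"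
  have U: "(\<Union>n. F n) = A \<union> B" by (auto simp: F_def split: if_splits)
  have "emeasure lborel (A \<union> B) \<le> emeasure lborel A + emeasure lborel B"
    using assms by (intro emeasure_subadditive) auto
  also have "\<dots> < \<infinity>" using assms by simp
  finally have m: "emeasure lborel (A \<union> B) < \<infinity>" .
  have d: "disjoint_family F" "\<And>n. F n \<in> sets borel"
    using assms by (auto simp: F_def disjoint_family_on_def)
  have "AE \<omega> in M. (\<lambda>n. W (F n) \<omega>) sums W (A \<union> B) \<omega>"
    using additive[of F, unfolded U] d m by simp
  then show ?thesis using W_empty
  proof eventually_elim
    case (elim \<omega>)
    have "(\<lambda>n. W (F n) \<omega>) sums (\<Sum>n\<in>{0, 1}. W (F n) \<omega>)"
      using elim by (intro sums_finite) (auto simp: F_def)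
    from sums_unique2[OF elim(1) this] show ?case
      by (simp add: F_def)
  qed
qed

lemma W_finite_additive:
  assumes "finite I" "disjoint_family_on A I"
    and "\<And>i. i \<in> I \<Longrightarrow> A i \<in> sets borel" "\<And>i. i \<in> I \<Longrightarrow> emeasure lborel (A i) < \<infinity>"
  shows "AE \<omega> in M. W (\<Union>i\<in>I. A i) \<omega> = (\<Sum>i\<in>I. W (A i) \<omega>)"
  using assms
proof (induction I rule: finite_induct)
  case empty
  then show ?case using W_empty by simp
next
  case (insert i I)
  have Ai: "A i \<in> sets borel" "emeasure lborel (A i) < \<infinity>"
    and AI: "\<And>j. j \<in> I \<Longrightarrow> A j \<in> sets borel" "\<And>j. j \<in> I \<Longrightarrow> emeasure lborel (A j) < \<infinity>"
    using insert.prems by simp_all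
  have U: "(\<Union>j\<in>I. A j) \<in> sets borel"
    using insert.hyps(1) AI(1) by (rule sets.finite_UN)
  have "emeasure lborel (\<Union>j\<in>I. A j) \<le> (\<Sum>j\<in>I. emeasure lborel (A j))"
    using insert.hyps(1) AI(1) by (intro emeasure_subadditive_finite) auto
  also have "\<dots> < \<infinity>" using AI(2) insert.hyps(1) by (simp add: less_top)
  finally have fin: "emeasure lborel (\<Union>j\<in>I. A j) < \<infinity>" .
  have "A i \<inter> A j = {}" if "j \<in> I" for j
  proof -
    have "i \<noteq> j" using that insert.hyps(2) by blast
    then show ?thesis
      using disjoint_family_onD[OF insert.prems(1), of i j] that by simp
  qed
  then have disj: "A i \<inter> (\<Union>j\<in>I. A j) = {}" by blast
  have "AE \<omega> in M. W (\<Union>j\<in>I. A j) \<omega> = (\<Sum>j\<in>I. W (A j) \<omega>)"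
    by (rule insert.IH[OF disjoint_family_on_mono[OF subset_insertI insert.prems(1)] AI])
  with W_additive2[OF Ai U fin disj] show ?case
  proof eventually_elim
    case (elim \<omega>)
    then show ?case using insert.hyps by simp
  qed
qed

end

section \<open>Changing the representation of a simple function\<close>

lemma sum_swap_triple:
  fixes X :: "'a \<Rightarrow> 'b \<Rightarrow> 'c \<Rightarrow> 'd::comm_monoid_add"
  shows "(\<Sum>t\<in>Q. \<Sum>i\<in>I. \<Sum>j\<in>J. X t i j) = (\<Sum>i\<in>I. \<Sum>j\<in>J. \<Sum>t\<in>Q. X t i j)"
  by (subst sum.swap, intro sum.cong refl sum.swap)

lemma sum_sum_product:
  fixes b :: real
  shows "(\<Sum>s\<in>P. \<Sum>t\<in>Q. (u s * w t * b) * G s * H t) = b * (\<Sum>s\<in>P. u s * G s) * (\<Sum>t\<in>Q. w t * H t)"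
  by (simp add: sum_product sum_distrib_left mult_ac)

context white_noise
begin

text \<open>The sets \<open>S i\<close> may overlap, and the index type is arbitrary so that two
  families can be joined through a sum type. The function identity holds everywhere, the one for the
  integrals only almost surely because \<open>W\<close> is additive only almost surely.\<close>

definition offdiag_rep :: "'i set \<Rightarrow> ('i \<Rightarrow> 'i \<Rightarrow> real) \<Rightarrow> ('i \<Rightarrow> real set) \<Rightarrow>
    nat \<Rightarrow> (nat \<Rightarrow> nat \<Rightarrow> real) \<Rightarrow> (nat \<Rightarrow> real set) \<Rightarrow> bool" where
  "offdiag_rep I b S n a A \<longleftrightarrow> simple_rep n a A \<and>
    (\<forall>x y. simple_fun n a A (x, y) = (\<Sum>i\<in>I. \<Sum>j\<in>I. b i j * indicator (S i) x * indicator (S j) y)) \<and>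
    (AE \<omega> in M. simple_I2 W n a A \<omega> = (\<Sum>i\<in>I. \<Sum>j\<in>I. b i j * W (S i) \<omega> * W (S j) \<omega>))"

text \<open>Every \<open>S i\<close> is a disjoint union of atoms of the generated algebra, and
  expanding the bilinear sum over atoms gives an admissible representation. The condition
  \<open>off\<close> is what keeps the diagonal blocks of the refined representation empty.\<close>

lemma simple_rep_refinement:
  fixes S :: "'i \<Rightarrow> real set" and b :: "'i \<Rightarrow> 'i \<Rightarrow> real"
  assumes I: "finite I"
    and S: "\<And>i. i \<in> I \<Longrightarrow> S i \<in> sets borel" "\<And>i. i \<in> I \<Longrightarrow> emeasure lborel (S i) < \<infinity>"
    and sym: "\<And>i j. i \<in> I \<Longrightarrow> j \<in> I \<Longrightarrow> b i j = b j i"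
    and off: "\<And>i j. i \<in> I \<Longrightarrow> j \<in> I \<Longrightarrow> b i j \<noteq> 0 \<Longrightarrow> S i \<inter> S j = {}"
  shows "\<exists>n a A. offdiag_rep I b S n a A"
proof -
  \<comment> \<open>The atoms of the family are indexed by subsets of \<open>I\<close>; the one of the empty subset has infinite measure.\<close>
  define P where "P = Pow I - {{}}"
  define At where "At \<sigma> = {x. {i\<in>I. x \<in> S i} = \<sigma>}" for \<sigma>
  \<comment> \<open>The diagonal is set to 0 by force. For a nonempty atom the double sum would
    vanish there anyway; for an empty one it need not, but then both the indicator and, almost
    surely, the noise of the atom are 0.\<close>
  define c where "c \<sigma> \<tau> = (if \<sigma> = \<tau> then 0 else \<Sum>i\<in>I. \<Sum>j\<in>I. of_bool (i \<in> \<sigma>) * of_bool (j \<in> \<tau>) * b i j)" for \<sigma> \<tau>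
  have P: "finite P" using I by (simp add: P_def)
  then obtain h where h: "bij_betw h {..<card P} P"
    using ex_bij_betw_nat_finite[OF P] by (auto simp: atLeast0LessThan)
  define a where "a k j = c (h k) (h j)" for k j
  define A where "A k = At (h k)" for k
  have hP: "h k \<in> P" if "k < card P" for k using h that by (auto simp: bij_betw_def)
  have At_sets: "At \<sigma> \<in> sets borel" if "\<sigma> \<in> P" for \<sigma>
  proof -
    have "At \<sigma> = (\<Inter>i\<in>I. if i \<in> \<sigma> then S i else - S i)"
    proof (rule set_eqI)
      fix x
      have "\<sigma> \<subseteq> I" using that by (auto simp: P_def)
      then have "x \<in> At \<sigma> \<longleftrightarrow> (\<forall>i\<in>I. x \<in> S i \<longleftrightarrow> i \<in> \<sigma>)"
        by (auto simp: At_def)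
      then show "x \<in> At \<sigma> \<longleftrightarrow> x \<in> (\<Inter>i\<in>I. if i \<in> \<sigma> then S i else - S i)"
        by auto
    qed
    also have "\<dots> \<in> sets borel"
    proof (cases "I = {}")
      case False
      then show ?thesis using I S by (intro sets.finite_INT) auto
    qed simp
    finally show ?thesis .
  qed
  have At_fin: "emeasure lborel (At \<sigma>) < \<infinity>" if sP: "\<sigma> \<in> P" for \<sigma>
  proof -
    obtain i where i: "i \<in> \<sigma>" "i \<in> I" using sP unfolding P_def by blast
    then have "emeasure lborel (At \<sigma>) \<le> emeasure lborel (S i)"
      using S by (intro emeasure_mono) (auto simp: At_def)
    then show ?thesis using S(2)[OF i(2)] by (simp add: order_le_less_trans)
  qed
  have S_eq: "S i = (\<Union>\<sigma>\<in>{\<sigma>\<in>P. i \<in> \<sigma>}. At \<sigma>)" if "i \<in> I" for i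
  proof (rule set_eqI)
    fix x
    have "x \<in> S i \<Longrightarrow> {i\<in>I. x \<in> S i} \<in> P \<and> i \<in> {i\<in>I. x \<in> S i}"
      using that by (auto simp: P_def)
    then show "x \<in> S i \<longleftrightarrow> x \<in> (\<Union>\<sigma>\<in>{\<sigma>\<in>P. i \<in> \<sigma>}. At \<sigma>)"
      unfolding At_def by blast
  qed
  have disj: "disjoint_family_on At Q" for Q
    by (auto simp: disjoint_family_on_def At_def)
  have c_sym: "c \<sigma> \<tau> = c \<tau> \<sigma>" for \<sigma> \<tau>
  proof -
    have "(\<Sum>i\<in>I. \<Sum>j\<in>I. of_bool (i \<in> \<sigma>) * of_bool (j \<in> \<tau>) * b i j)
      = (\<Sum>i\<in>I. \<Sum>j\<in>I. of_bool (i \<in> \<tau>) * of_bool (j \<in> \<sigma>) * b i j)"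
    proof (subst sum.swap, intro sum.cong refl)
      fix i j assume "i \<in> I" "j \<in> I"
      then show "of_bool (j \<in> \<sigma>) * of_bool (i \<in> \<tau>) * b j i = of_bool (i \<in> \<tau>) * of_bool (j \<in> \<sigma>) * b i j"
        using sym[of i j] by simp
    qed
    then show ?thesis by (simp add: c_def)
  qed
  have rep: "simple_rep (card P) a A"
  proof -
    have cc: "c \<sigma> \<sigma> = 0" for \<sigma> by (simp add: c_def)
    have "inj_on h {..<card P}" using h by (auto simp: bij_betw_def)
    then have "disjoint_family_on A {..<card P}"
      unfolding disjoint_family_on_def A_def At_def by (auto dest: inj_onD)
    then show ?thesis
      using At_sets At_fin hP c_sym[of "h _" "h _"] cc unfolding simple_rep_def A_def a_def by blast
  qed
  \<comment> \<open>The regrouping is purely algebraic. It is stated for arbitrary additive values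
    \<open>g\<close>, \<open>G\<close> so that it serves both for indicators at a point and for the
    values of \<open>W\<close> at a fixed outcome. The premise \<open>Z\<close> covers the forced
    zeros of \<open>c\<close> at empty atoms.\<close>
  have key: "(\<Sum>k<card P. \<Sum>j<card P. a k j * G (h k) * G' (h j)) = (\<Sum>i\<in>I. \<Sum>j\<in>I. b i j * g i * g' j)"
    if G: "\<And>i. i \<in> I \<Longrightarrow> g i = (\<Sum>\<sigma>\<in>{\<sigma>\<in>P. i \<in> \<sigma>}. G \<sigma>)" "\<And>i. i \<in> I \<Longrightarrow> g' i = (\<Sum>\<sigma>\<in>{\<sigma>\<in>P. i \<in> \<sigma>}. G' \<sigma>)"
      and Z: "\<And>\<sigma>. \<sigma> \<in> P \<Longrightarrow> At \<sigma> = {} \<Longrightarrow> G \<sigma> = 0" for g g' :: "'i \<Rightarrow> real" and G G'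
  proof -
    have g_eq: "g i = (\<Sum>\<sigma>\<in>P. of_bool (i \<in> \<sigma>) * G \<sigma>)" "g' i = (\<Sum>\<sigma>\<in>P. of_bool (i \<in> \<sigma>) * G' \<sigma>)" if "i \<in> I" for i
      unfolding G(1)[OF that] G(2)[OF that] using P
      by (auto intro!: sum.mono_neutral_cong_left)
    have "(\<Sum>k<card P. \<Sum>j<card P. a k j * G (h k) * G' (h j)) = (\<Sum>\<sigma>\<in>P. \<Sum>\<tau>\<in>P. c \<sigma> \<tau> * G \<sigma> * G' \<tau>)"
      unfolding a_def sum.reindex_bij_betw[OF h, symmetric] ..
    also have "\<dots> = (\<Sum>\<sigma>\<in>P. \<Sum>\<tau>\<in>P. \<Sum>i\<in>I. \<Sum>j\<in>I. (of_bool (i \<in> \<sigma>) * of_bool (j \<in> \<tau>) * b i j) * G \<sigma> * G' \<tau>)"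
    proof (intro sum.cong refl)
      fix \<sigma> \<tau> assume st: "\<sigma> \<in> P" "\<tau> \<in> P"
      have cG: "c \<sigma> \<tau> * G \<sigma> = (\<Sum>i\<in>I. \<Sum>j\<in>I. of_bool (i \<in> \<sigma>) * of_bool (j \<in> \<tau>) * b i j) * G \<sigma>"
      proof (cases "\<sigma> = \<tau> \<and> At \<sigma> \<noteq> {}")
        case True
        then obtain x where x: "x \<in> At \<sigma>" by auto
        \<comment> \<open>A point of the atom lies in \<open>S i\<close> and in \<open>S j\<close>
          whenever \<open>i\<close> and \<open>j\<close> belong to \<open>\<sigma>\<close>, so
          \<open>off\<close> leaves only \<open>b i j = 0\<close>.\<close>
        have "of_bool (i \<in> \<sigma>) * of_bool (j \<in> \<sigma>) * b i j = 0" if "i \<in> I" "j \<in> I" for i j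
          using off[OF that] x by (auto simp: At_def)
        then have "(\<Sum>i\<in>I. \<Sum>j\<in>I. of_bool (i \<in> \<sigma>) * of_bool (j \<in> \<sigma>) * b i j) = 0"
          by (intro sum.neutral ballI) auto
        then show ?thesis using True unfolding c_def by simp
      next
        case False
        then have "\<sigma> \<noteq> \<tau> \<or> G \<sigma> = 0" using Z[OF st(1)] by blast
        then show ?thesis unfolding c_def by (cases "\<sigma> = \<tau>") auto
      qed
      show "c \<sigma> \<tau> * G \<sigma> * G' \<tau> = (\<Sum>i\<in>I. \<Sum>j\<in>I. (of_bool (i \<in> \<sigma>) * of_bool (j \<in> \<tau>) * b i j) * G \<sigma> * G' \<tau>)"
        unfolding cG sum_distrib_right ..
    qed
    also have "\<dots> = (\<Sum>\<sigma>\<in>P. \<Sum>i\<in>I. \<Sum>j\<in>I. \<Sum>\<tau>\<in>P. (of_bool (i \<in> \<sigma>) * of_bool (j \<in> \<tau>) * b i j) * G \<sigma> * G' \<tau>)"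
      by (intro sum.cong refl sum_swap_triple)
    also have "\<dots> = (\<Sum>i\<in>I. \<Sum>j\<in>I. \<Sum>\<sigma>\<in>P. \<Sum>\<tau>\<in>P. (of_bool (i \<in> \<sigma>) * of_bool (j \<in> \<tau>) * b i j) * G \<sigma> * G' \<tau>)"
      by (rule sum_swap_triple)
    also have "\<dots> = (\<Sum>i\<in>I. \<Sum>j\<in>I. b i j * g i * g' j)"
    proof (intro sum.cong refl)
      fix i j assume "i \<in> I" "j \<in> I"
      show "(\<Sum>\<sigma>\<in>P. \<Sum>\<tau>\<in>P. (of_bool (i \<in> \<sigma>) * of_bool (j \<in> \<tau>) * b i j) * G \<sigma> * G' \<tau>) = b i j * g i * g' j"
        unfolding g_eq(1)[OF \<open>i \<in> I\<close>] g_eq(2)[OF \<open>j \<in> I\<close>]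
        by (rule sum_sum_product)
    qed
    finally show ?thesis .
  qed
  have ind: "indicator (S i) x = (\<Sum>\<sigma>\<in>{\<sigma>\<in>P. i \<in> \<sigma>}. indicator (At \<sigma>) x :: real)" if "i \<in> I" for i x
    unfolding S_eq[OF that] by (rule indicator_UN_disjoint) (use P disj in auto)
  have fun_eq: "simple_fun (card P) a A (x, y) = (\<Sum>i\<in>I. \<Sum>j\<in>I. b i j * indicator (S i) x * indicator (S j) y)" for x y
    unfolding simple_fun_def A_def prod.case
    by (rule key[of "\<lambda>i. indicator (S i) x" "\<lambda>\<sigma>. indicator (At \<sigma>) x" "\<lambda>i. indicator (S i) y"
        "\<lambda>\<sigma>. indicator (At \<sigma>) y"])
      (simp_all only: ind empty_iff not_False_eq_True indicator_simps)
  \<comment> \<open>The exceptional set of additivity depends on \<open>i\<close>; finiteness of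
    \<open>I\<close> provides a common one.\<close>
  have "AE \<omega> in M. \<forall>i\<in>I. W (S i) \<omega> = (\<Sum>\<sigma>\<in>{\<sigma>\<in>P. i \<in> \<sigma>}. W (At \<sigma>) \<omega>)"
  proof (rule AE_finite_allI[OF I])
    fix i assume i: "i \<in> I"
    show "AE \<omega> in M. W (S i) \<omega> = (\<Sum>\<sigma>\<in>{\<sigma>\<in>P. i \<in> \<sigma>}. W (At \<sigma>) \<omega>)"
      unfolding S_eq[OF i] using P disj At_sets At_fin by (intro W_finite_additive) auto
  qed
  then have "AE \<omega> in M. simple_I2 W (card P) a A \<omega> = (\<Sum>i\<in>I. \<Sum>j\<in>I. b i j * W (S i) \<omega> * W (S j) \<omega>)"
    using W_empty
  proof eventually_elim
    case (elim \<omega>)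
    show ?case unfolding simple_I2_def A_def
      by (rule key[of "\<lambda>i. W (S i) \<omega>" "\<lambda>\<sigma>. W (At \<sigma>) \<omega>" "\<lambda>i. W (S i) \<omega>" "\<lambda>\<sigma>. W (At \<sigma>) \<omega>"]) (use elim in auto)
  qed
  with rep fun_eq show ?thesis
    unfolding offdiag_rep_def by (intro exI[of _ "card P"] exI[of _ a] exI[of _ A] conjI allI)
qed

end

section \<open>Moments and completeness for the double integral\<close>

lemma ennreal_square_add_le:
  "ennreal ((a + b)\<^sup>2) \<le> 2 * (ennreal (a\<^sup>2) + ennreal (b\<^sup>2))"
proof -
  have "(a + b)\<^sup>2 \<le> 2 * (a\<^sup>2 + b\<^sup>2)"
    using zero_le_power2[of "a - b"] by (simp add: power2_eq_square algebra_simps)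
  then have "ennreal ((a + b)\<^sup>2) \<le> ennreal (2 * (a\<^sup>2 + b\<^sup>2))" by (rule ennreal_leI)
  then show ?thesis by (simp add: ennreal_mult ennreal_plus)
qed

lemma nn_integral_square_add_le:
  assumes [measurable]: "f \<in> borel_measurable N" "g \<in> borel_measurable N"
  shows "(L2sq N (\<lambda>x. f x + g x))
    \<le> 2 * ((L2sq N (\<lambda>x. f x)) + (L2sq N (\<lambda>x. g x)))"
proof -
  have "(L2sq N (\<lambda>x. f x + g x)) \<le> (\<integral>\<^sup>+x. 2 * (ennreal ((f x)\<^sup>2) + ennreal ((g x)\<^sup>2)) \<partial>N)"
    by (intro nn_integral_mono ennreal_square_add_le)
  also have "\<dots> = 2 * ((L2sq N (\<lambda>x. f x)) + (L2sq N (\<lambda>x. g x)))"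
    by (subst nn_integral_cmult, simp, subst nn_integral_add) auto
  finally show ?thesis .
qed

lemma tendsto_ennreal_power:
  fixes f :: "nat \<Rightarrow> ennreal"
  assumes f: "f \<longlonglongrightarrow> E" and E: "E < top"
  shows "(\<lambda>m. f m ^ p) \<longlonglongrightarrow> E ^ p"
proof -
  have "(\<lambda>m. ennreal (enn2real (f m) ^ p)) \<longlonglongrightarrow> ennreal (enn2real E ^ p)"
    using E f by (intro tendsto_ennrealI tendsto_power tendsto_enn2real) auto
  moreover have "ennreal (enn2real E ^ p) = E ^ p"
    using E by (simp add: ennreal_power[symmetric])
  moreover have "eventually (\<lambda>m. ennreal (enn2real (f m) ^ p) = f m ^ p) sequentially"
    using order_tendstoD(2)[OF f E] by eventually_elim (simp add: ennreal_power[symmetric])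
  ultimately show ?thesis by (simp cong: filterlim_cong)
qed

text \<open>Fatou's lemma, with the integrals controlled by bounds that converge themselves. It
  carries every estimate below from approximations to their limits.\<close>

lemma nn_integral_limit_le:
  fixes v :: "nat \<Rightarrow> 'a \<Rightarrow> ennreal"
  assumes "\<And>m. v m \<in> borel_measurable N" and lim: "AE x in N. (\<lambda>m. v m x) \<longlonglongrightarrow> w x"
    and le: "\<And>m. (\<integral>\<^sup>+x. v m x \<partial>N) \<le> Y m" and Y: "Y \<longlonglongrightarrow> L"
  shows "(\<integral>\<^sup>+x. w x \<partial>N) \<le> L"
proof -
  have "(\<integral>\<^sup>+x. w x \<partial>N) = (\<integral>\<^sup>+x. liminf (\<lambda>m. v m x) \<partial>N)"
    using lim by (intro nn_integral_cong_AE, eventually_elim)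
      (simp add: lim_imp_Liminf[OF sequentially_bot])
  also have "\<dots> \<le> liminf (\<lambda>m. \<integral>\<^sup>+x. v m x \<partial>N)"
    by (rule nn_integral_liminf) fact
  also have "\<dots> \<le> liminf Y"
    using le by (intro Liminf_mono always_eventually allI)
  also have "\<dots> = L" using Y by (rule lim_imp_Liminf[OF sequentially_bot])
  finally show ?thesis .
qed

lemma nn_integral_tendsto_0_AE_subseq:
  fixes u :: "nat \<Rightarrow> 'a \<Rightarrow> real"
  assumes [measurable]: "\<And>m. u m \<in> borel_measurable N" and nn: "\<And>m x. 0 \<le> u m x"
    and lim: "(\<lambda>m. \<integral>\<^sup>+x. ennreal (u m x) \<partial>N) \<longlonglongrightarrow> 0"
  obtains r :: "nat \<Rightarrow> nat" where "strict_mono r" "AE x in N. (\<lambda>m. u (r m) x) \<longlonglongrightarrow> 0"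
proof -
  \<comment> \<open>Finitely many of the integrals may be infinite. Shifting the sequence by
    \<open>m0\<close> makes all its members integrable.\<close>
  obtain m0 where m0: "\<And>m. m0 \<le> m \<Longrightarrow> (\<integral>\<^sup>+x. ennreal (u m x) \<partial>N) < top"
    using order_tendstoD(2)[OF lim, of top] by (auto simp: eventually_sequentially)
  define v where "v m = u (m + m0)" for m
  have int: "integrable N (v m)" for m
    using m0[of "m + m0"] nn by (intro integrableI_nonneg) (auto simp: v_def)
  have eq: "ennreal (\<integral>x. norm (v m x) \<partial>N) = (\<integral>\<^sup>+x. ennreal (u (m + m0) x) \<partial>N)" for m
    using nn_integral_eq_integral[OF int[of m]] nn by (simp add: v_def)
  have "(\<lambda>m. ennreal (\<integral>x. norm (v m x) \<partial>N)) \<longlonglongrightarrow> 0"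
    unfolding eq using lim by (rule LIMSEQ_ignore_initial_segment)
  then have "(\<lambda>m. \<integral>x. norm (v m x) \<partial>N) \<longlonglongrightarrow> 0"
    by (subst (asm) ennreal_tendsto_0_iff) auto
  from tendsto_L1_AE_subseq[OF int this] obtain r where r: "strict_mono r"
    "AE x in N. (\<lambda>m. v (r m) x) \<longlonglongrightarrow> 0" by blast
  show ?thesis
  proof
    show "strict_mono (\<lambda>m. r m + m0)" using r(1) by (simp add: strict_mono_def)
    show "AE x in N. (\<lambda>m. u (r m + m0) x) \<longlonglongrightarrow> 0" using r(2) by (simp add: v_def)
  qed
qed

lemma tendsto_0_square_sum:
  fixes a b :: "nat \<Rightarrow> real"
  assumes "(\<lambda>m. (a m - x)\<^sup>2 + (b m - y)\<^sup>2) \<longlonglongrightarrow> 0"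
  shows "a \<longlonglongrightarrow> x" "b \<longlonglongrightarrow> y"
proof -
  have "(\<lambda>m. (a m - x)\<^sup>2) \<longlonglongrightarrow> 0"
    by (rule tendsto_sandwich[OF _ _ tendsto_const assms]) auto
  then show "a \<longlonglongrightarrow> x" by (simp add: LIM_zero_iff)
  have "(\<lambda>m. (b m - y)\<^sup>2) \<longlonglongrightarrow> 0"
    by (rule tendsto_sandwich[OF _ _ tendsto_const assms]) auto
  then show "b \<longlonglongrightarrow> y" by (simp add: LIM_zero_iff)
qed

lemma simple_rep_off_diagonal:
  assumes "simple_rep n a A" "k < n" "j < n" "a k j \<noteq> 0"
  shows "A k \<inter> A j = {}"
proof -
  have "k \<noteq> j" using assms unfolding simple_rep_def by metis
  then show ?thesis
    using assms disjoint_family_onD[of A "{..<n}" k j] by (simp add: simple_rep_def)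
qed

context white_noise
begin

text \<open>Both families are indexed by a disjoint union, with the second block of coefficients
  negated. A set of one family may overlap sets of the other, but the coefficient of such a mixed
  pair is 0, so the refinement into atoms applies and turns the difference into one simple
  integral.\<close>

lemma simple_I2_diff_moment:
  assumes rep: "simple_rep n a A" "simple_rep n' a' A'" and p: "0 < p"
  shows "(\<integral>\<^sup>+\<omega>. ennreal ((simple_I2 W n a A \<omega> - simple_I2 W n' a' A' \<omega>) ^ (2 * p)) \<partial>M)
    \<le> (ennreal (2 * (hyper_const p)\<^sup>2) *
        (L2sq lborel (\<lambda>z. simple_fun n a A z - simple_fun n' a' A' z))) ^ p"
proof -
  define I where "I = {..<n} <+> {..<n'}"
  define S where "S = case_sum A A'"
  define b where "b = case_sum (\<lambda>k. case_sum (\<lambda>j. a k j) (\<lambda>_. 0)) (\<lambda>k. case_sum (\<lambda>_. 0) (\<lambda>j. - a' k j))"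
  have sum: "(\<Sum>i\<in>I. \<Sum>j\<in>I. b i j * g (S i) * h (S j))
      = (\<Sum>k<n. \<Sum>j<n. a k j * g (A k) * h (A j)) - (\<Sum>k<n'. \<Sum>j<n'. a' k j * g (A' k) * h (A' j))"
    for g h :: "real set \<Rightarrow> real"
    by (simp add: I_def sum.Plus S_def b_def sum_negf)
  have off: "S i \<inter> S j = {}" if ij: "i \<in> I" "j \<in> I" "b i j \<noteq> 0" for i j
  proof (cases "isl i")
    case True
    then obtain k l where "i = Inl k" "j = Inl l"
      using ij(3) by (cases i; cases j) (auto simp: b_def)
    then show ?thesis
      using ij simple_rep_off_diagonal[OF rep(1), of k l] by (auto simp: I_def S_def b_def)
  next
    case False
    then obtain k l where "i = Inr k" "j = Inr l"
      using ij(3) by (cases i; cases j) (auto simp: b_def)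
    then show ?thesis
      using ij simple_rep_off_diagonal[OF rep(2), of k l] by (auto simp: I_def S_def b_def)
  qed
  have fin: "finite I" by (simp add: I_def)
  have S: "S i \<in> sets borel" "emeasure lborel (S i) < \<infinity>" if "i \<in> I" for i
    using that rep by (auto simp: I_def S_def simple_rep_def)
  have sym: "b i j = b j i" if "i \<in> I" "j \<in> I" for i j
    using that rep by (cases i; cases j) (auto simp: I_def b_def simple_rep_def)
  have "\<exists>N c B. offdiag_rep I b S N c B"
    by (rule simple_rep_refinement) (fact fin S sym off)+
  then obtain N c B where ref: "simple_rep N c B"
    "\<And>x y. simple_fun N c B (x, y) = (\<Sum>i\<in>I. \<Sum>j\<in>I. b i j * indicator (S i) x * indicator (S j) y)"
    "AE \<omega> in M. simple_I2 W N c B \<omega> = (\<Sum>i\<in>I. \<Sum>j\<in>I. b i j * W (S i) \<omega> * W (S j) \<omega>)"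
    unfolding offdiag_rep_def by blast
  have f: "simple_fun N c B z = simple_fun n a A z - simple_fun n' a' A' z" for z
  proof (cases z)
    case (Pair x y)
    show ?thesis
      unfolding Pair ref(2) sum[of "\<lambda>U. indicator U x" "\<lambda>U. indicator U y"]
      by (simp only: simple_fun_def prod.case)
  qed
  have "AE \<omega> in M. simple_I2 W n a A \<omega> - simple_I2 W n' a' A' \<omega> = simple_I2 W N c B \<omega>"
    using ref(3)
  proof eventually_elim
    case (elim \<omega>)
    show ?case
      unfolding elim sum[of "\<lambda>U. W U \<omega>" "\<lambda>U. W U \<omega>"] by (simp only: simple_I2_def)
  qed
  then have "(\<integral>\<^sup>+\<omega>. ennreal ((simple_I2 W n a A \<omega> - simple_I2 W n' a' A' \<omega>) ^ (2 * p)) \<partial>M)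
      = (\<integral>\<^sup>+\<omega>. ennreal (simple_I2 W N c B \<omega> ^ (2 * p)) \<partial>M)"
    by (intro nn_integral_cong_AE) auto
  then show ?thesis using simple_I2_moment[OF ref(1) p] unfolding f by simp
qed

text \<open>Simple integrands give \<open>2 * (hyper_const p)\<^sup>2\<close>. Comparing the
  approximations with \<open>f - g\<close> by \<open>(a + b)^2 \<le> 2 (a^2 + b^2)\<close> doubles
  it; the remaining factor 2 is slack.\<close>

definition chaos_const :: "nat \<Rightarrow> real" where
  "chaos_const p = 8 * (hyper_const p)\<^sup>2"

lemma chaos_const_pos: "0 < chaos_const p"
  using hyper_const_ge_1[of p] by (simp add: chaos_const_def)

text \<open>The estimate for differences of simple integrals passes to the closure along an almost
  surely convergent subsequence. For \<open>f = g\<close> it shows that the integral is determined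
  almost surely, so the choice made in \<open>I2\<close> is harmless.\<close>

lemma has_I2_moment:
  assumes f: "has_I2 M W f Z" and g: "has_I2 M W g Z'" and p: "0 < p"
  shows "(\<integral>\<^sup>+\<omega>. ennreal ((Z \<omega> - Z' \<omega>) ^ (2 * p)) \<partial>M)
    \<le> (ennreal (chaos_const p) * (L2sq lborel (\<lambda>z. f z - g z))) ^ p"
proof (cases "(L2sq lborel (\<lambda>z. f z - g z)) = top")
  case True
  then show ?thesis using p chaos_const_pos[of p] by (simp add: ennreal_mult_top)
next
  case False
  from f obtain n a A where r: "\<And>m. simple_rep (n m) (a m) (A m)"
    and rf: "(\<lambda>m. L2sq lborel (\<lambda>z. simple_fun (n m) (a m) (A m) z - f z)) \<longlonglongrightarrow> 0"
    and rI: "(\<lambda>m. L2sq M (\<lambda>\<omega>. simple_I2 W (n m) (a m) (A m) \<omega> - Z \<omega>)) \<longlonglongrightarrow> 0"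
    and [measurable]: "Z \<in> borel_measurable M" "f \<in> borel_measurable borel"
    unfolding has_I2_def symmetric_L2_def by blast
  from g obtain n' a' A' where r': "\<And>m. simple_rep (n' m) (a' m) (A' m)"
    and rf': "(\<lambda>m. L2sq lborel (\<lambda>z. simple_fun (n' m) (a' m) (A' m) z - g z)) \<longlonglongrightarrow> 0"
    and rI': "(\<lambda>m. L2sq M (\<lambda>\<omega>. simple_I2 W (n' m) (a' m) (A' m) \<omega> - Z' \<omega>)) \<longlonglongrightarrow> 0"
    and [measurable]: "Z' \<in> borel_measurable M" "g \<in> borel_measurable borel"
    unfolding has_I2_def symmetric_L2_def by blast
  define F where "F m = simple_fun (n m) (a m) (A m)" for m
  define F' where "F' m = simple_fun (n' m) (a' m) (A' m)" for m
  define J where "J m = simple_I2 W (n m) (a m) (A m)" for m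
  define J' where "J' m = simple_I2 W (n' m) (a' m) (A' m)" for m
  have [measurable]: "F m \<in> borel_measurable borel" "F' m \<in> borel_measurable borel"
    "J m \<in> borel_measurable M" "J' m \<in> borel_measurable M" for m
    unfolding F_def F'_def J_def J'_def
    by (auto intro: simple_fun_measurable simple_I2_measurable r r')
  \<comment> \<open>The two approximation errors are added so that a single subsequence serves both
    integrals.\<close>
  have "(\<lambda>m. (L2sq M (\<lambda>\<omega>. J m \<omega> - Z \<omega>)) + (L2sq M (\<lambda>\<omega>. J' m \<omega> - Z' \<omega>))) \<longlonglongrightarrow> 0 + 0"
    unfolding J_def J'_def by (intro tendsto_add rI rI')
  then have "(\<lambda>m. \<integral>\<^sup>+\<omega>. ennreal ((J m \<omega> - Z \<omega>)\<^sup>2 + (J' m \<omega> - Z' \<omega>)\<^sup>2) \<partial>M) \<longlonglongrightarrow> 0"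
    by (simp add: nn_integral_add ennreal_plus)
  from nn_integral_tendsto_0_AE_subseq[OF _ _ this] obtain s where s: "strict_mono s"
    and AE: "AE \<omega> in M. (\<lambda>m. (J (s m) \<omega> - Z \<omega>)\<^sup>2 + (J' (s m) \<omega> - Z' \<omega>)\<^sup>2) \<longlonglongrightarrow> 0"
    by auto
  define c where "c = ennreal (2 * (hyper_const p)\<^sup>2)"
  define D where "D = (L2sq lborel (\<lambda>z. f z - g z))"
  define E where "E m = 2 * (D + 2 * ((L2sq lborel (\<lambda>z. F (s m) z - f z))
      + (L2sq lborel (\<lambda>z. F' (s m) z - g z))))" for m
  have FE: "(L2sq lborel (\<lambda>z. F (s m) z - F' (s m) z)) \<le> E m" for m
  proof -
    have eq: "F (s m) z - F' (s m) z = (f z - g z) + ((F (s m) z - f z) + (g z - F' (s m) z))" for z by simp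
    have "(L2sq lborel (\<lambda>z. F (s m) z - F' (s m) z))
      \<le> 2 * (D + (L2sq lborel (\<lambda>z. (F (s m) z - f z) + (g z - F' (s m) z))))"
      unfolding D_def eq by (rule nn_integral_square_add_le) auto
    also have "\<dots> \<le> 2 * (D + 2 * ((L2sq lborel (\<lambda>z. F (s m) z - f z))
      + (L2sq lborel (\<lambda>z. g z - F' (s m) z))))"
      by (intro mult_left_mono add_left_mono nn_integral_square_add_le) auto
    finally show ?thesis by (simp add: E_def power2_commute[of "g _"])
  qed
  have "E \<longlonglongrightarrow> 2 * (D + 2 * (0 + 0))"
    unfolding E_def F_def F'_def
    by (intro ennreal_tendsto_cmult tendsto_add tendsto_const
        LIMSEQ_subseq_LIMSEQ[OF rf s, unfolded o_def] LIMSEQ_subseq_LIMSEQ[OF rf' s, unfolded o_def]) auto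
  then have "(\<lambda>m. c * E m) \<longlonglongrightarrow> c * (2 * D)"
    by (intro ennreal_tendsto_cmult) (auto simp: c_def)
  then have lim: "(\<lambda>m. (c * E m) ^ p) \<longlonglongrightarrow> (c * (2 * D)) ^ p"
    using False by (intro tendsto_ennreal_power) (auto simp: D_def c_def less_top[symmetric] ennreal_mult_eq_top_iff)
  have "(\<integral>\<^sup>+\<omega>. ennreal ((Z \<omega> - Z' \<omega>) ^ (2 * p)) \<partial>M) \<le> (c * (2 * D)) ^ p"
  proof (rule nn_integral_limit_le[OF _ _ _ lim])
    show "(\<lambda>\<omega>. ennreal ((J (s m) \<omega> - J' (s m) \<omega>) ^ (2 * p))) \<in> borel_measurable M" for m by measurable
    show "AE \<omega> in M. (\<lambda>m. ennreal ((J (s m) \<omega> - J' (s m) \<omega>) ^ (2 * p))) \<longlonglongrightarrow> ennreal ((Z \<omega> - Z' \<omega>) ^ (2 * p))"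
      using AE
    proof eventually_elim
      case (elim \<omega>)
      show ?case by (intro tendsto_ennrealI tendsto_power tendsto_diff tendsto_0_square_sum[OF elim])
    qed
    fix m
    have "(\<integral>\<^sup>+\<omega>. ennreal ((J (s m) \<omega> - J' (s m) \<omega>) ^ (2 * p)) \<partial>M)
      \<le> (c * (L2sq lborel (\<lambda>z. F (s m) z - F' (s m) z))) ^ p"
      unfolding J_def J'_def F_def F'_def c_def by (rule simple_I2_diff_moment[OF r r' p])
    also have "\<dots> \<le> (c * E m) ^ p"
      by (intro power_mono mult_left_mono FE) auto
    finally show "(\<integral>\<^sup>+\<omega>. ennreal ((J (s m) \<omega> - J' (s m) \<omega>) ^ (2 * p)) \<partial>M) \<le> (c * E m) ^ p" .
  qed
  also have "\<dots> \<le> (ennreal (chaos_const p) * D) ^ p"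
  proof (rule power_mono)
    have "c * (2 * D) = (c * ennreal 2) * D" by (simp add: mult.assoc)
    also have "\<dots> \<le> ennreal (chaos_const p) * D"
      unfolding c_def chaos_const_def
      by (intro mult_right_mono, subst ennreal_mult[symmetric]) (auto intro!: ennreal_leI)
    finally show "c * (2 * D) \<le> ennreal (chaos_const p) * D" .
  qed simp
  finally show ?thesis by (simp add: D_def)
qed

text \<open>The integral is built as the almost sure limit of the simple integrals
  \<open>J m\<close>. The rate \<open>16^(-m)\<close> is fast enough for the increments of
  \<open>J m\<close> to be summable almost surely, so no subsequence has to be extracted.\<close>

lemma has_I2_exists_of_fast_approximation:
  assumes f: "symmetric_L2 f" and r: "\<And>m :: nat. simple_rep (n m) (a m) (A m)"
    and fast: "\<And>m. (L2sq lborel (\<lambda>z. simple_fun (n m) (a m) (A m) z - f z)) \<le> ennreal ((1 / 16) ^ m)"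
  shows "\<exists>Z. has_I2 M W f Z"
proof -
  define F where "F m = simple_fun (n m) (a m) (A m)" for m
  define J where "J m = simple_I2 W (n m) (a m) (A m)" for m
  have [measurable]: "f \<in> borel_measurable borel" using f by (simp add: symmetric_L2_def)
  have [measurable]: "F m \<in> borel_measurable borel" "J m \<in> borel_measurable M" for m
    unfolding F_def J_def by (auto intro: simple_fun_measurable simple_I2_measurable r)
  define C where "C = 4 * (hyper_const 1)\<^sup>2"
  have C: "0 \<le> C" by (simp add: C_def)
  have diff: "(L2sq M (\<lambda>\<omega>. J m \<omega> - J l \<omega>)) \<le> ennreal (C * ((1/16)^m + (1/16)^l))" for m l
  proof -
    have "(L2sq M (\<lambda>\<omega>. J m \<omega> - J l \<omega>))
      \<le> ennreal (2 * (hyper_const 1)\<^sup>2) * (L2sq lborel (\<lambda>z. F m z - F l z))"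
      using simple_I2_diff_moment[OF r[of m] r[of l], of 1] by (simp add: J_def F_def)
    also have "(L2sq lborel (\<lambda>z. F m z - F l z)) = (L2sq lborel (\<lambda>z. (F m z - f z) + (f z - F l z)))"
      by simp
    also have "\<dots> \<le> 2 * ((L2sq lborel (\<lambda>z. F m z - f z)) + (L2sq lborel (\<lambda>z. f z - F l z)))"
      by (rule nn_integral_square_add_le) auto
    also have "\<dots> \<le> 2 * (ennreal ((1/16)^m) + ennreal ((1/16)^l))"
      using fast[of m] fast[of l] unfolding F_def power2_commute[of "f _"]
      by (intro mult_left_mono add_mono) auto
    also have "ennreal (2 * (hyper_const 1)\<^sup>2) * (2 * (ennreal ((1/16)^m) + ennreal ((1/16)^l)))
        = ennreal (2 * (hyper_const 1)\<^sup>2) * ennreal (2 * ((1/16)^m + (1/16)^l))"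
      by (subst ennreal_mult) auto
    also have "\<dots> = ennreal (C * ((1/16)^m + (1/16)^l))"
      by (subst ennreal_mult[symmetric]) (auto simp: C_def algebra_simps)
    finally show ?thesis by (simp add: mult_left_mono)
  qed
  have abs_le: "(\<integral>\<^sup>+\<omega>. ennreal \<bar>J (Suc m) \<omega> - J m \<omega>\<bar> \<partial>M) \<le> ennreal ((1 + 2 * C) * (1/2)^m)" for m
  proof -
    \<comment> \<open>Young's inequality with weight \<open>2^m\<close> trades first moments for
      second ones. A second moment of order \<open>16^(-m)\<close> then contributes
      \<open>8^(-m)\<close>, which is summable together with \<open>2^(-m)\<close>.\<close>
    have "\<bar>x\<bar> \<le> (1/2)^m + 2^m * x\<^sup>2" for x :: real
    proof -
      have "0 \<le> ((1/2)^m - \<bar>x\<bar>)\<^sup>2" by simp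
      then have "2 * (1/2)^m * \<bar>x\<bar> \<le> ((1/2)^m)\<^sup>2 + x\<^sup>2"
        by (simp add: power2_diff)
      then have "2^m * (2 * (1/2)^m * \<bar>x\<bar>) \<le> 2^m * (((1/2)^m)\<^sup>2 + x\<^sup>2)"
        by (rule mult_left_mono) simp
      moreover have "2^m * (2 * (1/2)^m * \<bar>x\<bar>) = 2 * \<bar>x\<bar>" by (simp add: power_divide)
      moreover have "2^m * (((1/2)^m)\<^sup>2 + x\<^sup>2) = (1/2)^m + 2^m * x\<^sup>2"
        by (simp add: power_divide power2_eq_square distrib_left)
      ultimately show ?thesis by linarith
    qed
    then have "(\<integral>\<^sup>+\<omega>. ennreal \<bar>J (Suc m) \<omega> - J m \<omega>\<bar> \<partial>M)
        \<le> (\<integral>\<^sup>+\<omega>. ennreal ((1/2)^m + 2^m * (J (Suc m) \<omega> - J m \<omega>)\<^sup>2) \<partial>M)"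
      by (intro nn_integral_mono ennreal_leI)
    also have "\<dots> = (\<integral>\<^sup>+\<omega>. ennreal ((1/2)^m) + ennreal (2^m) * ennreal ((J (Suc m) \<omega> - J m \<omega>)\<^sup>2) \<partial>M)"
      by (intro nn_integral_cong) (simp add: ennreal_mult ennreal_plus)
    also have "\<dots> = ennreal ((1/2)^m) + ennreal (2^m) * (L2sq M (\<lambda>\<omega>. J (Suc m) \<omega> - J m \<omega>))"
      by (subst nn_integral_add) (auto simp: nn_integral_cmult emeasure_space_1)
    also have "\<dots> \<le> ennreal ((1/2)^m) + ennreal (2^m) * ennreal (C * ((1/16)^Suc m + (1/16)^m))"
      by (intro add_left_mono mult_left_mono diff) auto
    also have "\<dots> = ennreal ((1/2)^m + 2^m * (C * ((1/16)^Suc m + (1/16)^m)))"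
      using C by (subst ennreal_mult[symmetric]) (auto intro!: ennreal_plus[symmetric])
    also have "\<dots> \<le> ennreal ((1 + 2 * C) * (1/2)^m)"
    proof (rule ennreal_leI)
      have "2^m * (C * ((1/16)^Suc m + (1/16)^m)) = C * (17/16) * (1/8)^m"
        by (simp add: power_divide field_simps flip: power_mult_distrib)
      also have "\<dots> \<le> C * 2 * (1/2)^m"
        using C by (intro mult_mono power_mono) auto
      finally show "(1/2)^m + 2^m * (C * ((1/16)^Suc m + (1/16)^m)) \<le> (1 + 2 * C) * (1/2)^m"
        by (simp add: algebra_simps)
    qed
    finally show ?thesis .
  qed
  have "(\<integral>\<^sup>+\<omega>. (\<Sum>m. ennreal \<bar>J (Suc m) \<omega> - J m \<omega>\<bar>) \<partial>M) = (\<Sum>m. \<integral>\<^sup>+\<omega>. ennreal \<bar>J (Suc m) \<omega> - J m \<omega>\<bar> \<partial>M)"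
    by (rule nn_integral_suminf) auto
  also have "\<dots> \<le> (\<Sum>m. ennreal ((1 + 2 * C) * (1/2)^m))"
    by (intro suminf_le abs_le summableI)
  also have "\<dots> < top"
    using C by (subst suminf_ennreal2) (auto intro!: summable_mult summable_geometric)
  finally have "AE \<omega> in M. (\<Sum>m. ennreal \<bar>J (Suc m) \<omega> - J m \<omega>\<bar>) \<noteq> \<infinity>"
    by (intro nn_integral_PInf_AE) auto
  then have conv: "AE \<omega> in M. (\<lambda>m. J m \<omega>) \<longlonglongrightarrow> lim (\<lambda>m. J m \<omega>)"
  proof eventually_elim
    case (elim \<omega>)
    have "summable (\<lambda>m. \<bar>J (Suc m) \<omega> - J m \<omega>\<bar>)"
      using elim by (intro summable_suminf_not_top) auto
    then have "summable (\<lambda>m. J (Suc m) \<omega> - J m \<omega>)" by (rule summable_rabs_cancel)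
    then have "(\<lambda>m. \<Sum>i<m. J (Suc i) \<omega> - J i \<omega>) \<longlonglongrightarrow> (\<Sum>i. J (Suc i) \<omega> - J i \<omega>)"
      by (rule summable_LIMSEQ)
    then have "(\<lambda>m. J m \<omega> - J 0 \<omega>) \<longlonglongrightarrow> (\<Sum>i. J (Suc i) \<omega> - J i \<omega>)"
      by (simp add: sum_lessThan_telescope[of "\<lambda>i. J i \<omega>"])
    from tendsto_add[OF this tendsto_const[of "J 0 \<omega>"]] have "convergent (\<lambda>m. J m \<omega>)"
      by (auto simp: convergent_def)
    then show ?case by (simp add: convergent_LIMSEQ_iff)
  qed
  define Z where "Z \<omega> = lim (\<lambda>m. J m \<omega>)" for \<omega>
  have [measurable]: "Z \<in> borel_measurable M" unfolding Z_def by measurable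
  \<comment> \<open>This is the Cauchy estimate \<open>diff\<close> with \<open>l\<close> sent to
    infinity by Fatou's lemma.\<close>
  have JZ: "(L2sq M (\<lambda>\<omega>. J m \<omega> - Z \<omega>)) \<le> ennreal (C * (1/16)^m)" for m
  proof (rule nn_integral_limit_le[OF _ _ diff])
    show "AE \<omega> in M. (\<lambda>l. ennreal ((J m \<omega> - J l \<omega>)\<^sup>2)) \<longlonglongrightarrow> ennreal ((J m \<omega> - Z \<omega>)\<^sup>2)"
      using conv unfolding Z_def by eventually_elim (intro tendsto_intros)
    have "(\<lambda>l. C * ((1/16)^m + (1/16)^l)) \<longlonglongrightarrow> C * ((1/16)^m + 0)"
      by (intro tendsto_intros LIMSEQ_power_zero) auto
    then show "(\<lambda>l. ennreal (C * ((1/16)^m + (1/16)^l))) \<longlonglongrightarrow> ennreal (C * (1/16)^m)"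
      by (intro tendsto_ennrealI) simp
  qed auto
  have "(\<lambda>m. C * (1/16)^m) \<longlonglongrightarrow> C * 0" by (intro tendsto_intros LIMSEQ_power_zero) auto
  then have C0: "(\<lambda>m. ennreal (C * (1/16)^m)) \<longlonglongrightarrow> 0"
    using tendsto_ennrealI by fastforce
  have I_lim: "(\<lambda>m. L2sq M (\<lambda>\<omega>. J m \<omega> - Z \<omega>)) \<longlonglongrightarrow> 0"
    by (rule tendsto_sandwich[OF _ _ tendsto_const C0]) (auto intro!: always_eventually JZ)
  have "(\<lambda>m. (1/16::real)^m) \<longlonglongrightarrow> 0" by (intro LIMSEQ_power_zero) auto
  then have C0': "(\<lambda>m. ennreal ((1/16)^m)) \<longlonglongrightarrow> 0"
    using tendsto_ennrealI by fastforce
  have F_lim: "(\<lambda>m. L2sq lborel (\<lambda>z. F m z - f z)) \<longlonglongrightarrow> 0"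
    by (rule tendsto_sandwich[OF _ _ tendsto_const C0']) (auto intro!: always_eventually fast simp: F_def)
  have "integrable M (\<lambda>\<omega>. (Z \<omega>)\<^sup>2)"
  proof (rule integrableI_nonneg)
    have "(L2sq M (\<lambda>\<omega>. Z \<omega>)) = (L2sq M (\<lambda>\<omega>. J 0 \<omega> + (Z \<omega> - J 0 \<omega>)))" by simp
    also have "\<dots> \<le> 2 * ((L2sq M (\<lambda>\<omega>. J 0 \<omega>)) + (L2sq M (\<lambda>\<omega>. Z \<omega> - J 0 \<omega>)))"
      by (rule nn_integral_square_add_le) auto
    also have "\<dots> < \<infinity>"
    proof -
      have "(L2sq M (\<lambda>\<omega>. J 0 \<omega>)) \<le> ennreal (2 * (hyper_const 1)\<^sup>2) * (L2sq lborel (\<lambda>z. F 0 z))"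
        using simple_I2_moment[OF r[of 0], of 1] by (simp add: J_def F_def)
      also have "\<dots> < top"
        unfolding F_def nn_integral_simple_fun_square[OF r] by (simp add: ennreal_mult_less_top)
      finally have "(L2sq M (\<lambda>\<omega>. J 0 \<omega>)) < top" .
      moreover have "(L2sq M (\<lambda>\<omega>. Z \<omega> - J 0 \<omega>)) < top"
        using JZ[of 0] by (simp add: power2_commute[of "Z _"] order_le_less_trans)
      ultimately show ?thesis by (simp add: ennreal_mult_less_top)
    qed
    finally show "(L2sq M (\<lambda>\<omega>. Z \<omega>)) < \<infinity>" .
  qed auto
  then have "has_I2 M W f Z"
    unfolding has_I2_def using f r F_lim I_lim unfolding F_def J_def
    by (intro conjI exI[of _ n] exI[of _ a] exI[of _ A]) auto
  then show ?thesis by (rule exI[of _ Z])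
qed

end

section \<open>Approximation by off-diagonal simple functions\<close>

text \<open>Neither symmetry nor disjointness across different rectangles is demanded, only that the
  two sides of each rectangle be disjoint. This makes the class a vector space, in which density is
  easy to prove. Symmetry is restored by averaging and disjointness by refinement, both only at the
  end.\<close>

inductive offdiag :: "(real \<times> real \<Rightarrow> real) \<Rightarrow> bool" where
  offdiag_zero: "offdiag (\<lambda>_. 0)"
| offdiag_step: "offdiag g \<Longrightarrow> A \<in> sets borel \<Longrightarrow> emeasure lborel A < \<infinity> \<Longrightarrow>
    B \<in> sets borel \<Longrightarrow> emeasure lborel B < \<infinity> \<Longrightarrow> A \<inter> B = {} \<Longrightarrow>
    offdiag (\<lambda>z. g z + c * indicator (A \<times> B) z)"

lemma borel_rectangle[measurable]:
  "A \<in> sets borel \<Longrightarrow> B \<in> sets borel \<Longrightarrow> A \<times> B \<in> sets (borel :: (real \<times> real) measure)"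
  unfolding borel_prod_real by (rule pair_measureI)

lemma offdiag_measurable: "offdiag g \<Longrightarrow> g \<in> borel_measurable borel"
  by (induction rule: offdiag.induct) auto

lemma offdiag_add:
  assumes "offdiag h" "offdiag g" shows "offdiag (\<lambda>z. g z + h z)"
  using assms(1)
proof (induction rule: offdiag.induct)
  case offdiag_zero
  then show ?case using assms(2) by simp
next
  case (offdiag_step h A B c)
  from offdiag.offdiag_step[OF offdiag_step.IH offdiag_step.hyps(2-6), of c]
  show ?case by (simp add: add.assoc)
qed

lemma offdiag_scale:
  assumes "offdiag h" shows "offdiag (\<lambda>z. r * h z)"
  using assms
proof (induction rule: offdiag.induct)
  case offdiag_zero
  then show ?case by (simp add: offdiag.offdiag_zero)
next
  case (offdiag_step h A B c)
  from offdiag.offdiag_step[OF offdiag_step.IH offdiag_step.hyps(2-6), of "r * c"]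
  show ?case by (simp add: distrib_left mult.assoc)
qed

text \<open>The coefficient matrix consists of the old block and a \<open>2 \<times> 2\<close> block
  with zero diagonal; nothing couples the two blocks.\<close>

lemma bilinear_sum_Suc_Suc:
  fixes b :: "nat \<Rightarrow> nat \<Rightarrow> real"
  assumes "\<And>i. i < n \<Longrightarrow> b i n = 0" "\<And>i. i < n \<Longrightarrow> b i (Suc n) = 0"
    and "\<And>i. i < n \<Longrightarrow> b n i = 0" "\<And>i. i < n \<Longrightarrow> b (Suc n) i = 0"
    and "b n n = 0" "b (Suc n) (Suc n) = 0"
  shows "(\<Sum>i<Suc (Suc n). \<Sum>j<Suc (Suc n). b i j * u i * v j)
    = (\<Sum>i<n. \<Sum>j<n. b i j * u i * v j) + (b n (Suc n) * u n * v (Suc n) + b (Suc n) n * u (Suc n) * v n)"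
proof -
  have "(\<Sum>j<Suc (Suc n). b i j * u i * v j) = (\<Sum>j<n. b i j * u i * v j)" if "i < n" for i
    using assms(1,2)[OF that] by simp
  then have "(\<Sum>i<n. \<Sum>j<Suc (Suc n). b i j * u i * v j) = (\<Sum>i<n. \<Sum>j<n. b i j * u i * v j)"
    by (rule sum.cong[OF refl]) (simp only: lessThan_iff)
  moreover have "(\<Sum>j<n. b i j * u i * v j) = 0" if "i = n \<or> i = Suc n" for i
    using assms(3,4) that by (intro sum.neutral) auto
  then have "(\<Sum>j<Suc (Suc n). b n j * u n * v j) = b n (Suc n) * u n * v (Suc n)"
    "(\<Sum>j<Suc (Suc n). b (Suc n) j * u (Suc n) * v j) = b (Suc n) n * u (Suc n) * v n"
    using assms(5,6) by simp_all
  ultimately show ?thesis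
    unfolding sum.lessThan_Suc[of "\<lambda>i. \<Sum>j<Suc (Suc n). b i j * u i * v j"] by (simp only: add.assoc)
qed

text \<open>Each rectangle \<open>A \<times> B\<close> with coefficient \<open>c\<close> contributes
  two new indices, carrying \<open>A\<close> and \<open>B\<close>, and the coefficient
  \<open>c / 2\<close> in both orders. The new sets may meet the old ones, since the coefficients
  linking them are 0.\<close>

lemma offdiag_symmetrization:
  assumes "offdiag g"
  shows "\<exists>(n :: nat) S b. (\<forall>i<n. S i \<in> sets borel \<and> emeasure lborel (S i) < \<infinity>) \<and>
    (\<forall>i<n. \<forall>j<n. b i j = b j i) \<and> (\<forall>i<n. \<forall>j<n. b i j \<noteq> 0 \<longrightarrow> S i \<inter> S j = {}) \<and>
    (\<forall>x y. (g (x, y) + g (y, x)) / 2 = (\<Sum>i<n. \<Sum>j<n. b i j * indicator (S i) x * indicator (S j) y))"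
    (is "\<exists>n S b. ?P g n S b")
  using assms
proof (induction rule: offdiag.induct)
  case offdiag_zero
  show ?case by (intro exI[of _ "0 :: nat"]) simp
next
  case (offdiag_step g A B c)
  from offdiag_step.IH obtain n S b where P: "?P g n S b" by (elim exE) (rule that)
  define S' where "S' i = (if i < n then S i else if i = n then A else B)" for i
  define b' where "b' i j = (if i < n \<and> j < n then b i j
    else if i = n \<and> j = Suc n \<or> i = Suc n \<and> j = n then c / 2 else 0)" for i j
  have b': "b' n (Suc n) = c / 2" "b' (Suc n) n = c / 2" "\<And>i j. i < n \<Longrightarrow> j < n \<Longrightarrow> b' i j = b i j"
    and S': "S' n = A" "S' (Suc n) = B" "\<And>i. i < n \<Longrightarrow> S' i = S i"
    by (simp_all add: b'_def S'_def)
  have z: "\<And>i. i < n \<Longrightarrow> b' i n = 0" "\<And>i. i < n \<Longrightarrow> b' i (Suc n) = 0"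
    "\<And>i. i < n \<Longrightarrow> b' n i = 0" "\<And>i. i < n \<Longrightarrow> b' (Suc n) i = 0" "b' n n = 0" "b' (Suc n) (Suc n) = 0"
    by (simp_all add: b'_def)
  note P1 = P[THEN conjunct1] and P2 = P[THEN conjunct2, THEN conjunct1]
    and P3 = P[THEN conjunct2, THEN conjunct2, THEN conjunct1]
    and P4 = P[THEN conjunct2, THEN conjunct2, THEN conjunct2]
  have sum: "(\<Sum>i<Suc (Suc n). \<Sum>j<Suc (Suc n). b' i j * indicator (S' i) x * indicator (S' j) y)
      = (g (x, y) + g (y, x)) / 2 + (c / 2 * indicator A x * indicator B y + c / 2 * indicator B x * indicator A y)"
    for x y
  proof -
    have "(\<Sum>i<n. \<Sum>j<n. b' i j * indicator (S' i) x * indicator (S' j) y)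
        = (\<Sum>i<n. \<Sum>j<n. b i j * indicator (S i) x * indicator (S j) y :: real)"
      by (intro sum.cong refl) (simp only: b' S' lessThan_iff)
    also have "\<dots> = (g (x, y) + g (y, x)) / 2" using P4 by (simp only:)
    finally have s: "(\<Sum>i<n. \<Sum>j<n. b' i j * indicator (S' i) x * indicator (S' j) y) = (g (x, y) + g (y, x)) / 2" .
    show ?thesis
      using bilinear_sum_Suc_Suc[OF z, of "\<lambda>i. indicator (S' i) x" "\<lambda>j. indicator (S' j) y"]
      unfolding s b'(1,2) S'(1,2) by (simp only:)
  qed
  have "?P (\<lambda>z. g z + c * indicator (A \<times> B) z) (Suc (Suc n)) S' b'"
  proof (intro conjI allI)
    fix x y
    show "(g (x, y) + c * indicator (A \<times> B) (x, y) + (g (y, x) + c * indicator (A \<times> B) (y, x))) / 2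
      = (\<Sum>i<Suc (Suc n). \<Sum>j<Suc (Suc n). b' i j * indicator (S' i) x * indicator (S' j) y)"
      unfolding sum by (simp add: indicator_times add_divide_distrib mult_ac)
  next
    show "i < Suc (Suc n) \<longrightarrow> S' i \<in> sets borel \<and> emeasure lborel (S' i) < \<infinity>" for i
      using P1 offdiag_step.hyps(2-5) by (simp add: S'_def)
    show "i < Suc (Suc n) \<longrightarrow> (\<forall>j<Suc (Suc n). b' i j = b' j i)" for i
      using P2 unfolding b'_def by auto
    show "i < Suc (Suc n) \<longrightarrow> (\<forall>j<Suc (Suc n). b' i j \<noteq> 0 \<longrightarrow> S' i \<inter> S' j = {})" for i
    proof (intro impI allI)
      fix j assume "b' i j \<noteq> 0"
      then consider "i < n" "j < n" "b i j \<noteq> 0" | "i = n" "j = Suc n" | "i = Suc n" "j = n"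
        by (auto simp: b'_def split: if_splits)
      then show "S' i \<inter> S' j = {}"
      proof cases
        case 1
        then show ?thesis using P3 by (simp add: S'_def)
      next
        case 2
        then show ?thesis using offdiag_step.hyps(6) S' by simp
      next
        case 3
        then show ?thesis using offdiag_step.hyps(6) S' by (simp add: Int_commute)
      qed
    qed
  qed
  then show ?case
    by - (rule exI[of _ "Suc (Suc n)"], rule exI[of _ S'], rule exI[of _ b'])
qed

definition offdiag_approx :: "(real \<times> real \<Rightarrow> real) \<Rightarrow> bool" where
  "offdiag_approx f \<longleftrightarrow> f \<in> borel_measurable borel \<and>
    (\<forall>e>0. \<exists>g. offdiag g \<and> (L2sq lborel (\<lambda>z. f z - g z)) \<le> ennreal e)"

lemma offdiag_approxD:
  assumes "offdiag_approx f" "0 < e"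
  obtains g where "offdiag g" "(L2sq lborel (\<lambda>z. f z - g z)) \<le> ennreal e"
  using assms unfolding offdiag_approx_def by blast

lemma offdiag_approx_measurable: "offdiag_approx f \<Longrightarrow> f \<in> borel_measurable borel"
  by (simp add: offdiag_approx_def)

lemma offdiag_imp_approx: "offdiag f \<Longrightarrow> offdiag_approx f"
  unfolding offdiag_approx_def by (auto intro!: exI[of _ f] offdiag_measurable)

lemma ennreal_four_quarters:
  assumes "0 \<le> e"
  shows "2 * (ennreal (e / 4) + ennreal (e / 4)) = ennreal e"
proof -
  have "2 * (ennreal (e / 4) + ennreal (e / 4)) = ennreal 2 * ennreal (e / 4 + e / 4)"
    using assms by (subst ennreal_plus) auto
  also have "\<dots> = ennreal e"
    using assms by (subst ennreal_mult[symmetric]) auto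
  finally show ?thesis .
qed

lemma offdiag_approx_add:
  assumes f: "offdiag_approx f" and h: "offdiag_approx h"
  shows "offdiag_approx (\<lambda>z. f z + h z)"
proof -
  note [measurable] = offdiag_approx_measurable[OF f] offdiag_approx_measurable[OF h]
  have "\<exists>g. offdiag g \<and> (L2sq lborel (\<lambda>z. f z + h z - g z)) \<le> ennreal e" if e: "0 < e" for e
  proof -
    obtain g where g: "offdiag g" "(L2sq lborel (\<lambda>z. f z - g z)) \<le> ennreal (e / 4)"
      using offdiag_approxD[OF f, of "e / 4"] e by auto
    obtain k where k: "offdiag k" "(L2sq lborel (\<lambda>z. h z - k z)) \<le> ennreal (e / 4)"
      using offdiag_approxD[OF h, of "e / 4"] e by auto
    note [measurable] = offdiag_measurable[OF g(1)] offdiag_measurable[OF k(1)]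
    have "(L2sq lborel (\<lambda>z. f z + h z - (g z + k z))) = (L2sq lborel (\<lambda>z. (f z - g z) + (h z - k z)))"
      by (simp add: algebra_simps)
    also have "\<dots> \<le> 2 * ((L2sq lborel (\<lambda>z. f z - g z)) + (L2sq lborel (\<lambda>z. h z - k z)))"
      by (rule nn_integral_square_add_le) auto
    also have "\<dots> \<le> 2 * (ennreal (e / 4) + ennreal (e / 4))"
      by (intro mult_left_mono add_mono g k) auto
    also have "\<dots> = ennreal e" using e by (intro ennreal_four_quarters) simp
    finally show ?thesis using offdiag_add[OF k(1) g(1)] by blast
  qed
  then show ?thesis unfolding offdiag_approx_def by auto
qed

lemma offdiag_approx_scale:
  assumes f: "offdiag_approx f"
  shows "offdiag_approx (\<lambda>z. r * f z)"
proof (cases "r = 0")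
  case True
  then show ?thesis using offdiag_imp_approx[OF offdiag_zero] by simp
next
  case False
  note [measurable] = offdiag_approx_measurable[OF f]
  have "\<exists>g. offdiag g \<and> (L2sq lborel (\<lambda>z. r * f z - g z)) \<le> ennreal e" if e: "0 < e" for e
  proof -
    obtain g where g: "offdiag g" "(L2sq lborel (\<lambda>z. f z - g z)) \<le> ennreal (e / r\<^sup>2)"
      using offdiag_approxD[OF f, of "e / r\<^sup>2"] e False by auto
    note [measurable] = offdiag_measurable[OF g(1)]
    have "(L2sq lborel (\<lambda>z. r * f z - r * g z)) = (\<integral>\<^sup>+z. ennreal (r\<^sup>2) * ennreal ((f z - g z)\<^sup>2) \<partial>lborel)"
      by (intro nn_integral_cong) (simp add: ennreal_mult[symmetric] right_diff_distrib[symmetric] power_mult_distrib)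
    also have "\<dots> = ennreal (r\<^sup>2) * (L2sq lborel (\<lambda>z. f z - g z))"
      by (rule nn_integral_cmult) auto
    also have "\<dots> \<le> ennreal (r\<^sup>2) * ennreal (e / r\<^sup>2)" by (intro mult_left_mono g) auto
    also have "\<dots> = ennreal e" using e False by (subst ennreal_mult[symmetric]) auto
    finally show ?thesis using offdiag_scale[OF g(1)] by blast
  qed
  then show ?thesis unfolding offdiag_approx_def by auto
qed

lemma offdiag_approx_sum:
  assumes "finite I" "\<And>i. i \<in> I \<Longrightarrow> offdiag_approx (F i)"
  shows "offdiag_approx (\<lambda>z. \<Sum>i\<in>I. F i z)"
  using assms
proof (induction rule: finite_induct)
  case empty
  then show ?case using offdiag_imp_approx[OF offdiag_zero] by simp
next
  case (insert i I)
  then show ?case using offdiag_approx_add[of "F i" "\<lambda>z. \<Sum>i\<in>I. F i z"] by simp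
qed

lemma offdiag_approx_limit:
  assumes F: "\<And>m :: nat. offdiag_approx (F m)" and [measurable]: "f \<in> borel_measurable borel"
    and lim: "(\<lambda>m. L2sq lborel (\<lambda>z. F m z - f z)) \<longlonglongrightarrow> 0"
  shows "offdiag_approx f"
proof -
  note [measurable] = offdiag_approx_measurable[OF F]
  have "\<exists>g. offdiag g \<and> (L2sq lborel (\<lambda>z. f z - g z)) \<le> ennreal e" if e: "0 < e" for e
  proof -
    obtain m where "(L2sq lborel (\<lambda>z. F m z - f z)) < ennreal (e / 4)"
      using order_tendstoD(2)[OF lim, of "ennreal (e / 4)"] e by (auto simp: eventually_sequentially)
    then have m: "(L2sq lborel (\<lambda>z. f z - F m z)) \<le> ennreal (e / 4)"
      by (simp add: power2_commute[of "f _"])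
    obtain k where k: "offdiag k" "(L2sq lborel (\<lambda>z. F m z - k z)) \<le> ennreal (e / 4)"
      using offdiag_approxD[OF F, of "e / 4"] e by auto
    note [measurable] = offdiag_measurable[OF k(1)]
    have "(L2sq lborel (\<lambda>z. f z - k z)) = (L2sq lborel (\<lambda>z. (f z - F m z) + (F m z - k z)))"
      by simp
    also have "\<dots> \<le> 2 * ((L2sq lborel (\<lambda>z. f z - F m z)) + (L2sq lborel (\<lambda>z. F m z - k z)))"
      by (rule nn_integral_square_add_le) auto
    also have "\<dots> \<le> 2 * (ennreal (e / 4) + ennreal (e / 4))"
      by (intro mult_left_mono add_mono m k) auto
    also have "\<dots> = ennreal e" using e by (intro ennreal_four_quarters) simp
    finally show ?thesis using k(1) by blast
  qed
  then show ?thesis unfolding offdiag_approx_def by auto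
qed

text \<open>Since both \<open>F m\<close> and \<open>f\<close> are bounded by \<open>|f|\<close>,
  the squared error is dominated by \<open>4 f^2\<close>, and dominated convergence applies.\<close>

lemma offdiag_approx_dominated:
  assumes F: "\<And>m :: nat. offdiag_approx (F m)" and [measurable]: "f \<in> borel_measurable borel"
    and lim: "AE z in lborel. (\<lambda>m. F m z) \<longlonglongrightarrow> f z"
    and dom: "\<And>m z. \<bar>F m z\<bar> \<le> \<bar>f z\<bar>" and fin: "(L2sq lborel (\<lambda>z. f z)) < \<infinity>"
  shows "offdiag_approx f"
proof (rule offdiag_approx_limit[OF F])
  note [measurable] = offdiag_approx_measurable[OF F]
  have "(\<lambda>m. L2sq lborel (\<lambda>z. F m z - f z)) \<longlonglongrightarrow> (\<integral>\<^sup>+(z :: real \<times> real). ennreal 0 \<partial>lborel)"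
  proof (rule nn_integral_dominated_convergence[where w = "\<lambda>z. ennreal 4 * ennreal ((f z)\<^sup>2)"])
    show "AE z in lborel. ennreal ((F m z - f z)\<^sup>2) \<le> ennreal 4 * ennreal ((f z)\<^sup>2)" for m
    proof (intro AE_I2)
      fix z
      have "\<bar>F m z - f z\<bar> \<le> 2 * \<bar>f z\<bar>" using dom[of m z] by linarith
      then have "(F m z - f z)\<^sup>2 \<le> (2 * \<bar>f z\<bar>)\<^sup>2" using power_mono[of "\<bar>F m z - f z\<bar>" "2 * \<bar>f z\<bar>" 2] by simp
      then show "ennreal ((F m z - f z)\<^sup>2) \<le> ennreal 4 * ennreal ((f z)\<^sup>2)"
        by (subst ennreal_mult[symmetric]) (auto intro!: ennreal_leI simp: power_mult_distrib)
    qed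
    show "(\<integral>\<^sup>+z. ennreal 4 * ennreal ((f z)\<^sup>2) \<partial>lborel) < \<infinity>"
      using fin by (subst nn_integral_cmult) (auto simp: ennreal_mult_less_top)
    show "AE z in lborel. (\<lambda>m. ennreal ((F m z - f z)\<^sup>2)) \<longlonglongrightarrow> ennreal 0"
      using lim
    proof eventually_elim
      case (elim z)
      have "(\<lambda>m. (F m z - f z)\<^sup>2) \<longlonglongrightarrow> (f z - f z)\<^sup>2" by (intro tendsto_intros elim)
      then show ?case by (intro tendsto_ennrealI) simp
    qed
  qed auto
  then show "(\<lambda>m. L2sq lborel (\<lambda>z. F m z - f z)) \<longlonglongrightarrow> 0" by simp
qed fact

section \<open>Approximation on a rectangle with disjoint sides\<close>

context
  fixes C D :: "real set"
  assumes C: "C \<in> sets borel" "emeasure lborel C < \<infinity>" and D: "D \<in> sets borel" "emeasure lborel D < \<infinity>"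
    and CD: "C \<inter> D = {}"
begin

lemma offdiag_approx_rectangle:
  assumes "A \<in> sets borel" "B \<in> sets borel"
  shows "offdiag_approx (indicator ((A \<times> B) \<inter> (C \<times> D)))"
proof -
  have "emeasure lborel (A \<inter> C) < \<infinity>" "emeasure lborel (B \<inter> D) < \<infinity>"
    using C D emeasure_mono[of "A \<inter> C" C lborel] emeasure_mono[of "B \<inter> D" D lborel]
    by (auto intro: order_le_less_trans)
  then have "offdiag (\<lambda>z. 0 + 1 * indicator ((A \<inter> C) \<times> (B \<inter> D)) z)"
    using assms C D CD by (intro offdiag_step offdiag_zero) auto
  moreover have "(A \<inter> C) \<times> (B \<inter> D) = (A \<times> B) \<inter> (C \<times> D)" by auto
  ultimately show ?thesis by (intro offdiag_imp_approx) simp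
qed

lemma rectangle_finite: "emeasure lborel (C \<times> D) < \<infinity>"
  using C D by (simp add: lborel_prod[symmetric] lborel.emeasure_pair_measure_Times ennreal_mult_less_top)

text \<open>Inside \<open>C \<times> D\<close> every subrectangle has disjoint sides, so the
  pi-lambda argument for product sets runs undisturbed by the diagonal. Complements are taken within
  \<open>C \<times> D\<close>, and its finite measure bounds the countable unions.\<close>

lemma offdiag_approx_indicator:
  assumes "S \<in> sets borel"
  shows "offdiag_approx (indicator (S \<inter> (C \<times> D)))"
proof -
  let ?G = "{A \<times> B | A B. A \<in> sets (borel :: real measure) \<and> B \<in> sets (borel :: real measure)}"
  have "Int_stable ?G" by (rule Int_stable_pair_measure_generator)
  moreover have "?G \<subseteq> Pow UNIV" by simp
  moreover have sets: "sets (borel :: (real \<times> real) measure) = sigma_sets UNIV ?G"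
    unfolding borel_prod_real sets_pair_measure by simp
  then have "S \<in> sigma_sets UNIV ?G" using assms by simp
  ultimately show ?thesis
  proof (induction rule: sigma_sets_induct_disjoint)
    case (basic X)
    then show ?case using offdiag_approx_rectangle by auto
  next
    case empty
    then show ?case using offdiag_imp_approx[OF offdiag_zero] by simp
  next
    case (compl X)
    have "offdiag_approx (\<lambda>z. indicator (C \<times> D) z + (- 1) * indicator (X \<inter> (C \<times> D)) z)"
      using offdiag_approx_rectangle[of UNIV UNIV]
      by (intro offdiag_approx_add offdiag_approx_scale compl.IH) simp
    also have "(\<lambda>z. indicator (C \<times> D) z + (- 1) * indicator (X \<inter> (C \<times> D)) z) = (indicator ((UNIV - X) \<inter> (C \<times> D)) :: _ \<Rightarrow> real)"
      by (auto simp: fun_eq_iff indicator_def)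
    finally show ?case .
  next
    case (union X)
    have X[measurable]: "X i \<in> sets borel" for i using union.hyps(2) sets by auto
    have "C \<times> D \<in> sets borel" using C D by (intro borel_rectangle)
    then have UX[measurable]: "(\<Union>i. X i) \<inter> (C \<times> D) \<in> sets borel" by measurable
    show ?case
    proof (rule offdiag_approx_dominated)
      show "offdiag_approx (\<lambda>z. \<Sum>i<m. indicator (X i \<inter> (C \<times> D)) z)" for m
        by (intro offdiag_approx_sum union.IH) auto
      have eq: "(\<Sum>i<m. indicator (X i \<inter> (C \<times> D)) z) = (indicator (\<Union>i<m. X i \<inter> (C \<times> D)) z :: real)" for m z
        using union.hyps(1)
        by (intro indicator_UN_disjoint[symmetric]) (auto simp: disjoint_family_on_def)
      show "\<bar>\<Sum>i<m. indicator (X i \<inter> (C \<times> D)) z\<bar> \<le> \<bar>indicator ((\<Union>i. X i) \<inter> (C \<times> D)) z :: real\<bar>" for m z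
        unfolding eq by (auto simp: indicator_def)
      show "AE z in lborel. (\<lambda>m. \<Sum>i<m. indicator (X i \<inter> (C \<times> D)) z) \<longlonglongrightarrow> (indicator ((\<Union>i. X i) \<inter> (C \<times> D)) z :: real)"
        unfolding eq using LIMSEQ_indicator_UN[of "\<lambda>i. X i \<inter> (C \<times> D)"] by (intro AE_I2) simp
      have "(L2sq lborel (\<lambda>z. indicator ((\<Union>i. X i) \<inter> (C \<times> D)) z))
          = (\<integral>\<^sup>+z. indicator ((\<Union>i. X i) \<inter> (C \<times> D)) z \<partial>lborel)"
        by (intro nn_integral_cong) (simp add: indicator_def)
      also have "\<dots> = emeasure lborel ((\<Union>i. X i) \<inter> (C \<times> D))"
        using UX by (intro nn_integral_indicator) simp
      also have "\<dots> \<le> emeasure lborel (C \<times> D)"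
        using C D by (intro emeasure_mono) auto
      also have "\<dots> < \<infinity>" by (rule rectangle_finite)
      finally show "(L2sq lborel (\<lambda>z. indicator ((\<Union>i. X i) \<inter> (C \<times> D)) z)) < \<infinity>" .
    qed measurable
  qed
qed

lemma offdiag_approx_nonneg_on_rectangle:
  assumes "u \<in> borel_measurable borel" "\<And>z. 0 \<le> u z"
    and "(L2sq lborel (\<lambda>z. u z * indicator (C \<times> D) z)) < \<infinity>"
  shows "offdiag_approx (\<lambda>z. u z * indicator (C \<times> D) z)"
  using assms
proof (induction rule: borel_measurable_induct_real)
  case (set A)
  have "(\<lambda>z. indicator A z * indicator (C \<times> D) z) = (indicator (A \<inter> (C \<times> D)) :: _ \<Rightarrow> real)"
    by (auto simp: fun_eq_iff indicator_def)
  then show ?case using offdiag_approx_indicator[OF set(1)] by simp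
next
  case (mult u c)
  have [measurable]: "C \<times> D \<in> sets borel" using C D by (intro borel_rectangle)
  note [measurable] = mult.hyps(2)
  show ?case
  proof (cases "c = 0")
    case True
    then show ?thesis using offdiag_imp_approx[OF offdiag_zero] by simp
  next
    case False
    have "(L2sq lborel (\<lambda>z. c * u z * indicator (C \<times> D) z))
        = (\<integral>\<^sup>+z. ennreal (c\<^sup>2) * ennreal ((u z * indicator (C \<times> D) z)\<^sup>2) \<partial>lborel)"
      by (simp add: ennreal_mult[symmetric] power_mult_distrib mult.assoc)
    also have "\<dots> = ennreal (c\<^sup>2) * (L2sq lborel (\<lambda>z. u z * indicator (C \<times> D) z))"
      by (rule nn_integral_cmult) measurable
    finally have "(L2sq lborel (\<lambda>z. u z * indicator (C \<times> D) z)) < \<infinity>"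
      using mult.prems False by (auto simp: ennreal_mult_less_top)
    from offdiag_approx_scale[OF mult.IH[OF this], of c] show ?thesis by (simp add: mult.assoc)
  qed
next
  case (add u v)
  \<comment> \<open>Both summands are nonnegative, so each is dominated by their sum and inherits
    the finite norm that its induction hypothesis demands.\<close>
  have le: "(L2sq lborel (\<lambda>z. w z * indicator (C \<times> D) z)) < \<infinity>"
    if "\<And>z. 0 \<le> w z" "\<And>z. w z \<le> v z + u z" for w
  proof -
    have "(L2sq lborel (\<lambda>z. w z * indicator (C \<times> D) z))
      \<le> (L2sq lborel (\<lambda>z. (v z + u z) * indicator (C \<times> D) z))"
      using that by (intro nn_integral_mono ennreal_leI power_mono mult_right_mono) auto
    then show ?thesis using add.prems by (simp add: order_le_less_trans)
  qed
  have "offdiag_approx (\<lambda>z. v z * indicator (C \<times> D) z + u z * indicator (C \<times> D) z)"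
    using add.hyps by (intro offdiag_approx_add add.IH le) auto
  then show ?case by (simp add: distrib_right)
next
  case (seq U)
  have [measurable]: "C \<times> D \<in> sets borel" using C D by (intro borel_rectangle)
  note [measurable] = \<open>u \<in> borel_measurable borel\<close>
  have le: "U i z \<le> u z" for i z
  proof (rule incseq_le)
    show "incseq (\<lambda>i. U i z)" using seq.hyps(3) unfolding incseq_def le_fun_def by blast
    show "(\<lambda>i. U i z) \<longlonglongrightarrow> u z" by (rule seq.hyps(4)) simp
  qed
  show ?case
  proof (rule offdiag_approx_dominated)
    show "offdiag_approx (\<lambda>z. U i z * indicator (C \<times> D) z)" for i
    proof (rule seq.IH)
      have "(L2sq lborel (\<lambda>z. U i z * indicator (C \<times> D) z))
        \<le> (L2sq lborel (\<lambda>z. u z * indicator (C \<times> D) z))"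
        using seq.hyps(2) le by (intro nn_integral_mono ennreal_leI power_mono mult_right_mono) auto
      then show "(L2sq lborel (\<lambda>z. U i z * indicator (C \<times> D) z)) < \<infinity>"
        using seq.prems by (simp add: order_le_less_trans)
    qed
    show "\<bar>U i z * indicator (C \<times> D) z\<bar> \<le> \<bar>u z * indicator (C \<times> D) z\<bar>" for i z
      using seq.hyps(2)[of i z] le[of i z] by (simp add: indicator_def)
    show "AE z in lborel. (\<lambda>i. U i z * indicator (C \<times> D) z) \<longlonglongrightarrow> u z * indicator (C \<times> D) z"
      using seq.hyps by (intro AE_I2 tendsto_mult tendsto_const) auto
  qed (use seq.prems in measurable)
qed

end

section \<open>Exhausting the plane off the diagonal by dyadic squares\<close>

lemma AE_lborel_off_diagonal: "AE z in (lborel :: (real \<times> real) measure). fst z \<noteq> snd z"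
  unfolding lborel_prod[symmetric]
proof (rule lborel_pair.AE_pair_measure)
  have "open {z :: real \<times> real. fst z \<noteq> snd z}"
    by (intro open_Collect_neq continuous_intros)
  then have "{z :: real \<times> real. fst z \<noteq> snd z} \<in> sets (borel \<Otimes>\<^sub>M borel)"
    unfolding borel_prod by (rule borel_open)
  then show "{z \<in> space (lborel \<Otimes>\<^sub>M lborel). fst z \<noteq> snd z} \<in> sets (lborel \<Otimes>\<^sub>M (lborel :: real measure))"
    by (simp add: space_pair_measure cong: sets_pair_measure_cong)
  show "AE x in lborel. AE y in lborel. fst (x :: real, y :: real) \<noteq> snd (x, y)"
    using AE_lborel_singleton by (auto simp: eq_commute)
qed

text \<open>As fibres of the floor function, the cells of one level partition the line, and
  membership is decided by a single index.\<close>

definition dyadic_cell :: "nat \<Rightarrow> int \<Rightarrow> real set" where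
  "dyadic_cell m k = {x. \<lfloor>x * 2 ^ m\<rfloor> = k}"

lemma dyadic_cell_sets: "dyadic_cell m k \<in> sets borel"
  unfolding dyadic_cell_def by measurable

lemma dyadic_cell_finite: "emeasure lborel (dyadic_cell m k) < \<infinity>"
proof -
  have "dyadic_cell m k \<subseteq> {of_int k / 2 ^ m .. (of_int k + 1) / 2 ^ m}"
    unfolding dyadic_cell_def by (auto simp: field_simps floor_eq_iff)
  then have "emeasure lborel (dyadic_cell m k) \<le> emeasure lborel {of_int k / 2 ^ m .. (of_int k + 1) / 2 ^ m :: real}"
    by (intro emeasure_mono) auto
  also have "\<dots> < \<infinity>" by (simp add: emeasure_lborel_Icc_eq)
  finally show ?thesis .
qed

lemma eventually_off_diagonal_cells:
  fixes x y :: real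
  assumes "x \<noteq> y"
  shows "eventually (\<lambda>m. \<lfloor>x * 2 ^ m\<rfloor> \<noteq> \<lfloor>y * 2 ^ m\<rfloor> \<and> \<lfloor>x * 2 ^ m\<rfloor> \<in> {- (4 ^ m)..4 ^ m} \<and> \<lfloor>y * 2 ^ m\<rfloor> \<in> {- (4 ^ m)..4 ^ m}) sequentially"
proof -
  \<comment> \<open>For \<open>B < 2^m\<close> three demands hold together: \<open>|x| + 1\<close>
    and \<open>|y| + 1\<close> are at most \<open>2^m\<close>, which bounds the indices by
    \<open>4^m\<close>, and \<open>2^m |x - y| > 1\<close>, which separates the two floors.\<close>
  define B where "B = 1 + \<bar>x\<bar> + \<bar>y\<bar> + 1 / \<bar>x - y\<bar>"
  obtain n0 where n0: "B < 2 ^ n0" using real_arch_pow[of 2 B] by auto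
  have "\<lfloor>x * 2 ^ m\<rfloor> \<noteq> \<lfloor>y * 2 ^ m\<rfloor> \<and> \<lfloor>x * 2 ^ m\<rfloor> \<in> {- (4 ^ m)..4 ^ m} \<and> \<lfloor>y * 2 ^ m\<rfloor> \<in> {- (4 ^ m)..4 ^ m}" if "n0 \<le> m" for m
  proof -
    have "(2::real) ^ n0 \<le> 2 ^ m" using that by (intro power_increasing) auto
    with n0 have B: "B < 2 ^ m" by linarith
    have bd: "\<lfloor>w * 2 ^ m\<rfloor> \<in> {- (4 ^ m)..4 ^ m}" if "\<bar>w\<bar> + 1 \<le> 2 ^ m" for w :: real
    proof -
      have "(\<bar>w\<bar> + 1) * 2 ^ m \<le> 2 ^ m * 2 ^ m" using that by (intro mult_right_mono) auto
      then have "\<bar>w * 2 ^ m\<bar> + 2 ^ m \<le> (4::real) ^ m"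
        by (simp add: abs_mult distrib_right flip: power_mult_distrib)
      moreover have "(1::real) \<le> 2 ^ m" by simp
      ultimately have "\<bar>w * 2 ^ m\<bar> \<le> 4 ^ m - 1" by linarith
      then have "- (4 ^ m) \<le> w * 2 ^ m" "w * 2 ^ m \<le> 4 ^ m" by linarith+
      then have "of_int (- (4 ^ m)) \<le> w * 2 ^ m" "w * 2 ^ m \<le> of_int (4 ^ m)" by simp_all
      then show ?thesis unfolding atLeastAtMost_iff le_floor_iff by (metis floor_mono floor_of_int)
    qed
    have pos: "0 \<le> 1 / \<bar>x - y\<bar>" "0 < \<bar>x - y\<bar>" using assms by auto
    have "1 / \<bar>x - y\<bar> < 2 ^ m" using B unfolding B_def by linarith
    then have "1 < \<bar>x - y\<bar> * 2 ^ m" using pos(2) by (simp add: divide_less_eq mult.commute)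
    then have "1 < \<bar>x * 2 ^ m - y * 2 ^ m\<bar>" by (simp add: abs_mult left_diff_distrib[symmetric])
    then have "\<lfloor>x * 2 ^ m\<rfloor> \<noteq> \<lfloor>y * 2 ^ m\<rfloor>" by linarith
    moreover have "\<bar>x\<bar> + 1 \<le> 2 ^ m" "\<bar>y\<bar> + 1 \<le> 2 ^ m"
      using B pos(1) unfolding B_def by linarith+
    ultimately show ?thesis using bd by blast
  qed
  then show ?thesis unfolding eventually_sequentially by blast
qed

lemma offdiag_approx_nonneg:
  assumes [measurable]: "f \<in> borel_measurable borel" and nn: "\<And>z. 0 \<le> f z"
    and fin: "(L2sq lborel (\<lambda>z. f z)) < \<infinity>"
  shows "offdiag_approx f"
proof -
  \<comment> \<open>Off-diagonal dyadic squares of side \<open>2\<^sup>-\<^sup>m\<close> within \<open>[-2\<^sup>m, 2\<^sup>m]\<^sup>2\<close> exhaust the plane up to the diagonal.\<close>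
  define P where "P m = {(k, j). k \<in> {- (4 ^ m)..4 ^ m} \<and> j \<in> {- (4 ^ m)..4 ^ m} \<and> k \<noteq> (j :: int)}" for m :: nat
  have P: "finite (P m)" for m
    by (rule finite_subset[of _ "{- (4 ^ m)..4 ^ m} \<times> {- (4 ^ m)..4 ^ m}"]) (auto simp: P_def)
  define R where "R m p = dyadic_cell m (fst p) \<times> dyadic_cell m (snd p)" for m and p :: "int \<times> int"
  \<comment> \<open>At most one square of the level contains a given point, so the partial sum is
    either \<open>f (x, y)\<close> or 0. Domination and pointwise convergence both follow from
    this.\<close>
  have sum: "(\<Sum>p\<in>P m. f (x, y) * indicator (R m p) (x, y)) = (if (\<lfloor>x * 2 ^ m\<rfloor>, \<lfloor>y * 2 ^ m\<rfloor>) \<in> P m then f (x, y) else 0)" for m x y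
  proof -
    have "(\<Sum>p\<in>P m. f (x, y) * indicator (R m p) (x, y)) = (\<Sum>p\<in>P m. if p = (\<lfloor>x * 2 ^ m\<rfloor>, \<lfloor>y * 2 ^ m\<rfloor>) then f (x, y) else 0)"
      by (intro sum.cong refl) (auto simp: R_def dyadic_cell_def indicator_def)
    then show ?thesis by (simp add: P)
  qed
  show ?thesis
  proof (rule offdiag_approx_dominated)
    show "offdiag_approx (\<lambda>z. \<Sum>p\<in>P m. f z * indicator (R m p) z)" for m
    proof (intro offdiag_approx_sum P)
      fix p assume "p \<in> P m"
      then have "dyadic_cell m (fst p) \<inter> dyadic_cell m (snd p) = {}"
        by (auto simp: P_def dyadic_cell_def)
      moreover have "(L2sq lborel (\<lambda>z. f z * indicator (R m p) z)) \<le> (L2sq lborel (\<lambda>z. f z))"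
        by (intro nn_integral_mono ennreal_leI) (simp add: indicator_def)
      ultimately show "offdiag_approx (\<lambda>z. f z * indicator (R m p) z)"
        unfolding R_def using nn fin
        by (intro offdiag_approx_nonneg_on_rectangle dyadic_cell_sets dyadic_cell_finite) (auto simp: order_le_less_trans)
    qed
    show "\<bar>\<Sum>p\<in>P m. f z * indicator (R m p) z\<bar> \<le> \<bar>f z\<bar>" for m z
      by (cases z) (simp add: sum)
    show "AE z in lborel. (\<lambda>m. \<Sum>p\<in>P m. f z * indicator (R m p) z) \<longlonglongrightarrow> f z"
      using AE_lborel_off_diagonal
    proof eventually_elim
      case (elim z)
      obtain x y where z: "z = (x, y)" "x \<noteq> y" using elim by (cases z) auto
      show ?case unfolding z(1) sum
        by (rule tendsto_eventually, use eventually_off_diagonal_cells[OF z(2)] in eventually_elim)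
          (auto simp: P_def)
    qed
  qed (use fin in auto)
qed

lemma borel_measurable_swap:
  fixes h :: "real \<times> real \<Rightarrow> 'b::topological_space"
  assumes "h \<in> borel_measurable borel"
  shows "(\<lambda>z. h (snd z, fst z)) \<in> borel_measurable lborel"
proof -
  have "(\<lambda>z :: real \<times> real. (snd z, fst z)) \<in> borel_measurable borel"
    by (intro borel_measurable_continuous_onI continuous_intros)
  from measurable_compose[OF this assms] show ?thesis by simp
qed

lemma nn_integral_lborel_swap:
  assumes [measurable]: "h \<in> borel_measurable (borel :: (real \<times> real) measure)"
  shows "(\<integral>\<^sup>+z. h (snd z, fst z) \<partial>lborel) = (\<integral>\<^sup>+z. h z \<partial>lborel)"
proof -
  have h: "h \<in> borel_measurable (lborel \<Otimes>\<^sub>M lborel)" using assms by (simp add: lborel_prod)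
  have hs: "(\<lambda>z. h (snd z, fst z)) \<in> borel_measurable (lborel \<Otimes>\<^sub>M lborel)"
    using borel_measurable_swap[OF assms] by (simp only: lborel_prod)
  have "(\<integral>\<^sup>+z. h (snd z, fst z) \<partial>lborel) = (\<integral>\<^sup>+x. \<integral>\<^sup>+y. h (y, x) \<partial>lborel \<partial>lborel)"
    unfolding lborel_prod[symmetric] by (subst lborel.nn_integral_fst[OF hs, symmetric]) simp
  also have "\<dots> = (\<integral>\<^sup>+z. h z \<partial>lborel)"
    unfolding lborel_prod[symmetric] by (rule lborel_pair.nn_integral_snd[OF h])
  finally show ?thesis .
qed

section \<open>Existence of the integral for nonnegative symmetric kernels\<close>

context white_noise
begin

text \<open>An off-diagonal approximation \<open>g\<close> of \<open>f\<close> is averaged with its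
  reflection. As \<open>f\<close> is symmetric and reflection preserves Lebesgue measure, averaging
  does not enlarge the error bound: the factors \<open>1/4\<close> from halving compensate the 2 and
  the two equal terms of the squared triangle inequality.\<close>

lemma simple_fun_approx:
  assumes f: "symmetric_L2 f" and nn: "\<And>z. 0 \<le> f z" and e: "0 < e"
  shows "\<exists>n a A. simple_rep n a A \<and> (L2sq lborel (\<lambda>z. simple_fun n a A z - f z)) \<le> ennreal e"
proof -
  have [measurable]: "f \<in> borel_measurable borel" and sym: "\<And>x y. f (x, y) = f (y, x)"
    and int: "integrable lborel (\<lambda>z. (f z)\<^sup>2)"
    using f unfolding symmetric_L2_def by blast+
  have "(L2sq lborel (\<lambda>z. f z)) < \<infinity>"
    using nn_integral_eq_integral[OF int] by simp
  then have "offdiag_approx f" using nn by (intro offdiag_approx_nonneg) auto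
  then obtain g where g: "offdiag g" "(L2sq lborel (\<lambda>z. f z - g z)) \<le> ennreal e"
    by (rule offdiag_approxD[OF _ e])
  note [measurable] = offdiag_measurable[OF g(1)]
  from offdiag_symmetrization[OF g(1)] obtain n :: nat and S b
    where P: "(\<forall>i<n. S i \<in> sets borel \<and> emeasure lborel (S i) < \<infinity>) \<and>
    (\<forall>i<n. \<forall>j<n. b i j = b j i) \<and> (\<forall>i<n. \<forall>j<n. b i j \<noteq> 0 \<longrightarrow> S i \<inter> S j = {}) \<and>
    (\<forall>x y. (g (x, y) + g (y, x)) / 2 = (\<Sum>i<n. \<Sum>j<n. b i j * indicator (S i) x * indicator (S j) y))"
    by (elim exE) (rule that)
  note P1 = P[THEN conjunct1, rule_format] and P2 = P[THEN conjunct2, THEN conjunct1, rule_format]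
    and P3 = P[THEN conjunct2, THEN conjunct2, THEN conjunct1, rule_format]
    and P4 = P[THEN conjunct2, THEN conjunct2, THEN conjunct2, rule_format]
  have "\<exists>N a A. offdiag_rep {..<n} b S N a A"
  proof (rule simple_rep_refinement)
    show "b i j = b j i" if "i \<in> {..<n}" "j \<in> {..<n}" for i j
      using P2[of i j] that by simp
    show "S i \<inter> S j = {}" if "i \<in> {..<n}" "j \<in> {..<n}" "b i j \<noteq> 0" for i j
      using P3[of i j] that by simp
  qed (use P1 in simp_all)
  then obtain N a A where R: "offdiag_rep {..<n} b S N a A"
    by (elim exE) (rule that)
  note R = R[unfolded offdiag_rep_def]
  note rep = R[THEN conjunct1]
  have fun_eq: "simple_fun N a A (x, y) = (g (x, y) + g (y, x)) / 2" for x y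
    unfolding P4 by (rule R[THEN conjunct2, THEN conjunct1, rule_format])
  have "(L2sq lborel (\<lambda>z. simple_fun N a A z - f z))
    = (L2sq lborel (\<lambda>z. (g z - f z) / 2 + (g (snd z, fst z) - f (snd z, fst z)) / 2))"
  proof (intro nn_integral_cong)
    fix z :: "real \<times> real"
    obtain x y where z: "z = (x, y)" by (cases z)
    show "ennreal ((simple_fun N a A z - f z)\<^sup>2)
      = ennreal (((g z - f z) / 2 + (g (snd z, fst z) - f (snd z, fst z)) / 2)\<^sup>2)"
    proof -
      have "(g (x, y) + g (y, x)) / 2 - f (x, y) = (g (x, y) - f (x, y)) / 2 + (g (y, x) - f (y, x)) / 2"
        using sym[of x y] by (simp add: field_simps)
      then show ?thesis by (simp only: z fun_eq fst_conv snd_conv)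
    qed
  qed
  also have "\<dots> \<le> 2 * ((L2sq lborel (\<lambda>z. (g z - f z) / 2))
      + (L2sq lborel (\<lambda>z. (g (snd z, fst z) - f (snd z, fst z)) / 2)))"
    by (intro nn_integral_square_add_le borel_measurable_divide borel_measurable_diff borel_measurable_swap
        borel_measurable_const) measurable
  also have "(L2sq lborel (\<lambda>z. (g (snd z, fst z) - f (snd z, fst z)) / 2))
      = (L2sq lborel (\<lambda>z. (g z - f z) / 2))"
    by (rule nn_integral_lborel_swap[of "\<lambda>z. ennreal (((g z - f z) / 2)\<^sup>2)"]) measurable
  also have "(L2sq lborel (\<lambda>z. (g z - f z) / 2)) = (\<integral>\<^sup>+z. ennreal (1/4) * ennreal ((f z - g z)\<^sup>2) \<partial>lborel)"
    by (intro nn_integral_cong, subst ennreal_mult[symmetric]) (auto simp: power_divide power2_commute)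
  also have "\<dots> = ennreal (1/4) * (L2sq lborel (\<lambda>z. f z - g z))"
    by (rule nn_integral_cmult) measurable
  also have "2 * (\<dots> + \<dots>) \<le> 2 * (ennreal (1/4) * ennreal e + ennreal (1/4) * ennreal e)"
    by (intro mult_left_mono add_mono g) auto
  also have "\<dots> = ennreal e"
  proof -
    have "ennreal (1/4) * ennreal e = ennreal (1/4 * e)"
      using e by (intro ennreal_mult[symmetric]) auto
    then show ?thesis using ennreal_four_quarters[of e] e by simp
  qed
  finally show ?thesis
    by (intro exI[of _ N] exI[of _ a] exI[of _ A] conjI rep)
qed

theorem has_I2_exists:
  assumes f: "symmetric_L2 f" and nn: "\<And>z. 0 \<le> f z"
  shows "\<exists>Z. has_I2 M W f Z"
proof -
  define Q where "Q m r \<longleftrightarrow> simple_rep (fst r) (fst (snd r)) (snd (snd r)) \<and>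
    (L2sq lborel (\<lambda>z. simple_fun (fst r) (fst (snd r)) (snd (snd r)) z - f z)) \<le> ennreal ((1/16) ^ m)"
    for m and r :: "nat \<times> (nat \<Rightarrow> nat \<Rightarrow> real) \<times> (nat \<Rightarrow> real set)"
  have "\<exists>r. Q m r" for m
  proof -
    obtain n a A where "simple_rep n a A \<and> (L2sq lborel (\<lambda>z. simple_fun n a A z - f z)) \<le> ennreal ((1/16) ^ m)"
      using simple_fun_approx[OF f nn zero_less_power, of "1/16" m] by fastforce
    then have "Q m (n, a, A)" by (simp add: Q_def)
    then show ?thesis by (rule exI)
  qed
  then obtain r where r: "Q m (r m)" for m using choice[of Q] by blast
  show ?thesis
    by (rule has_I2_exists_of_fast_approximation[OF f, where n = "\<lambda>m. fst (r m)"
          and a = "\<lambda>m. fst (snd (r m))" and A = "\<lambda>m. snd (snd (r m))"])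
      (use r[unfolded Q_def] in blast)+
qed

lemma has_I2_I2:
  assumes "symmetric_L2 f" "\<And>z. 0 \<le> f z"
  shows "has_I2 M W f (I2 M W f)"
  unfolding I2_def using has_I2_exists[OF assms] by (rule someI_ex)

end

section \<open>Kolmogorov's continuity criterion\<close>

lemma power_powr: "0 < x \<Longrightarrow> (x ^ n) powr a = (x powr a) ^ n" for x :: real
  by (simp add: powr_powr mult.commute flip: powr_realpow)

section \<open>Dyadic grids and chaining along a fixed path\<close>

definition grid :: "real \<Rightarrow> nat \<Rightarrow> nat \<Rightarrow> real" where
  "grid T m k = T * real k / 2 ^ m"

text \<open>For \<open>t\<close> in \<open>[0, T]\<close> this is the index of the last grid point
  of level \<open>m\<close> not after \<open>t\<close>; at \<open>t = T\<close> it is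
  \<open>2^m\<close>, the final grid point.\<close>

definition grid_index :: "real \<Rightarrow> nat \<Rightarrow> real \<Rightarrow> nat" where
  "grid_index T m t = nat \<lfloor>t / T * 2 ^ m\<rfloor>"

lemma grid_mem: "0 < T \<Longrightarrow> k \<le> 2 ^ m \<Longrightarrow> grid T m k \<in> {0..T}"
  unfolding grid_def by (auto simp: field_simps of_nat_le_numeral_power_cancel_iff intro!: mult_left_mono)

lemma grid_double: "grid T (Suc m) (2 * k) = grid T m k"
  by (simp add: grid_def)

lemma grid_index_bounds:
  assumes "0 < T" "t \<in> {0..T}"
  shows "real (grid_index T m t) \<le> t / T * 2 ^ m" "t / T * 2 ^ m < real (grid_index T m t) + 1"
proof -
  have "0 \<le> t / T * 2 ^ m" using assms by simp
  then have "real (grid_index T m t) = of_int \<lfloor>t / T * 2 ^ m\<rfloor>"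
    unfolding grid_index_def by simp
  then show "real (grid_index T m t) \<le> t / T * 2 ^ m" "t / T * 2 ^ m < real (grid_index T m t) + 1"
    by linarith+
qed

lemma grid_index_le:
  assumes "0 < T" "t \<in> {0..T}"
  shows "grid_index T m t \<le> 2 ^ m"
proof -
  have "t / T * 2 ^ m \<le> 1 * 2 ^ m" using assms by (intro mult_right_mono) auto
  then have "real (grid_index T m t) \<le> 2 ^ m" using grid_index_bounds(1)[OF assms, of m] by linarith
  then have "real (grid_index T m t) \<le> real (2 ^ m)" by simp
  then show ?thesis unfolding of_nat_le_iff .
qed

text \<open>The floor of \<open>2 u\<close> is twice the floor of \<open>u\<close>, or one more.
  Refining the grid therefore moves the left approximation of \<open>t\<close> by at most one step
  of the finer grid, which is a single controlled increment.\<close>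

lemma grid_index_Suc:
  assumes "0 < T" "t \<in> {0..T}"
  shows "grid_index T (Suc m) t = 2 * grid_index T m t \<or> grid_index T (Suc m) t = Suc (2 * grid_index T m t)"
proof -
  define u where "u = t / T * 2 ^ m"
  have e: "t / T * 2 ^ Suc m = 2 * u" by (simp add: u_def)
  have "real (grid_index T m t) \<le> u" "u < real (grid_index T m t) + 1"
    "real (grid_index T (Suc m) t) \<le> 2 * u" "2 * u < real (grid_index T (Suc m) t) + 1"
    using grid_index_bounds[OF assms, of m, folded u_def] grid_index_bounds[OF assms, of "Suc m", unfolded e] .
  then have "real (2 * grid_index T m t) < real (grid_index T (Suc m) t + 1)"
    "real (grid_index T (Suc m) t) < real (2 * grid_index T m t + 2)" by simp_all
  then have "2 * grid_index T m t < grid_index T (Suc m) t + 1"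
    "grid_index T (Suc m) t < 2 * grid_index T m t + 2" unfolding of_nat_less_iff .
  then show ?thesis by linarith
qed

lemma grid_index_dist:
  assumes "0 < T" "t \<in> {0..T}"
  shows "\<bar>t - grid T m (grid_index T m t)\<bar> \<le> T / 2 ^ m"
proof -
  have "t = T * (t / T * 2 ^ m) / 2 ^ m" using assms by simp
  then have "t - grid T m (grid_index T m t) = T / 2 ^ m * (t / T * 2 ^ m - real (grid_index T m t))"
    using assms(1) unfolding grid_def by (simp add: field_simps)
  moreover have "\<bar>t / T * 2 ^ m - real (grid_index T m t)\<bar> \<le> 1"
    using grid_index_bounds[OF assms, of m] by linarith
  ultimately show ?thesis
    using assms(1) by (simp add: abs_mult mult_left_le del: times_divide_eq_left)
qed

context
  fixes T \<alpha> K :: real and f :: "real \<Rightarrow> real"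
  assumes T: "0 < T" and \<alpha>: "0 < \<alpha>" and K: "0 \<le> K"
    and incr: "\<And>m k. k < 2 ^ m \<Longrightarrow> \<bar>f (grid T m (Suc k)) - f (grid T m k)\<bar> \<le> K * (1 / 2 powr \<alpha>) ^ m"
begin

abbreviation (input) "dyad m t \<equiv> f (grid T m (grid_index T m t))"
abbreviation (input) "rr \<equiv> 1 / 2 powr \<alpha>"

lemma ratio_bounds: "0 < rr" "rr < 1"
  using \<alpha> by simp_all

lemma dyadic_Suc_diff:
  assumes t: "t \<in> {0..T}"
  shows "\<bar>dyad (Suc m) t - dyad m t\<bar> \<le> K * rr ^ Suc m"
  using grid_index_Suc[OF T t, of m]
proof
  assume "grid_index T (Suc m) t = 2 * grid_index T m t"
  then have "dyad (Suc m) t - dyad m t = 0" by (simp add: grid_double)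
  then show ?thesis using K by simp
next
  assume *: "grid_index T (Suc m) t = Suc (2 * grid_index T m t)"
  then have "2 * grid_index T m t < 2 ^ Suc m" using grid_index_le[OF T t, of "Suc m"] by simp
  from incr[OF this] show ?thesis unfolding * grid_double .
qed

lemma dyadic_diff:
  assumes t: "t \<in> {0..T}"
  shows "\<bar>dyad (m + j) t - dyad m t\<bar> \<le> K * rr ^ m / (1 - rr)"
proof -
  have "\<bar>dyad (m + j) t - dyad m t\<bar> \<le> (\<Sum>i<j. K * rr ^ Suc (m + i))"
  proof (induction j)
    case (Suc j)
    then show ?case using dyadic_Suc_diff[OF t, of "m + j"] by simp
  qed simp
  also have "\<dots> \<le> (\<Sum>i<j. K * rr ^ m * rr ^ i)"
  proof (rule sum_mono)
    fix i
    have "rr ^ Suc (m + i) \<le> rr ^ (m + i)"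
      by (rule power_decreasing) (use ratio_bounds in auto)
    then have "K * rr ^ Suc (m + i) \<le> K * rr ^ (m + i)"
      using K by (rule mult_left_mono)
    then show "K * rr ^ Suc (m + i) \<le> K * rr ^ m * rr ^ i"
      by (simp only: power_add mult.assoc)
  qed
  also have "\<dots> = K * rr ^ m * (\<Sum>i<j. rr ^ i)" by (rule sum_distrib_left[symmetric])
  also have "(\<Sum>i<j. rr ^ i) = (1 - rr ^ j) / (1 - rr)"
  proof -
    have "rr \<noteq> 1" using ratio_bounds(2) by (rule less_imp_neq)
    then show ?thesis unfolding sum_gp_strict by (simp only: if_False)
  qed
  also have "K * rr ^ m * ((1 - rr ^ j) / (1 - rr)) \<le> K * rr ^ m * (1 / (1 - rr))"
    using K ratio_bounds by (intro mult_left_mono divide_right_mono) auto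
  finally show ?thesis by simp
qed

lemma dyadic_convergent:
  assumes t: "t \<in> {0..T}"
  shows "(\<lambda>m. dyad m t) \<longlonglongrightarrow> lim (\<lambda>m. dyad m t)"
proof -
  have "summable (\<lambda>m. dyad (Suc m) t - dyad m t)"
  proof (rule summable_comparison_test'[where N = 0])
    show "summable (\<lambda>m. K * rr ^ Suc m)"
      using ratio_bounds by (intro summable_mult, subst summable_Suc_iff) (simp add: summable_geometric)
    show "norm (dyad (Suc m) t - dyad m t) \<le> K * rr ^ Suc m" for m
      using dyadic_Suc_diff[OF t] by simp
  qed
  then have "(\<lambda>m. \<Sum>i<m. dyad (Suc i) t - dyad i t) \<longlonglongrightarrow> (\<Sum>i. dyad (Suc i) t - dyad i t)"
    by (rule summable_LIMSEQ)
  then have "(\<lambda>m. dyad m t - dyad 0 t) \<longlonglongrightarrow> (\<Sum>i. dyad (Suc i) t - dyad i t)"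
    unfolding sum_lessThan_telescope[of "\<lambda>i. dyad i t"] .
  from tendsto_add[OF this tendsto_const[of "dyad 0 t"]] have "convergent (\<lambda>m. dyad m t)"
    by (auto simp: convergent_def)
  then show ?thesis by (simp add: convergent_LIMSEQ_iff)
qed

lemma dyadic_limit_diff:
  assumes t: "t \<in> {0..T}"
  shows "\<bar>lim (\<lambda>m. dyad m t) - dyad m t\<bar> \<le> K * rr ^ m / (1 - rr)"
proof (rule LIMSEQ_le_const2)
  show "(\<lambda>j. \<bar>dyad (m + j) t - dyad m t\<bar>) \<longlonglongrightarrow> \<bar>lim (\<lambda>m. dyad m t) - dyad m t\<bar>"
    using LIMSEQ_ignore_initial_segment[OF dyadic_convergent[OF t], of m]
    by (intro tendsto_intros) (simp add: add.commute)
qed (use dyadic_diff[OF t] in blast)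

text \<open>At the level matching the distance of \<open>s\<close> and \<open>t\<close>, their left
  approximations coincide or are neighbours. The increment of the limit is then at most one grid
  increment plus two geometric tails, all of order \<open>rr ^ m\<close>.\<close>

lemma dyadic_limit_increment:
  assumes st: "s \<in> {0..T}" "t \<in> {0..T}" "s < t"
  shows "\<bar>lim (\<lambda>m. dyad m t) - lim (\<lambda>m. dyad m s)\<bar> \<le> (K + 2 * (K / (1 - rr))) / (rr * T powr \<alpha>) * \<bar>t - s\<bar> powr \<alpha>"
proof -
  define v where "v = (t - s) / T"
  have v: "0 < v" "v \<le> 1" using st T by (auto simp: v_def)
  have "\<exists>m. (1/2::real) ^ Suc m < v"
  proof -
    obtain n where "(1/2::real) ^ n < v" using real_arch_pow_inv[OF v(1), of "1/2"] by auto
    moreover have "(1/2::real) ^ Suc n \<le> (1/2) ^ n" by (intro power_decreasing) auto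
    ultimately show ?thesis by (meson order_le_less_trans)
  qed
  \<comment> \<open>Minimality gives \<open>v \<le> 2^(-m)\<close>, which forces the indices to
    differ by at most one. The defining property \<open>2^(-m-1) < v\<close> bounds
    \<open>rr ^ m\<close> by \<open>v powr \<alpha> / rr\<close>, at the cost of one factor
    \<open>rr\<close>.\<close>
  define m where "m = (LEAST m. (1/2::real) ^ Suc m < v)"
  have m1: "(1/2::real) ^ Suc m < v" unfolding m_def by (rule LeastI_ex) fact
  have m2: "v \<le> (1/2) ^ m"
  proof (cases m)
    case 0
    then show ?thesis using v by simp
  next
    case (Suc k)
    then have "k < m" by simp
    from not_less_Least[OF this[unfolded m_def]] show ?thesis unfolding Suc by simp
  qed
  let ?i = "grid_index T m s" and ?j = "grid_index T m t"
  have "v * 2 ^ m \<le> 1" using m2 by (simp add: field_simps power_one_over)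
  moreover have "t / T * 2 ^ m - s / T * 2 ^ m = v * 2 ^ m"
    by (simp add: v_def diff_divide_distrib left_diff_distrib)
  moreover have "s / T * 2 ^ m \<le> t / T * 2 ^ m"
    using st T by (intro mult_right_mono divide_right_mono) auto
  ultimately have "real ?i < real (?j + 1)" "real ?j < real (?i + 2)"
    using grid_index_bounds[OF T st(1), of m] grid_index_bounds[OF T st(2), of m] by simp_all
  then have "?i < ?j + 1" "?j < ?i + 2" unfolding of_nat_less_iff .
  then consider "?j = ?i" | "?j = Suc ?i" by linarith
  then have adj: "\<bar>dyad m t - dyad m s\<bar> \<le> K * rr ^ m"
  proof cases
    case 1
    then show ?thesis using K by simp
  next
    case 2
    then have "?i < 2 ^ m" using grid_index_le[OF T st(2), of m] by simp
    then show ?thesis unfolding 2 by (rule incr)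
  qed
  have "\<bar>lim (\<lambda>m. dyad m t) - lim (\<lambda>m. dyad m s)\<bar> \<le> K * rr ^ m + 2 * (K * rr ^ m / (1 - rr))"
    using adj dyadic_limit_diff[OF st(1), of m] dyadic_limit_diff[OF st(2), of m] by linarith
  also have "\<dots> = (K + 2 * (K / (1 - rr))) * rr ^ m" by (simp add: distrib_right)
  also have "\<dots> \<le> (K + 2 * (K / (1 - rr))) * (v powr \<alpha> / rr)"
  proof (rule mult_left_mono)
    have "((1/2) ^ Suc m) powr \<alpha> \<le> v powr \<alpha>"
      using m1 \<alpha> by (intro powr_mono2) auto
    moreover have "((1/2::real) ^ Suc m) powr \<alpha> = rr ^ Suc m"
      by (subst power_powr) (simp_all add: powr_divide)
    ultimately have "rr ^ Suc m \<le> v powr \<alpha>" by (simp only:)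
    then have "rr ^ m * rr \<le> v powr \<alpha>" by (simp only: power_Suc2)
    then show "rr ^ m \<le> v powr \<alpha> / rr"
      using ratio_bounds(1) by (simp only: pos_le_divide_eq)
    show "0 \<le> K + 2 * (K / (1 - rr))" using K ratio_bounds by simp
  qed
  also have "v powr \<alpha> = \<bar>t - s\<bar> powr \<alpha> / T powr \<alpha>"
    using st T by (simp add: v_def powr_divide)
  finally show ?thesis by (simp add: mult_ac)
qed

lemma holder_continuous_on_dyadic_limit:
  "holder_continuous_on \<alpha> {0..T} (\<lambda>t. lim (\<lambda>m. dyad m t))"
  unfolding holder_continuous_on_def
proof (intro exI ballI)
  fix s t assume st: "s \<in> {0..T}" "t \<in> {0..T}"
  consider "s = t" | "s < t" | "t < s" by linarith
  then show "\<bar>lim (\<lambda>m. dyad m t) - lim (\<lambda>m. dyad m s)\<bar> \<le> (K + 2 * (K / (1 - rr))) / (rr * T powr \<alpha>) * \<bar>t - s\<bar> powr \<alpha>"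
  proof cases
    case 2
    then show ?thesis by (rule dyadic_limit_increment[OF st])
  next
    case 3
    then show ?thesis using dyadic_limit_increment[OF st(2,1)] by (simp only: abs_minus_commute)
  qed simp
qed

end

text \<open>One random series \<open>S\<close>, summing the \<open>n\<close>-th powers of all grid
  increments with weight \<open>2^(n \<alpha> m)\<close> at level \<open>m\<close>, has finite
  expectation. Where it is finite, it bounds all increments at once and yields an explicit random
  constant for the chaining argument.\<close>

theorem (in prob_space) kolmogorov_continuity:
  fixes X :: "real \<Rightarrow> 'a \<Rightarrow> real"
  assumes T: "0 < T" and \<alpha>: "0 < \<alpha>" and C: "0 \<le> C" and n: "0 < n" and b: "1 + real n * \<alpha> < b"
    and meas: "\<And>t. t \<in> {0..T} \<Longrightarrow> X t \<in> borel_measurable M"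
    and mom: "\<And>s t. s \<in> {0..T} \<Longrightarrow> t \<in> {0..T} \<Longrightarrow>
      (\<integral>\<^sup>+\<omega>. ennreal (\<bar>X t \<omega> - X s \<omega>\<bar> ^ n) \<partial>M) \<le> ennreal (C * \<bar>t - s\<bar> powr b)"
  shows "\<exists>X'. modification_on M {0..T} X X' \<and>
    (\<forall>\<omega>\<in>space M. holder_continuous_on \<alpha> {0..T} (\<lambda>t. X' t \<omega>))"
proof -
  let ?\<Delta> = "\<lambda>m k \<omega>. \<bar>X (grid T m (Suc k)) \<omega> - X (grid T m k) \<omega>\<bar>"
  define D where "D m \<omega> = (\<Sum>k<2^m. ?\<Delta> m k \<omega> ^ n)" for m \<omega>
  define R where "R = 2 powr (real n * \<alpha>)"
  define S where "S \<omega> = (\<Sum>m. ennreal (R ^ m * D m \<omega>))" for \<omega>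
  have R: "0 < R" by (simp add: R_def)
  have Xg[measurable]: "X (grid T m k) \<in> borel_measurable M" if "k \<le> 2 ^ m" for m k
    by (intro meas grid_mem T that)
  have D[measurable]: "D m \<in> borel_measurable M" for m
    unfolding D_def using Xg by (intro borel_measurable_sum borel_measurable_power borel_measurable_abs borel_measurable_diff) auto
  have S[measurable]: "S \<in> borel_measurable M" unfolding S_def by measurable
  have D_nn: "0 \<le> D m \<omega>" for m \<omega> unfolding D_def by (intro sum_nonneg) simp
  \<comment> \<open>Ratio of consecutive levels in the bound for the expectation of
    \<open>S\<close>: \<open>R\<close> is the growth of the weight, 2 that of the number of
    increments, and \<open>2 powr b\<close> the gain from halving the mesh. It is below 1 because
    \<open>1 + n \<alpha> < b\<close>.\<close>
  define q where "q = R * 2 / 2 powr b"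
  have q: "0 < q" "q < 1"
  proof -
    have "R * 2 = 2 powr (real n * \<alpha> + 1)" by (simp add: R_def powr_add)
    also have "\<dots> < 2 powr b" using b by (intro powr_less_mono) auto
    finally show "q < 1" by (simp add: q_def)
    show "0 < q" using R by (simp add: q_def)
  qed
  have ED: "(\<integral>\<^sup>+\<omega>. ennreal (R ^ m * D m \<omega>) \<partial>M) \<le> ennreal (C * T powr b * q ^ m)" for m
  proof -
    have "(\<integral>\<^sup>+\<omega>. ennreal (R ^ m * D m \<omega>) \<partial>M)
      = (\<integral>\<^sup>+\<omega>. ennreal (R ^ m) * (\<Sum>k<2^m. ennreal (?\<Delta> m k \<omega> ^ n)) \<partial>M)"
      using R D_nn unfolding D_def by (intro nn_integral_cong) (simp add: ennreal_mult sum_nonneg)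
    also have "\<dots> = ennreal (R ^ m) * (\<integral>\<^sup>+\<omega>. (\<Sum>k<2^m. ennreal (?\<Delta> m k \<omega> ^ n)) \<partial>M)"
      using Xg by (intro nn_integral_cmult borel_measurable_sum measurable_ennreal
        borel_measurable_power borel_measurable_abs borel_measurable_diff measurable_compose[OF _ measurable_ennreal]) auto
    also have "(\<integral>\<^sup>+\<omega>. (\<Sum>k<2^m. ennreal (?\<Delta> m k \<omega> ^ n)) \<partial>M)
      = (\<Sum>k<2^m. \<integral>\<^sup>+\<omega>. ennreal (?\<Delta> m k \<omega> ^ n) \<partial>M)"
      using Xg by (intro nn_integral_sum
        borel_measurable_power borel_measurable_abs borel_measurable_diff measurable_compose[OF _ measurable_ennreal]) auto
    also have "\<dots> \<le> (\<Sum>k<(2::nat)^m. ennreal (C * (T / 2 ^ m) powr b))"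
    proof (rule sum_mono)
      fix k :: nat assume "k \<in> {..<2^m}"
      then have "grid T m (Suc k) \<in> {0..T}" "grid T m k \<in> {0..T}"
        using T by (auto intro!: grid_mem simp del: atLeastAtMost_iff)
      from mom[OF this(2,1)] show "(\<integral>\<^sup>+\<omega>. ennreal (?\<Delta> m k \<omega> ^ n) \<partial>M)
        \<le> ennreal (C * (T / 2 ^ m) powr b)"
        using T by (simp add: grid_def diff_divide_distrib[symmetric] right_diff_distrib[symmetric])
    qed
    also have "\<dots> = ennreal (2 ^ m * (C * (T / 2 ^ m) powr b))"
      using C by (simp add: ennreal_mult ennreal_of_nat_eq_real_of_nat)
    also have "ennreal (R ^ m) * \<dots> = ennreal (R ^ m * (2 ^ m * (C * (T / 2 ^ m) powr b)))"
      using C R by (intro ennreal_mult[symmetric]) auto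
    also have "R ^ m * (2 ^ m * (C * (T / 2 ^ m) powr b)) = C * T powr b * q ^ m"
    proof -
      have "((2::real) ^ m) powr b = (2 powr b) ^ m"
        by (rule power_powr) simp
      then show ?thesis using T
        by (simp add: q_def powr_divide power_divide power_mult_distrib)
    qed
    finally show ?thesis by (simp add: mult_left_mono)
  qed
  have "(\<integral>\<^sup>+\<omega>. S \<omega> \<partial>M) = (\<Sum>m. \<integral>\<^sup>+\<omega>. ennreal (R ^ m * D m \<omega>) \<partial>M)"
    unfolding S_def by (rule nn_integral_suminf) measurable
  also have "\<dots> \<le> (\<Sum>m. ennreal (C * T powr b * q ^ m))"
    by (intro suminf_le ED summableI)
  also have "\<dots> < top"
    using C q by (subst suminf_ennreal2) (auto intro!: summable_mult summable_geometric)
  finally have "AE \<omega> in M. S \<omega> \<noteq> \<infinity>"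
    by (intro nn_integral_PInf_AE S) auto
  then have AE_S: "AE \<omega> in M. S \<omega> < top" by (simp add: less_top)
  \<comment> \<open>Each single term is at most the whole series, so \<open>R ^ m\<close> times the
    \<open>n\<close>-th power of an increment is bounded by \<open>S\<close>. Taking
    \<open>n\<close>-th roots gives the constant \<open>root n B\<close>.\<close>
  have incr: "\<exists>K\<ge>0. \<forall>m k. k < 2 ^ m \<longrightarrow> ?\<Delta> m k \<omega> \<le> K * (1 / 2 powr \<alpha>) ^ m"
    if fin: "S \<omega> < top" for \<omega>
  proof (intro exI conjI allI impI)
    define B where "B = enn2real (S \<omega>)"
    have B: "ennreal B = S \<omega>" "0 \<le> B" using fin by (simp_all add: B_def)
    show "0 \<le> root n B" using B n by simp
    fix m k :: nat assume k: "k < 2 ^ m"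
    have "ennreal (R ^ m * D m \<omega>) \<le> S \<omega>"
      unfolding S_def using sum_le_suminf[of "\<lambda>m. ennreal (R ^ m * D m \<omega>)" "{m}"] by simp
    then have RD: "R ^ m * D m \<omega> \<le> B" using B by (metis ennreal_le_iff)
    let ?x = "?\<Delta> m k \<omega>"
    have "?x ^ n \<le> D m \<omega>"
      unfolding D_def using k by (intro member_le_sum[of k "{..<2^m}" "\<lambda>k. ?\<Delta> m k \<omega> ^ n"]) auto
    then have "R ^ m * ?x ^ n \<le> B" using RD R by (meson mult_left_mono order_trans zero_le_power less_imp_le)
    moreover have "R ^ m = ((2 powr \<alpha>) ^ m) ^ n"
      unfolding R_def by (simp add: powr_power mult.commute mult.left_commute flip: power_mult)
    ultimately have "((2 powr \<alpha>) ^ m * ?x) ^ n \<le> B" by (simp add: power_mult_distrib)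
    then have "root n (((2 powr \<alpha>) ^ m * ?x) ^ n) \<le> root n B"
      using n by (subst real_root_le_iff)
    then have "(2 powr \<alpha>) ^ m * ?x \<le> root n B"
      using n by (simp add: real_root_power_cancel)
    then show "?x \<le> root n B * (1 / 2 powr \<alpha>) ^ m"
      by (simp add: power_one_over field_simps)
  qed
  \<comment> \<open>Where \<open>S\<close> is infinite the path is replaced by 0, so that every path
    is Holder continuous and not only almost every one.\<close>
  define X' where "X' t \<omega> = (if S \<omega> < top then lim (\<lambda>m. X (grid T m (grid_index T m t)) \<omega>) else 0)" for t \<omega>
  have "modification_on M {0..T} X X'"
    unfolding modification_on_def
  proof (intro ballI conjI)
    fix t assume t: "t \<in> {0..T}"
    have [measurable]: "X (grid T m (grid_index T m t)) \<in> borel_measurable M" for m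
      by (intro Xg grid_index_le T t)
    note [measurable] = meas[OF t]
    show "X' t \<in> borel_measurable M" unfolding X'_def by measurable
    \<comment> \<open>For fixed \<open>t\<close> the grid values converge to \<open>X t\<close> in
      the \<open>n\<close>-th mean, hence almost surely along a subsequence. This identifies the
      dyadic limit with \<open>X t\<close>, although the paths of \<open>X\<close> need not be
      continuous.\<close>
    define u where "u m \<omega> = \<bar>X t \<omega> - X (grid T m (grid_index T m t)) \<omega>\<bar> ^ n" for m \<omega>
    have u_le: "(\<integral>\<^sup>+\<omega>. ennreal (u m \<omega>) \<partial>M) \<le> ennreal (C * (T / 2 ^ m) powr b)" for m
    proof -
      have "(\<integral>\<^sup>+\<omega>. ennreal (u m \<omega>) \<partial>M) \<le> ennreal (C * \<bar>t - grid T m (grid_index T m t)\<bar> powr b)"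
        unfolding u_def by (intro mom t grid_mem T grid_index_le)
      also have "\<dots> \<le> ennreal (C * (T / 2 ^ m) powr b)"
      proof (intro ennreal_leI mult_left_mono C powr_mono2)
        have "0 \<le> real n * \<alpha>" using \<alpha> by simp
        then show "0 \<le> b" using b by linarith
      qed (use grid_index_dist[OF T t] in simp_all)
      finally show ?thesis .
    qed
    have "(\<lambda>m. \<integral>\<^sup>+\<omega>. ennreal (u m \<omega>) \<partial>M) \<longlonglongrightarrow> 0"
    proof (rule tendsto_sandwich[OF _ _ tendsto_const])
      have "(\<lambda>m. T / 2 ^ m) \<longlonglongrightarrow> 0" by real_asymp
      moreover have "0 < b" using b \<alpha> n by (smt (verit) mult_nonneg_nonneg of_nat_0_le_iff)
      ultimately have "(\<lambda>m. C * (T / 2 ^ m) powr b) \<longlonglongrightarrow> C * 0"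
        using T by (intro tendsto_mult tendsto_const tendsto_zero_powrI[where b = b]) auto
      then show "(\<lambda>m. ennreal (C * (T / 2 ^ m) powr b)) \<longlonglongrightarrow> 0"
        using tendsto_ennrealI by fastforce
    qed (use u_le in auto)
    from nn_integral_tendsto_0_AE_subseq[OF _ _ this] obtain r where r: "strict_mono r"
      "AE \<omega> in M. (\<lambda>m. u (r m) \<omega>) \<longlonglongrightarrow> 0"
      unfolding u_def by auto
    show "AE \<omega> in M. X' t \<omega> = X t \<omega>"
      using AE_S r(2)
    proof eventually_elim
      case (elim \<omega>)
      obtain K where K: "0 \<le> K" "\<And>m k. k < 2 ^ m \<Longrightarrow> ?\<Delta> m k \<omega> \<le> K * (1 / 2 powr \<alpha>) ^ m"
        using incr[OF elim(1)] by blast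
      let ?a = "\<lambda>m. X (grid T m (grid_index T m t)) \<omega>"
      have "?a \<longlonglongrightarrow> lim ?a" by (rule dyadic_convergent[OF T \<alpha> K t])
      then have 1: "(\<lambda>m. ?a (r m)) \<longlonglongrightarrow> lim ?a" using LIMSEQ_subseq_LIMSEQ[OF _ r(1)] by (fastforce simp: o_def)
      have "(\<lambda>m. root n (u (r m) \<omega>)) \<longlonglongrightarrow> root n 0" by (intro tendsto_real_root elim)
      then have "(\<lambda>m. \<bar>X t \<omega> - ?a (r m)\<bar>) \<longlonglongrightarrow> 0"
        using n by (simp add: u_def real_root_power_cancel)
      then have "(\<lambda>m. X t \<omega> - ?a (r m)) \<longlonglongrightarrow> 0" by (rule tendsto_rabs_zero_cancel)
      from tendsto_diff[OF tendsto_const[of "X t \<omega>"] this] have "(\<lambda>m. ?a (r m)) \<longlonglongrightarrow> X t \<omega>" by simp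
      from LIMSEQ_unique[OF 1 this] show ?case using elim(1) by (simp add: X'_def)
    qed
  qed
  moreover have "holder_continuous_on \<alpha> {0..T} (\<lambda>t. X' t \<omega>)" for \<omega>
  proof (cases "S \<omega> < top")
    case True
    then obtain K where K: "0 \<le> K" "\<And>m k. k < 2 ^ m \<Longrightarrow> ?\<Delta> m k \<omega> \<le> K * (1 / 2 powr \<alpha>) ^ m"
      using incr by blast
    show ?thesis using holder_continuous_on_dyadic_limit[OF T \<alpha> K] True by (simp add: X'_def)
  next
    case False
    then show ?thesis unfolding X'_def holder_continuous_on_def by (intro exI[of _ 0]) simp
  qed
  ultimately show ?thesis by blast
qed

section \<open>Energy of power kernels\<close>

lemma nn_integral_powr_Icc_0:
  assumes "-1 < a" "0 \<le> d"
  shows "(\<integral>\<^sup>+w. indicator {0..d} w * ennreal (w powr a) \<partial>lborel) = ennreal (d powr (a + 1) / (a + 1))"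
  using nn_integral_has_integral_lebesgue[OF _ has_integral_powr_from_0[OF assms]] 
  by (simp add: ennreal_mult' ennreal_indicator)

lemma nn_integral_powr_Ici:
  assumes "e < -1" "0 < d"
  shows "(\<integral>\<^sup>+w. indicator {d..} w * ennreal (w powr e) \<partial>lborel) = ennreal (- (d powr (e + 1)) / (e + 1))"
  using nn_integral_has_integral_lebesgue[OF _ has_integral_powr_to_inf[OF assms]] 
  by (simp add: ennreal_mult' ennreal_indicator)

lemma pos_powr_nonneg: "0 \<le> pos_powr u a"
  by (simp add: pos_powr_def)

lemma pos_powr_measurable[measurable (raw)]:
  assumes [measurable]: "f \<in> borel_measurable N"
  shows "(\<lambda>x. pos_powr (f x) a) \<in> borel_measurable N"
  unfolding pos_powr_def by measurable

text \<open>The two terms come from integrating over \<open>[0, d]\<close> and over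
  \<open>[d, \<infinity>)\<close>. The second is positive for \<open>a < -1/2\<close>, where
  \<open>2 * a + 1\<close> is negative.\<close>

definition overlap_const :: "real \<Rightarrow> real" where
  "overlap_const a = 1 / (a + 1) - 1 / (2 * a + 1)"

lemma overlap_const_nonneg:
  assumes "-1 < a" "a < -1/2"
  shows "0 \<le> overlap_const a"
proof -
  have "0 \<le> 1 / (a + 1)" "1 / (2 * a + 1) \<le> 0"
    using assms by (auto simp: divide_le_0_iff)
  then show ?thesis unfolding overlap_const_def by linarith
qed

text \<open>With \<open>w = u - x\<close> and \<open>d = v - u\<close> the integrand is
  \<open>w^a (w + d)^a\<close>. Since \<open>a\<close> is negative, the second factor is at most
  \<open>d^a\<close> for \<open>w \<le> d\<close> and at most \<open>w^a\<close> beyond.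
  Integrability at 0 uses \<open>a > -1\<close>, at infinity \<open>2 a < -1\<close>.\<close>

lemma pos_powr_overlap_aux:
  assumes a: "-1 < a" "a < -1/2" and "u < v"
  shows "(\<integral>\<^sup>+x. ennreal (pos_powr (u - x) a * pos_powr (v - x) a) \<partial>lborel)
    \<le> ennreal (overlap_const a * (v - u) powr (2 * a + 1))"
proof -
  define d where "d = v - u"
  have d: "0 < d" using assms by (simp add: d_def)
  have "(\<integral>\<^sup>+x. ennreal (pos_powr (u - x) a * pos_powr (v - x) a) \<partial>lborel)
    = (\<integral>\<^sup>+w. ennreal (pos_powr w a * pos_powr (w + d) a) \<partial>lborel)"
    by (subst nn_integral_real_affine[where c = "-1" and t = u]) (auto simp: d_def algebra_simps)
  also have "\<dots> \<le> (\<integral>\<^sup>+w. ennreal (d powr a) * (indicator {0..d} w * ennreal (w powr a))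
      + indicator {d..} w * ennreal (w powr (2 * a)) \<partial>lborel)"
  proof (rule nn_integral_mono)
    fix w :: real
    consider "w \<le> 0" | "0 < w" "w \<le> d" | "d < w" by linarith
    then show "ennreal (pos_powr w a * pos_powr (w + d) a)
      \<le> ennreal (d powr a) * (indicator {0..d} w * ennreal (w powr a)) + indicator {d..} w * ennreal (w powr (2 * a))"
    proof cases
      case 1
      then show ?thesis by (simp add: pos_powr_def)
    next
      case 2
      have "(w + d) powr a \<le> d powr a" using 2 d a by (intro powr_mono2') auto
      from mult_right_mono[OF this, of "w powr a"] have "w powr a * (w + d) powr a \<le> d powr a * w powr a"
        by (simp add: mult.commute)
      then have "ennreal (pos_powr w a * pos_powr (w + d) a) \<le> ennreal (d powr a * w powr a)"
        using 2 d by (intro ennreal_leI) (simp add: pos_powr_def)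
      also have "\<dots> = ennreal (d powr a) * (indicator {0..d} w * ennreal (w powr a))"
        using 2 by (simp add: ennreal_mult)
      finally show ?thesis by (simp add: add_increasing2)
    next
      case 3
      have "(w + d) powr a \<le> w powr a" using 3 d a by (intro powr_mono2') auto
      then have "w powr a * (w + d) powr a \<le> w powr a * w powr a" by (intro mult_left_mono) auto
      also have "w powr a * w powr a = w powr (2 * a)" using powr_add[of w a a] by simp
      finally have "ennreal (pos_powr w a * pos_powr (w + d) a) \<le> ennreal (w powr (2 * a))"
        using 3 d by (intro ennreal_leI) (simp add: pos_powr_def)
      also have "\<dots> = indicator {d..} w * ennreal (w powr (2 * a))" using 3 by simp
      finally show ?thesis by (simp add: add_increasing)
    qed
  qed
  also have "\<dots> = ennreal (d powr a) * ennreal (d powr (a + 1) / (a + 1)) + ennreal (- (d powr (2 * a + 1)) / (2 * a + 1))"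
    using a d by (subst nn_integral_add) (simp_all add: nn_integral_cmult nn_integral_powr_Icc_0 nn_integral_powr_Ici)
  also have "\<dots> = ennreal (d powr a * (d powr (a + 1) / (a + 1)) + - (d powr (2 * a + 1)) / (2 * a + 1))"
  proof -
    have "0 \<le> - (d powr (2 * a + 1)) / (2 * a + 1)" using a by (intro divide_nonpos_neg) auto
    moreover have "ennreal (d powr a) * ennreal (d powr (a + 1) / (a + 1)) = ennreal (d powr a * (d powr (a + 1) / (a + 1)))"
      using a by (intro ennreal_mult[symmetric]) auto
    ultimately show ?thesis using a by (subst ennreal_plus) auto
  qed
  also have "d powr a * (d powr (a + 1) / (a + 1)) + - (d powr (2 * a + 1)) / (2 * a + 1) = overlap_const a * d powr (2 * a + 1)"
  proof -
    have "d powr a * d powr (a + 1) = d powr (2 * a + 1)" using powr_add[of d a "a + 1"] by (simp add: algebra_simps)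
    then show ?thesis by (simp add: overlap_const_def algebra_simps)
  qed
  finally show ?thesis by (simp add: d_def)
qed

lemma pos_powr_overlap:
  assumes a: "-1 < a" "a < -1/2" and "u \<noteq> v"
  shows "(\<integral>\<^sup>+x. ennreal (pos_powr (u - x) a * pos_powr (v - x) a) \<partial>lborel)
    \<le> ennreal (overlap_const a * \<bar>u - v\<bar> powr (2 * a + 1))"
proof (cases "u < v")
  case True
  then show ?thesis using pos_powr_overlap_aux[OF a True] by simp
next
  case False
  then have "v < u" using assms by simp
  then show ?thesis using pos_powr_overlap_aux[OF a \<open>v < u\<close>] by (simp add: mult.commute)
qed

text \<open>The interval is enlarged to length \<open>t - s\<close> on both sides of
  \<open>v\<close>, which makes the bound uniform in \<open>v\<close> and accounts for the factor
  2.\<close>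

lemma nn_integral_abs_powr_le:
  assumes c: "-1 < c" and v: "v \<in> {s..t}"
  shows "(\<integral>\<^sup>+u. indicator {s..t} u * ennreal (\<bar>u - v\<bar> powr c) \<partial>lborel) \<le> ennreal (2 * (t - s) powr (c + 1) / (c + 1))"
proof -
  define L where "L = t - s"
  have L: "0 \<le> L" using v by (simp add: L_def)
  have "(\<integral>\<^sup>+u. indicator {s..t} u * ennreal (\<bar>u - v\<bar> powr c) \<partial>lborel)
      = (\<integral>\<^sup>+w. indicator {s..t} (v + w) * ennreal (\<bar>w\<bar> powr c) \<partial>lborel)"
    by (subst nn_integral_real_affine[where c = 1 and t = v]) auto
  also have "\<dots> \<le> (\<integral>\<^sup>+w. indicator {0..L} w * ennreal (w powr c) + indicator {0..L} (0 + - 1 * w) * ennreal ((0 + - 1 * w) powr c) \<partial>lborel)"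
  proof (rule nn_integral_mono)
    fix w :: real
    show "indicator {s..t} (v + w) * ennreal (\<bar>w\<bar> powr c)
      \<le> indicator {0..L} w * ennreal (w powr c) + indicator {0..L} (0 + - 1 * w) * ennreal ((0 + - 1 * w) powr c)"
      using v by (cases "0 \<le> w") (auto simp: indicator_def L_def)
  qed
  also have "\<dots> = (\<integral>\<^sup>+w. indicator {0..L} w * ennreal (w powr c) \<partial>lborel)
      + (\<integral>\<^sup>+w. indicator {0..L} (0 + - 1 * w) * ennreal ((0 + - 1 * w) powr c) \<partial>lborel)"
    by (rule nn_integral_add) measurable
  also have "(\<integral>\<^sup>+w. indicator {0..L} (0 + - 1 * w) * ennreal ((0 + - 1 * w) powr c) \<partial>lborel)
      = (\<integral>\<^sup>+w. indicator {0..L} w * ennreal (w powr c) \<partial>lborel)"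
    by (subst (2) nn_integral_real_affine[where c = "- 1" and t = 0]) auto
  also have "(\<integral>\<^sup>+w. indicator {0..L} w * ennreal (w powr c) \<partial>lborel) = ennreal (L powr (c + 1) / (c + 1))"
    by (rule nn_integral_powr_Icc_0[OF c L])
  also have "ennreal (L powr (c + 1) / (c + 1)) + ennreal (L powr (c + 1) / (c + 1)) = ennreal (2 * L powr (c + 1) / (c + 1))"
    using c by (subst ennreal_plus[symmetric]) auto
  finally show ?thesis by (simp add: L_def)
qed

section \<open>Energy of a product of two powers over a time interval\<close>

definition power_kernel :: "real \<Rightarrow> real \<Rightarrow> real \<Rightarrow> real \<times> real \<Rightarrow> real" where
  "power_kernel a b u z = pos_powr (u - fst z) a * pos_powr (u - snd z) b"

lemma power_kernel_nonneg: "0 \<le> power_kernel a b u z"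
  by (simp add: power_kernel_def pos_powr_nonneg)

abbreviation (input) nn_ivl :: "real \<Rightarrow> real \<Rightarrow> (real \<Rightarrow> real) \<Rightarrow> ennreal" where
  "nn_ivl s t f \<equiv> (\<integral>\<^sup>+u. indicator {s..t} u * ennreal (f u) \<partial>lborel)"

definition energy_const :: "real \<Rightarrow> real \<Rightarrow> real" where
  "energy_const a b = overlap_const a * overlap_const b * (2 / (2 * a + 2 * b + 3))"

lemma nn_integral_square_eq_double:
  assumes [measurable]: "g \<in> borel_measurable N"
  shows "(\<integral>\<^sup>+u. g u \<partial>N)\<^sup>2 = (\<integral>\<^sup>+u. \<integral>\<^sup>+v. g u * g v \<partial>N \<partial>N)"
  by (simp add: nn_integral_cmult nn_integral_multc power2_eq_square)

text \<open>The squared time integral is a double integral over \<open>u\<close> and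
  \<open>v\<close>. After Tonelli's theorem the space integrals factor into two overlaps, bounded by
  multiples of \<open>|u - v|^(2a + 1)\<close> and \<open>|u - v|^(2b + 1)\<close>. Their product
  has exponent \<open>c = 2 a + 2 b + 2\<close>, above \<open>-1\<close> since both exponents exceed
  \<open>-3/4\<close>, and integrating it over the square of \<open>[s, t]\<close> gives the order
  \<open>c + 2\<close>.\<close>

lemma power_kernel_energy:
  assumes a: "-3/4 < a" "a < -1/2" and b: "-3/4 < b" "b < -1/2" and st: "s \<le> t"
  shows "(\<integral>\<^sup>+z. (nn_ivl s t (\<lambda>u. power_kernel a b u z))\<^sup>2 \<partial>lborel)
    \<le> ennreal (energy_const a b * (t - s) powr (2 * a + 2 * b + 4))"
proof -
  define I :: "real \<Rightarrow> ennreal" where "I = indicator {s..t}"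
  define P where "P u v x = ennreal (pos_powr (u - x) a * pos_powr (v - x) a)" for u v x
  define Q where "Q u v y = ennreal (pos_powr (u - y) b * pos_powr (v - y) b)" for u v y
  define c where "c = 2 * a + 2 * b + 2"
  have c: "-1 < c" using a b by (simp add: c_def)
  have [measurable]: "I \<in> borel_measurable borel" unfolding I_def by measurable
  have [measurable (raw)]: "(\<lambda>w. P (f w) (g w) (h w)) \<in> borel_measurable N"
    "(\<lambda>w. Q (f w) (g w) (h w)) \<in> borel_measurable N"
    if [measurable]: "f \<in> borel_measurable N" "g \<in> borel_measurable N" "h \<in> borel_measurable N"
    for f g h :: "'b \<Rightarrow> real" and N
    unfolding P_def Q_def by measurable
  have K[measurable]: "(\<lambda>(z, u). ennreal (power_kernel a b u z)) \<in> borel_measurable ((lborel \<Otimes>\<^sub>M lborel) \<Otimes>\<^sub>M lborel)"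
    unfolding power_kernel_def by measurable
  have "(\<integral>\<^sup>+z. (\<integral>\<^sup>+u. I u * ennreal (power_kernel a b u z) \<partial>lborel)\<^sup>2 \<partial>lborel)
      = (\<integral>\<^sup>+x. \<integral>\<^sup>+y. (\<integral>\<^sup>+u. I u * ennreal (power_kernel a b u (x, y)) \<partial>lborel)\<^sup>2 \<partial>lborel \<partial>lborel)"
    unfolding lborel_prod[symmetric]
    by (subst lborel.nn_integral_fst[symmetric]) measurable
  also have "\<dots> = (\<integral>\<^sup>+x. \<integral>\<^sup>+y. \<integral>\<^sup>+u. \<integral>\<^sup>+v. I u * I v * (P u v x * Q u v y) \<partial>lborel \<partial>lborel \<partial>lborel \<partial>lborel)"
  proof (intro nn_integral_cong)
    fix x y :: real
    have m: "(\<lambda>u. I u * ennreal (power_kernel a b u (x, y))) \<in> borel_measurable lborel"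
      unfolding power_kernel_def by measurable
    show "(\<integral>\<^sup>+u. I u * ennreal (power_kernel a b u (x, y)) \<partial>lborel)\<^sup>2
      = (\<integral>\<^sup>+u. \<integral>\<^sup>+v. I u * I v * (P u v x * Q u v y) \<partial>lborel \<partial>lborel)"
      unfolding nn_integral_square_eq_double[OF m]
      by (intro nn_integral_cong) (simp add: P_def Q_def power_kernel_def ennreal_mult pos_powr_nonneg mult_ac)
  qed
  \<comment> \<open>Four swaps of adjacent integrals bring the order \<open>x, y, u, v\<close> to
    \<open>u, v, x, y\<close>.\<close>
  also have "\<dots> = (\<integral>\<^sup>+x. \<integral>\<^sup>+u. \<integral>\<^sup>+y. \<integral>\<^sup>+v. I u * I v * (P u v x * Q u v y) \<partial>lborel \<partial>lborel \<partial>lborel \<partial>lborel)"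
    by (intro nn_integral_cong lborel_pair.Fubini') measurable
  also have "\<dots> = (\<integral>\<^sup>+x. \<integral>\<^sup>+u. \<integral>\<^sup>+v. \<integral>\<^sup>+y. I u * I v * (P u v x * Q u v y) \<partial>lborel \<partial>lborel \<partial>lborel \<partial>lborel)"
    by (intro nn_integral_cong lborel_pair.Fubini') measurable
  also have "\<dots> = (\<integral>\<^sup>+u. \<integral>\<^sup>+x. \<integral>\<^sup>+v. \<integral>\<^sup>+y. I u * I v * (P u v x * Q u v y) \<partial>lborel \<partial>lborel \<partial>lborel \<partial>lborel)"
    by (intro lborel_pair.Fubini') measurable
  also have "\<dots> = (\<integral>\<^sup>+u. \<integral>\<^sup>+v. \<integral>\<^sup>+x. \<integral>\<^sup>+y. I u * I v * (P u v x * Q u v y) \<partial>lborel \<partial>lborel \<partial>lborel \<partial>lborel)"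
    by (intro nn_integral_cong lborel_pair.Fubini') measurable
  also have "\<dots> = (\<integral>\<^sup>+u. \<integral>\<^sup>+v. I u * I v * ((\<integral>\<^sup>+x. P u v x \<partial>lborel) * (\<integral>\<^sup>+y. Q u v y \<partial>lborel)) \<partial>lborel \<partial>lborel)"
    by (intro nn_integral_cong) (simp add: nn_integral_cmult nn_integral_multc)
  also have "\<dots> \<le> (\<integral>\<^sup>+u. \<integral>\<^sup>+v. I u * ennreal (overlap_const a * overlap_const b) * (I v * ennreal (\<bar>v - u\<bar> powr c)) \<partial>lborel \<partial>lborel)"
  proof (rule nn_integral_mono, rule nn_integral_mono_AE)
    fix u :: real
    \<comment> \<open>The overlap bound is available only for \<open>u \<noteq> v\<close>; for fixed
      \<open>u\<close> the excluded point is a null set.\<close>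
    have "AE v in lborel. v \<noteq> u" by (rule AE_lborel_singleton)
    then show "AE v in lborel. I u * I v * ((\<integral>\<^sup>+x. P u v x \<partial>lborel) * (\<integral>\<^sup>+y. Q u v y \<partial>lborel))
      \<le> I u * ennreal (overlap_const a * overlap_const b) * (I v * ennreal (\<bar>v - u\<bar> powr c))"
    proof eventually_elim
      case (elim v)
      have "(\<integral>\<^sup>+x. P u v x \<partial>lborel) * (\<integral>\<^sup>+y. Q u v y \<partial>lborel)
        \<le> ennreal (overlap_const a * \<bar>u - v\<bar> powr (2 * a + 1)) * ennreal (overlap_const b * \<bar>u - v\<bar> powr (2 * b + 1))"
        unfolding P_def Q_def using a b elim by (intro mult_mono pos_powr_overlap) auto
      also have "\<dots> = ennreal ((overlap_const a * overlap_const b) * (\<bar>u - v\<bar> powr (2 * a + 1) * \<bar>u - v\<bar> powr (2 * b + 1)))"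
        using a b by (subst ennreal_mult[symmetric]) (auto simp: overlap_const_nonneg mult_ac)
      also have "\<bar>u - v\<bar> powr (2 * a + 1) * \<bar>u - v\<bar> powr (2 * b + 1) = \<bar>v - u\<bar> powr c"
        by (simp add: powr_add[symmetric] c_def abs_minus_commute algebra_simps)
      also have "ennreal ((overlap_const a * overlap_const b) * \<bar>v - u\<bar> powr c) = ennreal (overlap_const a * overlap_const b) * ennreal (\<bar>v - u\<bar> powr c)"
        using a b by (intro ennreal_mult) (auto simp: overlap_const_nonneg)
      finally have "I u * I v * ((\<integral>\<^sup>+x. P u v x \<partial>lborel) * (\<integral>\<^sup>+y. Q u v y \<partial>lborel))
        \<le> I u * I v * (ennreal (overlap_const a * overlap_const b) * ennreal (\<bar>v - u\<bar> powr c))"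
        by (intro mult_left_mono) auto
      then show ?case by (simp only: mult_ac)
    qed
  qed
  also have "\<dots> = (\<integral>\<^sup>+u. I u * ennreal (overlap_const a * overlap_const b) * (\<integral>\<^sup>+v. I v * ennreal (\<bar>v - u\<bar> powr c) \<partial>lborel) \<partial>lborel)"
    by (intro nn_integral_cong nn_integral_cmult) measurable
  also have "\<dots> \<le> (\<integral>\<^sup>+u. ennreal (overlap_const a * overlap_const b) * ennreal (2 * (t - s) powr (c + 1) / (c + 1)) * indicator {s..t} u \<partial>lborel)"
  proof (rule nn_integral_mono)
    fix u :: real
    show "I u * ennreal (overlap_const a * overlap_const b) * (\<integral>\<^sup>+v. I v * ennreal (\<bar>v - u\<bar> powr c) \<partial>lborel)
      \<le> ennreal (overlap_const a * overlap_const b) * ennreal (2 * (t - s) powr (c + 1) / (c + 1)) * indicator {s..t} u"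
    proof (cases "u \<in> {s..t}")
      case True
      have "(\<integral>\<^sup>+v. I v * ennreal (\<bar>v - u\<bar> powr c) \<partial>lborel) \<le> ennreal (2 * (t - s) powr (c + 1) / (c + 1))"
        unfolding I_def by (rule nn_integral_abs_powr_le[OF c True])
      then show ?thesis using True by (simp add: I_def mult_left_mono)
    qed (simp add: I_def)
  qed
  also have "\<dots> = ennreal (overlap_const a * overlap_const b) * ennreal (2 * (t - s) powr (c + 1) / (c + 1)) * ennreal (t - s)"
    using st by (subst nn_integral_cmult_indicator) auto
  also have "\<dots> = ennreal (overlap_const a * overlap_const b * (2 * (t - s) powr (c + 1) / (c + 1)) * (t - s))"
    using a b c st by (subst ennreal_mult[symmetric] | simp add: overlap_const_nonneg)+
  also have "overlap_const a * overlap_const b * (2 * (t - s) powr (c + 1) / (c + 1)) * (t - s)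
      = energy_const a b * (t - s) powr (2 * a + 2 * b + 4)"
  proof -
    have "(c + 1) + 1 = 2 * a + 2 * b + 4" by (simp add: c_def)
    then have e: "(t - s) powr (c + 1) * (t - s) = (t - s) powr (2 * a + 2 * b + 4)"
      using st powr_add[of "t - s" "c + 1" 1] by (simp only: powr_one)
    have "c + 1 = 2 * a + 2 * b + 3" by (simp add: c_def)
    then have "overlap_const a * overlap_const b * (2 * (t - s) powr (c + 1) / (c + 1)) * (t - s)
      = energy_const a b * ((t - s) powr (c + 1) * (t - s))"
      by (simp add: energy_const_def add.commute mult_ac)
    then show ?thesis unfolding e .
  qed
  finally show ?thesis by (simp add: I_def)
qed

section \<open>Bounds for the Rosenblatt kernel\<close>

text \<open>An explicit mean value estimate, obtained from \<open>1 + z \<le> exp z\<close> with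
  \<open>z = y - x\<close> after multiplication by \<open>exp x\<close>.\<close>

lemma exp_diff_le: "\<bar>exp x - exp y\<bar> \<le> \<bar>x - y\<bar> * exp (max x y)" for x y :: real
proof -
  have *: "exp x - exp y \<le> (x - y) * exp x" for x y :: real
  proof -
    have "exp x * (1 + (y - x)) \<le> exp x * exp (y - x)"
      by (intro mult_left_mono exp_ge_add_one_self) simp
    also have "exp x * exp (y - x) = exp y" by (simp add: exp_add[symmetric])
    finally show ?thesis by (simp add: algebra_simps)
  qed
  show ?thesis using *[of x y] *[of y x] by (cases "y \<le> x") (auto simp: max_def abs_if)
qed

section \<open>Envelopes uniform in the exponents\<close>

definition powr_envelope :: "real \<Rightarrow> real \<Rightarrow> real \<Rightarrow> real" where
  "powr_envelope l u w = pos_powr w l + pos_powr w u"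

lemma powr_envelope_nonneg: "0 \<le> powr_envelope l u w"
  by (simp add: powr_envelope_def pos_powr_nonneg)

lemma powr_envelope_measurable[measurable (raw)]:
  assumes [measurable]: "f \<in> borel_measurable N"
  shows "(\<lambda>x. powr_envelope l u (f x)) \<in> borel_measurable N"
  unfolding powr_envelope_def by measurable

text \<open>For \<open>0 < w < 1\<close> the power with the smaller exponent \<open>l\<close>
  dominates, for \<open>w \<ge> 1\<close> the one with the larger exponent \<open>u\<close>.\<close>

lemma pos_powr_le_envelope:
  assumes "l \<le> a" "a \<le> u"
  shows "pos_powr w a \<le> powr_envelope l u w"
proof (cases "0 < w")
  case True
  show ?thesis
  proof (cases "1 \<le> w")
    case True
    then have "w powr a \<le> w powr u" using assms by (intro powr_mono) auto
    then show ?thesis using \<open>0 < w\<close> by (simp add: powr_envelope_def pos_powr_def add_increasing)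
  next
    case False
    then have "w powr a \<le> w powr l" using assms \<open>0 < w\<close> by (intro powr_mono') auto
    then show ?thesis using \<open>0 < w\<close> by (simp add: powr_envelope_def pos_powr_def add_increasing2)
  qed
qed (simp add: pos_powr_def powr_envelope_def)

text \<open>The logarithm from the mean value theorem is at most \<open>w\<^sup>e / e\<close> or \<open>w\<^sup>-\<^sup>e / e\<close>, which the margin \<open>e\<close> absorbs.\<close>

lemma pos_powr_diff_le_envelope:
  assumes e: "0 < e" and a: "l + e \<le> a" "a \<le> u - e" and b: "l + e \<le> b" "b \<le> u - e"
  shows "\<bar>pos_powr w a - pos_powr w b\<bar> \<le> \<bar>a - b\<bar> / e * powr_envelope l u w"
proof (cases "0 < w")
  case True
  have "\<bar>w powr a - w powr b\<bar> = \<bar>exp (a * ln w) - exp (b * ln w)\<bar>"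
    using True by (simp add: powr_def)
  also have "\<dots> \<le> \<bar>a * ln w - b * ln w\<bar> * exp (max (a * ln w) (b * ln w))"
    by (rule exp_diff_le)
  also have "\<dots> = \<bar>a - b\<bar> * (\<bar>ln w\<bar> * exp (max (a * ln w) (b * ln w)))"
    by (simp add: abs_mult left_diff_distrib[symmetric])
  also have "\<dots> \<le> \<bar>a - b\<bar> * (powr_envelope l u w / e)"
  proof (rule mult_left_mono)
    show "\<bar>ln w\<bar> * exp (max (a * ln w) (b * ln w)) \<le> powr_envelope l u w / e"
    proof (cases "1 \<le> w")
      case w: True
      have ln: "\<bar>ln w\<bar> \<le> w powr e / e" using w e ln_powr_bound[of w e] by simp
      have "max (a * ln w) (b * ln w) \<le> (u - e) * ln w"
        using w a b by (auto intro!: mult_right_mono)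
      then have "exp (max (a * ln w) (b * ln w)) \<le> w powr (u - e)"
        using True by (simp add: powr_def)
      then have "\<bar>ln w\<bar> * exp (max (a * ln w) (b * ln w)) \<le> w powr e / e * w powr (u - e)"
        using ln e by (intro mult_mono) auto
      also have "\<dots> = w powr u / e" using powr_add[of w e "u - e"] by simp
      also have "\<dots> \<le> powr_envelope l u w / e"
        using True e by (intro divide_right_mono) (auto simp: powr_envelope_def pos_powr_def)
      finally show ?thesis .
    next
      case w: False
      have "ln (1 / w) \<le> (1 / w) powr e / e" using w True e by (intro ln_powr_bound) auto
      then have ln: "\<bar>ln w\<bar> \<le> w powr (- e) / e"
        using w True by (simp add: ln_div powr_divide powr_minus_divide)
      have "max (a * ln w) (b * ln w) \<le> (l + e) * ln w"
        using w True a b by (auto intro!: mult_right_mono_neg)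
      then have "exp (max (a * ln w) (b * ln w)) \<le> w powr (l + e)"
        using True by (simp add: powr_def)
      then have "\<bar>ln w\<bar> * exp (max (a * ln w) (b * ln w)) \<le> w powr (- e) / e * w powr (l + e)"
        using ln e by (intro mult_mono) auto
      also have "\<dots> = w powr l / e" using powr_add[of w "- e" "l + e"] by simp
      also have "\<dots> \<le> powr_envelope l u w / e"
        using True e by (intro divide_right_mono) (auto simp: powr_envelope_def pos_powr_def)
      finally show ?thesis .
    qed
  qed simp
  finally show ?thesis using True by (simp add: pos_powr_def)
qed (simp add: pos_powr_def powr_envelope_def)

lemma ennreal_square_sum_le: "(a + b)\<^sup>2 \<le> 2 * (a\<^sup>2 + b\<^sup>2)" for a b :: ennreal
proof (cases a; cases b)
  fix x y assume xy: "a = ennreal x" "0 \<le> x" "b = ennreal y" "0 \<le> y"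
  have "(a + b)\<^sup>2 = ennreal ((x + y)\<^sup>2)" using xy by (simp add: ennreal_power ennreal_plus[symmetric] del: ennreal_plus)
  also have "\<dots> \<le> 2 * (ennreal (x\<^sup>2) + ennreal (y\<^sup>2))" by (rule ennreal_square_add_le)
  also have "\<dots> = 2 * (a\<^sup>2 + b\<^sup>2)" using xy by (simp add: ennreal_power)
  finally show ?thesis .
qed (simp_all add: power2_eq_square ennreal_mult_top ennreal_top_mult)

text \<open>The constant may depend on \<open>T\<close>, so kernels with different energy exponents
  fit one common \<open>q\<close>. The class is closed under sums, which lets an envelope be treated
  as a sum of power kernels.\<close>

definition energy_bounded :: "real \<Rightarrow> real \<Rightarrow> (real \<Rightarrow> real \<times> real \<Rightarrow> real) \<Rightarrow> bool" where
  "energy_bounded T q F \<longleftrightarrow>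
     (\<lambda>p. F (snd p) (fst p)) \<in> borel_measurable (borel \<Otimes>\<^sub>M borel) \<and> (\<forall>u z. 0 \<le> F u z) \<and>
     (\<exists>C\<ge>0. \<forall>s t. 0 \<le> s \<longrightarrow> s \<le> t \<longrightarrow> t \<le> T \<longrightarrow>
       (\<integral>\<^sup>+z. (nn_ivl s t (\<lambda>u. F u z))\<^sup>2 \<partial>lborel) \<le> ennreal (C * (t - s) powr q))"

lemma energy_bounded_measurable:
  assumes "energy_bounded T q F"
  shows "(\<lambda>u. ennreal (F u z)) \<in> borel_measurable borel"
    and "(\<lambda>z. \<integral>\<^sup>+u. indicator {s..t} u * ennreal (F u z) \<partial>lborel) \<in> borel_measurable borel"
    and "(\<lambda>u. F u z) \<in> borel_measurable borel"
proof -
  have [measurable]: "(\<lambda>p. F (snd p) (fst p)) \<in> borel_measurable (borel \<Otimes>\<^sub>M borel)"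
    using assms by (simp add: energy_bounded_def)
  have "(\<lambda>u. (\<lambda>p. F (snd p) (fst p)) (z, u)) \<in> borel_measurable borel" by measurable
  then show *: "(\<lambda>u. F u z) \<in> borel_measurable borel" by simp
  then show "(\<lambda>u. ennreal (F u z)) \<in> borel_measurable borel" by measurable
  have "(\<lambda>z. \<integral>\<^sup>+u. indicator {s..t} u * ennreal ((\<lambda>p. F (snd p) (fst p)) (z, u)) \<partial>lborel) \<in> borel_measurable borel"
    by measurable
  then show "(\<lambda>z. \<integral>\<^sup>+u. indicator {s..t} u * ennreal (F u z) \<partial>lborel) \<in> borel_measurable borel" by simp
qed

lemma energy_bounded_add:
  assumes F: "energy_bounded T q F" and G: "energy_bounded T q G"
  shows "energy_bounded T q (\<lambda>u z. F u z + G u z)"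
proof -
  note [measurable] = energy_bounded_measurable[OF F] energy_bounded_measurable[OF G]
  have nn: "0 \<le> F u z" "0 \<le> G u z" for u z
    using F G unfolding energy_bounded_def by blast+
  obtain A where A: "0 \<le> A" "\<And>s t. 0 \<le> s \<Longrightarrow> s \<le> t \<Longrightarrow> t \<le> T \<Longrightarrow>
       (\<integral>\<^sup>+z. (nn_ivl s t (\<lambda>u. F u z))\<^sup>2 \<partial>lborel) \<le> ennreal (A * (t - s) powr q)"
    using F unfolding energy_bounded_def by blast
  obtain B where B: "0 \<le> B" "\<And>s t. 0 \<le> s \<Longrightarrow> s \<le> t \<Longrightarrow> t \<le> T \<Longrightarrow>
       (\<integral>\<^sup>+z. (nn_ivl s t (\<lambda>u. G u z))\<^sup>2 \<partial>lborel) \<le> ennreal (B * (t - s) powr q)"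
    using G unfolding energy_bounded_def by blast
  have "(\<integral>\<^sup>+z. (nn_ivl s t (\<lambda>u. F u z + G u z))\<^sup>2 \<partial>lborel) \<le> ennreal (2 * (A + B) * (t - s) powr q)"
    if st: "0 \<le> s" "s \<le> t" "t \<le> T" for s t
  proof -
    have "(nn_ivl s t (\<lambda>u. F u z + G u z))
      = (nn_ivl s t (\<lambda>u. F u z)) + (nn_ivl s t (\<lambda>u. G u z))" for z
    proof -
      have "(nn_ivl s t (\<lambda>u. F u z + G u z))
        = (\<integral>\<^sup>+u. indicator {s..t} u * ennreal (F u z) + indicator {s..t} u * ennreal (G u z) \<partial>lborel)"
        using nn by (intro nn_integral_cong) (simp add: ennreal_plus distrib_left)
      then show ?thesis by (simp add: nn_integral_add)
    qed
    then have "(\<integral>\<^sup>+z. (nn_ivl s t (\<lambda>u. F u z + G u z))\<^sup>2 \<partial>lborel)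
      \<le> (\<integral>\<^sup>+z. 2 * ((nn_ivl s t (\<lambda>u. F u z))\<^sup>2 + (nn_ivl s t (\<lambda>u. G u z))\<^sup>2) \<partial>lborel)"
      by (simp only:) (intro nn_integral_mono ennreal_square_sum_le)
    also have "\<dots> = 2 * ((\<integral>\<^sup>+z. (nn_ivl s t (\<lambda>u. F u z))\<^sup>2 \<partial>lborel) + (\<integral>\<^sup>+z. (nn_ivl s t (\<lambda>u. G u z))\<^sup>2 \<partial>lborel))"
      by (subst nn_integral_cmult, measurable, subst nn_integral_add) measurable
    also have "\<dots> \<le> 2 * (ennreal (A * (t - s) powr q) + ennreal (B * (t - s) powr q))"
      by (intro mult_left_mono add_mono A B st) auto
    also have "\<dots> = ennreal 2 * ennreal (A * (t - s) powr q + B * (t - s) powr q)"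
      using A B by (subst ennreal_plus) auto
    also have "\<dots> = ennreal (2 * (A + B) * (t - s) powr q)"
      using A B by (subst ennreal_mult[symmetric]) (auto simp: algebra_simps)
    finally show ?thesis .
  qed
  moreover have "(\<lambda>p. F (snd p) (fst p) + G (snd p) (fst p)) \<in> borel_measurable (borel \<Otimes>\<^sub>M borel)"
    using F G by (auto simp: energy_bounded_def)
  moreover have "0 \<le> F u z + G u z" for u z using nn by (simp add: add_nonneg_nonneg)
  moreover have "0 \<le> 2 * (A + B)" using A B by simp
  ultimately show ?thesis unfolding energy_bounded_def by blast
qed

lemma energy_const_nonneg:
  assumes "-3/4 < a" "a < -1/2" "-3/4 < b" "b < -1/2"
  shows "0 \<le> energy_const a b"
  unfolding energy_const_def using assms by (intro mult_nonneg_nonneg overlap_const_nonneg) auto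

text \<open>An exponent larger than \<open>q\<close> is lowered to \<open>q\<close> at the price of
  a power of \<open>T\<close>, since \<open>t - s \<le> T\<close>.\<close>

lemma energy_bounded_power_kernel:
  assumes a: "-3/4 < a" "a < -1/2" and b: "-3/4 < b" "b < -1/2" and q: "q \<le> 2 * a + 2 * b + 4"
  shows "energy_bounded T q (power_kernel a b)"
proof -
  have "(\<integral>\<^sup>+z. (nn_ivl s t (\<lambda>u. power_kernel a b u z))\<^sup>2 \<partial>lborel)
    \<le> ennreal (energy_const a b * T powr (2 * a + 2 * b + 4 - q) * (t - s) powr q)"
    if st: "0 \<le> s" "s \<le> t" "t \<le> T" for s t
  proof -
    have "(t - s) powr (2 * a + 2 * b + 4) = (t - s) powr (2 * a + 2 * b + 4 - q) * (t - s) powr q"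
      by (simp add: powr_add[symmetric])
    also have "\<dots> \<le> T powr (2 * a + 2 * b + 4 - q) * (t - s) powr q"
      using st q by (intro mult_right_mono powr_mono2) auto
    finally have "energy_const a b * (t - s) powr (2 * a + 2 * b + 4) \<le> energy_const a b * (T powr (2 * a + 2 * b + 4 - q) * (t - s) powr q)"
      by (intro mult_left_mono energy_const_nonneg a b)
    then show ?thesis
      using power_kernel_energy[OF a b st(2)] by (elim order_trans) (simp add: ennreal_leI mult.assoc)
  qed
  moreover have "0 \<le> energy_const a b * T powr (2 * a + 2 * b + 4 - q)"
    by (intro mult_nonneg_nonneg energy_const_nonneg a b) simp
  moreover have "(\<lambda>p. power_kernel a b (snd p) (fst p)) \<in> borel_measurable (borel \<Otimes>\<^sub>M borel)"
  proof -
    have "(\<lambda>p :: (real \<times> real) \<times> real. fst (fst p)) \<in> borel_measurable borel"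
      "(\<lambda>p :: (real \<times> real) \<times> real. snd (fst p)) \<in> borel_measurable borel"
      by (intro borel_measurable_continuous_onI continuous_intros)+
    then have [measurable]: "(\<lambda>p :: (real \<times> real) \<times> real. fst (fst p)) \<in> borel_measurable (borel \<Otimes>\<^sub>M borel)"
      "(\<lambda>p :: (real \<times> real) \<times> real. snd (fst p)) \<in> borel_measurable (borel \<Otimes>\<^sub>M borel)"
      by (simp_all only: borel_prod)
    show ?thesis unfolding power_kernel_def by measurable
  qed
  ultimately show ?thesis unfolding energy_bounded_def using power_kernel_nonneg by blast
qed

section \<open>Domination of the Rosenblatt kernel and of its parameter differences\<close>

definition kernel_envelope :: "real \<Rightarrow> real \<Rightarrow> real \<Rightarrow> real \<Rightarrow> real \<Rightarrow> real \<times> real \<Rightarrow> real" where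
  "kernel_envelope l1 u1 l2 u2 s z =
     powr_envelope l1 u1 (s - fst z) * powr_envelope l2 u2 (s - snd z) +
     powr_envelope l2 u2 (s - fst z) * powr_envelope l1 u1 (s - snd z)"

lemma kernel_envelope_nonneg: "0 \<le> kernel_envelope l1 u1 l2 u2 s z"
  by (simp add: kernel_envelope_def powr_envelope_nonneg)

text \<open>Expanding the envelope gives eight power kernels, each with one exponent of the first
  index and one of the second, so the worst energy exponent is \<open>2 * l1 + 2 * l2 + 4\<close>.
  Keeping the indices apart is what leads to the mean of the two smallest indices and not to the
  smaller of them.\<close>

lemma energy_bounded_kernel_envelope:
  assumes "-3/4 < l1" "l1 \<le> u1" "u1 < -1/2" "-3/4 < l2" "l2 \<le> u2" "u2 < -1/2"
  shows "energy_bounded T (2 * l1 + 2 * l2 + 4) (kernel_envelope l1 u1 l2 u2)"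
proof -
  have eq: "kernel_envelope l1 u1 l2 u2 = (\<lambda>s z.
      ((power_kernel l1 l2 s z + power_kernel l1 u2 s z) + (power_kernel u1 l2 s z + power_kernel u1 u2 s z)) +
      ((power_kernel l2 l1 s z + power_kernel l2 u1 s z) + (power_kernel u2 l1 s z + power_kernel u2 u1 s z)))"
    by (simp add: fun_eq_iff kernel_envelope_def powr_envelope_def power_kernel_def algebra_simps)
  show ?thesis unfolding eq
    by (intro energy_bounded_add energy_bounded_power_kernel) (use assms in auto)
qed

lemma rosenblatt_K_nonneg: "0 \<le> rosenblatt_K h1 h2 s x y"
  by (simp add: rosenblatt_K_def pos_powr_nonneg)

lemma rosenblatt_K_le:
  assumes "h1 / 2 - 1 \<in> {l1..u1}" "h2 / 2 - 1 \<in> {l2..u2}"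
  shows "rosenblatt_K h1 h2 s x y \<le> kernel_envelope l1 u1 l2 u2 s (x, y)"
  unfolding rosenblatt_K_def kernel_envelope_def using assms
  by (intro add_mono mult_mono) (auto intro: pos_powr_le_envelope pos_powr_nonneg powr_envelope_nonneg)

lemma product_diff_le:
  fixes a b a' b' c d g h :: real
  assumes "\<bar>a - a'\<bar> \<le> c * g" "\<bar>b - b'\<bar> \<le> d * h" "0 \<le> b" "b \<le> h" "0 \<le> a'" "a' \<le> g"
  shows "\<bar>a * b - a' * b'\<bar> \<le> (c + d) * (g * h)"
proof -
  have "a * b - a' * b' = (a - a') * b + a' * (b - b')" by (simp add: algebra_simps)
  then have "\<bar>a * b - a' * b'\<bar> \<le> \<bar>a - a'\<bar> * \<bar>b\<bar> + \<bar>a'\<bar> * \<bar>b - b'\<bar>"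
    by (metis abs_mult abs_triangle_ineq)
  also have "\<dots> \<le> (c * g) * h + g * (d * h)"
    using assms by (intro add_mono mult_mono) auto
  finally show ?thesis by (simp add: algebra_simps)
qed

text \<open>In each product one factor is changed at a time. The parameters enter the exponents as
  \<open>h / 2 - 1\<close>, so a change of \<open>h\<close> is halved, which gives
  \<open>2 * e\<close> in the denominator.\<close>

lemma rosenblatt_K_diff_le:
  assumes e: "0 < e" and h: "h1 / 2 - 1 \<in> {l1 + e..u1 - e}" "h2 / 2 - 1 \<in> {l2 + e..u2 - e}"
    and k: "k1 / 2 - 1 \<in> {l1 + e..u1 - e}" "k2 / 2 - 1 \<in> {l2 + e..u2 - e}"
  shows "\<bar>rosenblatt_K h1 h2 s x y - rosenblatt_K k1 k2 s x y\<bar>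
    \<le> (\<bar>h1 - k1\<bar> + \<bar>h2 - k2\<bar>) / (2 * e) * kernel_envelope l1 u1 l2 u2 s (x, y)"
proof -
  define c where "c = \<bar>(h1 / 2 - 1) - (k1 / 2 - 1)\<bar> / e"
  define d where "d = \<bar>(h2 / 2 - 1) - (k2 / 2 - 1)\<bar> / e"
  let ?p = pos_powr and ?h1 = "h1 / 2 - 1" and ?h2 = "h2 / 2 - 1" and ?k1 = "k1 / 2 - 1" and ?k2 = "k2 / 2 - 1"
  let ?g1 = "powr_envelope l1 u1" and ?g2 = "powr_envelope l2 u2"
  have d1: "\<bar>?p w ?h1 - ?p w ?k1\<bar> \<le> c * ?g1 w" for w
    unfolding c_def using e h k by (intro pos_powr_diff_le_envelope) auto
  have d2: "\<bar>?p w ?h2 - ?p w ?k2\<bar> \<le> d * ?g2 w" for w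
    unfolding d_def using e h k by (intro pos_powr_diff_le_envelope) auto
  have b1: "?p w ?h1 \<le> ?g1 w" "?p w ?k1 \<le> ?g1 w" for w
    using e h k by (auto intro!: pos_powr_le_envelope)
  have b2: "?p w ?h2 \<le> ?g2 w" "?p w ?k2 \<le> ?g2 w" for w
    using e h k by (auto intro!: pos_powr_le_envelope)
  have "\<bar>?p (s - x) ?h1 * ?p (s - y) ?h2 - ?p (s - x) ?k1 * ?p (s - y) ?k2\<bar>
      \<le> (c + d) * (?g1 (s - x) * ?g2 (s - y))"
    by (intro product_diff_le d1 d2 b1 b2 pos_powr_nonneg)
  moreover have "\<bar>?p (s - x) ?h2 * ?p (s - y) ?h1 - ?p (s - x) ?k2 * ?p (s - y) ?k1\<bar>
      \<le> (d + c) * (?g2 (s - x) * ?g1 (s - y))"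
    by (intro product_diff_le d1 d2 b1 b2 pos_powr_nonneg)
  ultimately have "\<bar>rosenblatt_K h1 h2 s x y - rosenblatt_K k1 k2 s x y\<bar>
      \<le> (c + d) * kernel_envelope l1 u1 l2 u2 s (x, y)"
    unfolding rosenblatt_K_def kernel_envelope_def by (simp add: distrib_left add.commute)
  moreover have "c + d = (\<bar>h1 - k1\<bar> + \<bar>h2 - k2\<bar>) / (2 * e)"
    unfolding c_def d_def using e by (simp add: diff_divide_distrib[symmetric] add_divide_distrib)
  ultimately show ?thesis by simp
qed

section \<open>Measurability, sign and symmetry of the integrated kernel\<close>

lemma rosenblatt_K_measurable:
  "(\<lambda>(z, s). rosenblatt_K h1 h2 s (fst z) (snd z)) \<in> borel_measurable ((borel :: (real \<times> real) measure) \<Otimes>\<^sub>M borel)"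
proof -
  have "(\<lambda>p :: (real \<times> real) \<times> real. fst (fst p)) \<in> borel_measurable borel"
    "(\<lambda>p :: (real \<times> real) \<times> real. snd (fst p)) \<in> borel_measurable borel"
    by (intro borel_measurable_continuous_onI continuous_intros)+
  then have [measurable]: "(\<lambda>p :: (real \<times> real) \<times> real. fst (fst p)) \<in> borel_measurable (borel \<Otimes>\<^sub>M borel)"
    "(\<lambda>p :: (real \<times> real) \<times> real. snd (fst p)) \<in> borel_measurable (borel \<Otimes>\<^sub>M borel)"
    by (simp_all only: borel_prod)
  show ?thesis unfolding rosenblatt_K_def case_prod_beta by measurable
qed

lemma rosenblatt_kernel_eq:
  "rosenblatt_kernel h1 h2 t z = (\<integral>s. indicator {0..t} s * rosenblatt_K h1 h2 s (fst z) (snd z) \<partial>lborel)"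
  by (simp add: rosenblatt_kernel_def set_lebesgue_integral_def case_prod_beta)

lemma rosenblatt_kernel_measurable: "rosenblatt_kernel h1 h2 t \<in> borel_measurable borel"
proof -
  note [measurable] = rosenblatt_K_measurable[of h1 h2]
  have "(\<lambda>(z, s). indicator {0..t} s * (\<lambda>(z, s). rosenblatt_K h1 h2 s (fst z) (snd z)) (z, s))
      \<in> borel_measurable ((borel :: (real \<times> real) measure) \<Otimes>\<^sub>M lborel)"
    unfolding case_prod_beta by measurable
  from lborel.borel_measurable_lebesgue_integral[OF this]
  have "(\<lambda>z. \<integral>s. indicator {0..t} s * rosenblatt_K h1 h2 s (fst z) (snd z) \<partial>lborel) \<in> borel_measurable borel"
    by simp
  then show ?thesis by (simp add: rosenblatt_kernel_eq[abs_def])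
qed

lemma rosenblatt_kernel_nonneg: "0 \<le> rosenblatt_kernel h1 h2 t z"
  unfolding rosenblatt_kernel_eq by (intro Bochner_Integration.integral_nonneg) (simp add: rosenblatt_K_nonneg)

lemma rosenblatt_kernel_sym: "rosenblatt_kernel h1 h2 t (x, y) = rosenblatt_kernel h1 h2 t (y, x)"
  unfolding rosenblatt_kernel_eq rosenblatt_K_def by (simp add: mult.commute add.commute)

text \<open>The interval \<open>{0..0}\<close> is a null set. With a vanishing kernel at time 0, the
  increment bound for \<open>s = 0\<close> also bounds the norm of the kernel at time
  \<open>t\<close>.\<close>

lemma rosenblatt_kernel_0: "rosenblatt_kernel h1 h2 0 z = 0"
proof -
  have "(\<integral>s. indicator {0..0} s * rosenblatt_K h1 h2 s (fst z) (snd z) \<partial>lborel) = (\<integral>s. 0 \<partial>(lborel :: real measure))"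
  proof (rule integral_cong_AE)
    have [measurable]: "(\<lambda>s. rosenblatt_K h1 h2 s (fst z) (snd z)) \<in> borel_measurable borel"
      unfolding rosenblatt_K_def by measurable
    show "(\<lambda>s. indicator {0..0} s * rosenblatt_K h1 h2 s (fst z) (snd z)) \<in> borel_measurable lborel"
      by measurable
    show "AE s in lborel. indicator {0..0} s * rosenblatt_K h1 h2 s (fst z) (snd z) = 0"
      using AE_lborel_singleton[of "0 :: real"] by eventually_elim simp
  qed simp
  then show ?thesis by (simp add: rosenblatt_kernel_eq)
qed

section \<open>Increments of the multifractional process\<close>

text \<open>It takes extended values because the time integral may diverge, as on parts of the
  diagonal for exponents below \<open>-1/2\<close>. Finiteness at a point certifies that the Bochner
  integrals there are genuine and not the default 0.\<close>

definition envelope_integral :: "real \<Rightarrow> real \<Rightarrow> real \<Rightarrow> real \<Rightarrow> real \<Rightarrow> real \<Rightarrow> real \<times> real \<Rightarrow> ennreal" where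
  "envelope_integral l1 u1 l2 u2 s t z = (nn_ivl s t (\<lambda>u. kernel_envelope l1 u1 l2 u2 u z))"

lemma kernel_envelope_measurable: "(\<lambda>u. kernel_envelope l1 u1 l2 u2 u z) \<in> borel_measurable borel"
  unfolding kernel_envelope_def by measurable

lemma integrable_rosenblatt_K:
  assumes h: "h1 / 2 - 1 \<in> {l1..u1}" "h2 / 2 - 1 \<in> {l2..u2}" and t: "t \<le> T"
    and fin: "envelope_integral l1 u1 l2 u2 0 T z < top"
  shows "integrable lborel (\<lambda>u. indicator {0..t} u * rosenblatt_K h1 h2 u (fst z) (snd z))"
proof (rule integrableI_bounded)
  have [measurable]: "(\<lambda>u. rosenblatt_K h1 h2 u (fst z) (snd z)) \<in> borel_measurable borel"
    unfolding rosenblatt_K_def by measurable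
  show "(\<lambda>u. indicator {0..t} u * rosenblatt_K h1 h2 u (fst z) (snd z)) \<in> borel_measurable lborel"
    by measurable
  have "(\<integral>\<^sup>+u. ennreal (norm (indicator {0..t} u * rosenblatt_K h1 h2 u (fst z) (snd z))) \<partial>lborel)
    \<le> envelope_integral l1 u1 l2 u2 0 T z"
    unfolding envelope_integral_def
  proof (rule nn_integral_mono)
    fix u
    have "rosenblatt_K h1 h2 u (fst z) (snd z) \<le> kernel_envelope l1 u1 l2 u2 u z"
      using rosenblatt_K_le[OF h, of u "fst z" "snd z"] by simp
    then show "ennreal (norm (indicator {0..t} u * rosenblatt_K h1 h2 u (fst z) (snd z)))
      \<le> indicator {0..T} u * ennreal (kernel_envelope l1 u1 l2 u2 u z)"
      using t by (cases "u \<in> {0..t}") (simp_all add: rosenblatt_K_nonneg ennreal_leI)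
  qed
  then show "(\<integral>\<^sup>+u. ennreal (norm (indicator {0..t} u * rosenblatt_K h1 h2 u (fst z) (snd z))) \<partial>lborel) < \<infinity>"
    using fin by (simp add: order_le_less_trans)
qed

text \<open>The time integral is split at \<open>s\<close>. After \<open>s\<close> only the first
  kernel is present and the envelope bounds it; before \<open>s\<close> both are present and differ
  only through their parameters. The premise \<open>fin\<close> makes both integrals converge, so
  their difference is the integral of the difference.\<close>

lemma rosenblatt_kernel_increment_le:
  assumes e: "0 < e" and h: "h1 / 2 - 1 \<in> {l1 + e..u1 - e}" "h2 / 2 - 1 \<in> {l2 + e..u2 - e}"
    and k: "k1 / 2 - 1 \<in> {l1 + e..u1 - e}" "k2 / 2 - 1 \<in> {l2 + e..u2 - e}"
    and st: "0 \<le> s" "s \<le> t" "t \<le> T"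
    and c: "(\<bar>h1 - k1\<bar> + \<bar>h2 - k2\<bar>) / (2 * e) \<le> c" "0 \<le> c"
    and fin: "envelope_integral l1 u1 l2 u2 0 T z < top"
  shows "ennreal \<bar>rosenblatt_kernel h1 h2 t z - rosenblatt_kernel k1 k2 s z\<bar>
    \<le> envelope_integral l1 u1 l2 u2 s t z + ennreal c * envelope_integral l1 u1 l2 u2 0 T z"
proof -
  let ?H = "\<lambda>u. indicator {0..t} u * rosenblatt_K h1 h2 u (fst z) (snd z)"
  let ?K = "\<lambda>u. indicator {0..s} u * rosenblatt_K k1 k2 u (fst z) (snd z)"
  let ?G = "\<lambda>u. kernel_envelope l1 u1 l2 u2 u z"
  note [measurable] = kernel_envelope_measurable
  have h': "h1 / 2 - 1 \<in> {l1..u1}" "h2 / 2 - 1 \<in> {l2..u2}" and k': "k1 / 2 - 1 \<in> {l1..u1}" "k2 / 2 - 1 \<in> {l2..u2}"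
    using e h k by auto
  have iH: "integrable lborel ?H" by (rule integrable_rosenblatt_K[OF h' st(3) fin])
  have iK: "integrable lborel ?K" by (rule integrable_rosenblatt_K[OF k' _ fin]) (use st in simp)
  have "rosenblatt_kernel h1 h2 t z - rosenblatt_kernel k1 k2 s z = (\<integral>u. ?H u - ?K u \<partial>lborel)"
    unfolding rosenblatt_kernel_eq using iH iK by simp
  then have "ennreal \<bar>rosenblatt_kernel h1 h2 t z - rosenblatt_kernel k1 k2 s z\<bar>
      \<le> (\<integral>\<^sup>+u. ennreal (norm (?H u - ?K u)) \<partial>lborel)"
    using integral_norm_bound_ennreal[OF Bochner_Integration.integrable_diff[OF iH iK]] by simp
  also have "\<dots> \<le> (\<integral>\<^sup>+u. indicator {s..t} u * ennreal (?G u) + ennreal c * (indicator {0..T} u * ennreal (?G u)) \<partial>lborel)"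
  proof (rule nn_integral_mono)
    fix u :: real
    have G: "0 \<le> ?G u" by (rule kernel_envelope_nonneg)
    consider "u \<notin> {0..t}" | "u \<in> {0..s}" | "u \<in> {0..t}" "u \<notin> {0..s}" by blast
    then show "ennreal (norm (?H u - ?K u)) \<le> indicator {s..t} u * ennreal (?G u) + ennreal c * (indicator {0..T} u * ennreal (?G u))"
    proof cases
      case 1
      then have "u \<notin> {0..s}" using st by auto
      with 1 show ?thesis by simp
    next
      case 2
      then have u: "u \<in> {0..t}" "u \<in> {0..T}" using st by auto
      have "norm (?H u - ?K u) \<le> (\<bar>h1 - k1\<bar> + \<bar>h2 - k2\<bar>) / (2 * e) * ?G u"
        using rosenblatt_K_diff_le[OF e h k, of u "fst z" "snd z"] 2 u by simp
      also have "\<dots> \<le> c * ?G u" using c G by (intro mult_right_mono)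
      finally have "ennreal (norm (?H u - ?K u)) \<le> ennreal (c * ?G u)" by (rule ennreal_leI)
      also have "\<dots> = ennreal c * (indicator {0..T} u * ennreal (?G u))"
        using u c G by (simp add: ennreal_mult)
      finally show ?thesis by (simp add: add_increasing)
    next
      case 3
      then have u: "u \<in> {s..t}" using st by auto
      have "norm (?H u - ?K u) \<le> ?G u"
        using rosenblatt_K_le[OF h', of u "fst z" "snd z"] 3 by (simp add: rosenblatt_K_nonneg)
      then have "ennreal (norm (?H u - ?K u)) \<le> indicator {s..t} u * ennreal (?G u)"
        using u by (simp add: ennreal_leI)
      then show ?thesis by (simp add: add_increasing2)
    qed
  qed
  also have "\<dots> = envelope_integral l1 u1 l2 u2 s t z + ennreal c * envelope_integral l1 u1 l2 u2 0 T z"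
    unfolding envelope_integral_def
    by (subst nn_integral_add, measurable, subst nn_integral_cmult) measurable
  finally show ?thesis .
qed

text \<open>The pointwise increment bound is squared and integrated. New time contributes the
  envelope energy over \<open>[s, t]\<close>; the change of parameters contributes the energy over
  all of \<open>[0, T]\<close> times \<open>c^2\<close>, a factor of order
  \<open>(t - s)^(2 \<gamma>)\<close>.\<close>

lemma rosenblatt_kernel_increment_L2:
  assumes l: "-3/4 < l1" "l1 \<le> u1" "u1 < -1/2" "-3/4 < l2" "l2 \<le> u2" "u2 < -1/2" and e: "0 < e"
    and H: "\<And>t. t \<in> {0..T} \<Longrightarrow> H1 t / 2 - 1 \<in> {l1 + e..u1 - e}" "\<And>t. t \<in> {0..T} \<Longrightarrow> H2 t / 2 - 1 \<in> {l2 + e..u2 - e}"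
    and holder: "\<And>s t. s \<in> {0..T} \<Longrightarrow> t \<in> {0..T} \<Longrightarrow> \<bar>H1 t - H1 s\<bar> \<le> \<bar>t - s\<bar> powr \<gamma>"
      "\<And>s t. s \<in> {0..T} \<Longrightarrow> t \<in> {0..T} \<Longrightarrow> \<bar>H2 t - H2 s\<bar> \<le> \<bar>t - s\<bar> powr \<gamma>"
    and q: "q = 2 * l1 + 2 * l2 + 4" "q \<le> 2 * \<gamma>" and T: "0 < T"
  shows "\<exists>C\<ge>0. \<forall>s\<in>{0..T}. \<forall>t\<in>{0..T}.
    (L2sq lborel (\<lambda>z. rosenblatt_kernel (H1 t) (H2 t) t z - rosenblatt_kernel (H1 s) (H2 s) s z))
      \<le> ennreal (C * \<bar>t - s\<bar> powr q)"
proof -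
  let ?\<Gamma> = "envelope_integral l1 u1 l2 u2"
  have eb: "energy_bounded T q (kernel_envelope l1 u1 l2 u2)"
    unfolding q(1) by (rule energy_bounded_kernel_envelope[OF l])
  then obtain C where C: "0 \<le> C" "\<And>s t. 0 \<le> s \<Longrightarrow> s \<le> t \<Longrightarrow> t \<le> T \<Longrightarrow>
      (\<integral>\<^sup>+z. (?\<Gamma> s t z)\<^sup>2 \<partial>lborel) \<le> ennreal (C * (t - s) powr q)"
    unfolding energy_bounded_def envelope_integral_def by blast
  have [measurable]: "?\<Gamma> s t \<in> borel_measurable borel" for s t
    unfolding envelope_integral_def[abs_def] by (rule energy_bounded_measurable(2)[OF eb])
  have "(\<integral>\<^sup>+z. (?\<Gamma> 0 T z)\<^sup>2 \<partial>lborel) < top"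
    using C(2)[of 0 T] T by (simp add: order_le_less_trans)
  \<comment> \<open>Finite energy over the whole interval makes the envelope integral finite at
    almost every point, which is the premise of the pointwise increment bound.\<close>
  then have "AE z in lborel. (?\<Gamma> 0 T z)\<^sup>2 \<noteq> \<infinity>"
    by (intro nn_integral_PInf_AE) auto
  then have fin: "AE z in lborel. ?\<Gamma> 0 T z < top"
  proof eventually_elim
    case (elim z)
    then have "?\<Gamma> 0 T z \<noteq> top" by (intro notI) (simp add: power2_eq_square ennreal_top_mult)
    then show ?case by (simp only: less_top)
  qed
  \<comment> \<open>The outer 2 is from the squared triangle inequality. The second summand is the
    bound \<open>c2\<close> for the squared parameter change, with \<open>(t - s) powr q\<close>
    taken out, times the energy bound \<open>C * T powr q\<close> over
    \<open>[0, T]\<close>.\<close>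
  define D where "D = 2 * (C + T powr (2 * \<gamma> - q) / e\<^sup>2 * (C * T powr q))"
  have D: "0 \<le> D" using C(1) by (simp add: D_def)
  have le: "(L2sq lborel (\<lambda>z. rosenblatt_kernel (H1 t) (H2 t) t z - rosenblatt_kernel (H1 s) (H2 s) s z))
      \<le> ennreal (D * (t - s) powr q)" if s: "s \<in> {0..T}" and t: "t \<in> {0..T}" and "s \<le> t" for s t
  proof -
    have st: "0 \<le> s" "s \<le> t" "t \<le> T" using that by auto
    define c where "c = (t - s) powr \<gamma> / e"
    have c: "0 \<le> c" using e by (simp add: c_def)
    have hc: "(\<bar>H1 t - H1 s\<bar> + \<bar>H2 t - H2 s\<bar>) / (2 * e) \<le> c"
    proof -
      have "\<bar>H1 t - H1 s\<bar> + \<bar>H2 t - H2 s\<bar> \<le> 2 * (t - s) powr \<gamma>"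
        using holder(1)[OF s t] holder(2)[OF s t] st by simp
      then have "(\<bar>H1 t - H1 s\<bar> + \<bar>H2 t - H2 s\<bar>) / (2 * e) \<le> 2 * (t - s) powr \<gamma> / (2 * e)"
        using e by (intro divide_right_mono) auto
      then show ?thesis by (simp add: c_def)
    qed
    have c2: "c\<^sup>2 \<le> T powr (2 * \<gamma> - q) / e\<^sup>2 * (t - s) powr q"
    proof -
      have "c\<^sup>2 = (t - s) powr (2 * \<gamma>) / e\<^sup>2"
        by (simp add: c_def power_divide power2_eq_square powr_add[symmetric])
      also have "(t - s) powr (2 * \<gamma>) = (t - s) powr (2 * \<gamma> - q) * (t - s) powr q"
        by (simp add: powr_add[symmetric])
      also have "\<dots> \<le> T powr (2 * \<gamma> - q) * (t - s) powr q"
        using st q by (intro mult_right_mono powr_mono2) auto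
      finally show ?thesis by (simp add: divide_right_mono)
    qed
    have "(L2sq lborel (\<lambda>z. rosenblatt_kernel (H1 t) (H2 t) t z - rosenblatt_kernel (H1 s) (H2 s) s z))
      \<le> (\<integral>\<^sup>+z. 2 * ((?\<Gamma> s t z)\<^sup>2 + ennreal (c\<^sup>2) * (?\<Gamma> 0 T z)\<^sup>2) \<partial>lborel)"
    proof (rule nn_integral_mono_AE)
      show "AE z in lborel. ennreal ((rosenblatt_kernel (H1 t) (H2 t) t z - rosenblatt_kernel (H1 s) (H2 s) s z)\<^sup>2)
        \<le> 2 * ((?\<Gamma> s t z)\<^sup>2 + ennreal (c\<^sup>2) * (?\<Gamma> 0 T z)\<^sup>2)"
        using fin
      proof eventually_elim
        case (elim z)
        let ?d = "rosenblatt_kernel (H1 t) (H2 t) t z - rosenblatt_kernel (H1 s) (H2 s) s z"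
        have "ennreal (?d\<^sup>2) = (ennreal \<bar>?d\<bar>)\<^sup>2" by (simp add: ennreal_power)
        also have "\<dots> \<le> (?\<Gamma> s t z + ennreal c * ?\<Gamma> 0 T z)\<^sup>2"
          by (intro power_mono rosenblatt_kernel_increment_le[OF e H(1)[OF t] H(2)[OF t] H(1)[OF s] H(2)[OF s] st hc c elim]) simp
        also have "\<dots> \<le> 2 * ((?\<Gamma> s t z)\<^sup>2 + (ennreal c * ?\<Gamma> 0 T z)\<^sup>2)"
          by (rule ennreal_square_sum_le)
        finally show ?case using c by (simp add: power_mult_distrib ennreal_power)
      qed
    qed
    also have "\<dots> = 2 * ((\<integral>\<^sup>+z. (?\<Gamma> s t z)\<^sup>2 \<partial>lborel) + ennreal (c\<^sup>2) * (\<integral>\<^sup>+z. (?\<Gamma> 0 T z)\<^sup>2 \<partial>lborel))"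
      by (subst nn_integral_cmult, measurable, subst nn_integral_add, measurable, subst nn_integral_cmult) measurable
    also have "\<dots> \<le> 2 * (ennreal (C * (t - s) powr q) + ennreal (c\<^sup>2) * ennreal (C * (T - 0) powr q))"
      using T st by (intro mult_left_mono add_mono C) auto
    also have "\<dots> = ennreal (2 * (C * (t - s) powr q + c\<^sup>2 * (C * T powr q)))"
    proof -
      have "ennreal (c\<^sup>2) * ennreal (C * (T - 0) powr q) = ennreal (c\<^sup>2 * (C * T powr q))"
        using C(1) by (subst ennreal_mult[symmetric]) auto
      moreover have "ennreal (C * (t - s) powr q) + ennreal (c\<^sup>2 * (C * T powr q)) = ennreal (C * (t - s) powr q + c\<^sup>2 * (C * T powr q))"
        using C(1) by (intro ennreal_plus[symmetric]) auto
      moreover have "2 * ennreal x = ennreal (2 * x)" if "0 \<le> x" for x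
        using ennreal_mult[of 2 x] that by simp
      ultimately show ?thesis using C(1) by simp
    qed
    also have "\<dots> \<le> ennreal (D * (t - s) powr q)"
    proof (rule ennreal_leI)
      have le_c: "c\<^sup>2 * (C * T powr q) \<le> T powr (2 * \<gamma> - q) / e\<^sup>2 * (t - s) powr q * (C * T powr q)"
        using C(1) by (intro mult_right_mono c2) auto
      have eq_D: "D * (t - s) powr q = 2 * (C * (t - s) powr q + T powr (2 * \<gamma> - q) / e\<^sup>2 * (t - s) powr q * (C * T powr q))"
        by (simp add: D_def distrib_left distrib_right mult_ac)
      show "2 * (C * (t - s) powr q + c\<^sup>2 * (C * T powr q)) \<le> D * (t - s) powr q"
        unfolding eq_D by (intro mult_left_mono add_left_mono le_c) simp
    qed
    finally show ?thesis .
  qed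
  have "(L2sq lborel (\<lambda>z. rosenblatt_kernel (H1 t) (H2 t) t z - rosenblatt_kernel (H1 s) (H2 s) s z))
      \<le> ennreal (D * \<bar>t - s\<bar> powr q)" if s: "s \<in> {0..T}" and t: "t \<in> {0..T}" for s t
  proof (cases "s \<le> t")
    case True
    then show ?thesis using le[OF s t True] by simp
  next
    case False
    then have ts: "t \<le> s" by simp
    then show ?thesis using le[OF t s ts] by (simp add: power2_commute)
  qed
  then show ?thesis using D by blast
qed

theorem theorem1:
  fixes M :: "'a measure" and W :: "real set \<Rightarrow> 'a \<Rightarrow> real"
    and T :: real and H1 H2 :: "real \<Rightarrow> real" and \<gamma> \<alpha> :: real
  assumes "white_noise M W"
    and "0 < T"
    and "continuous_on {0..T} H1" and "continuous_on {0..T} H2"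
    and "H1 ` {0..T} \<subseteq> {1/2<..<1}" and "H2 ` {0..T} \<subseteq> {1/2<..<1}"
    and "((SUP t\<in>{0..T}. H1 t) + (SUP t\<in>{0..T}. H2 t)) / 2 < \<gamma>"
    and "\<forall>s\<in>{0..T}. \<forall>t\<in>{0..T}. \<bar>H1 t - H1 s\<bar> \<le> \<bar>t - s\<bar> powr \<gamma>"
    and "\<forall>s\<in>{0..T}. \<forall>t\<in>{0..T}. \<bar>H2 t - H2 s\<bar> \<le> \<bar>t - s\<bar> powr \<gamma>"
    and "0 < \<alpha>" and "\<alpha> < ((INF t\<in>{0..T}. H1 t) + (INF t\<in>{0..T}. H2 t)) / 2"
  shows "\<exists>X'. modification_on M {0..T} (multifractional_rosenblatt M W H1 H2) X' \<and>
           (\<forall>\<omega>\<in>space M. holder_continuous_on \<alpha> {0..T} (\<lambda>t. X' t \<omega>))"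
proof -
  interpret white_noise M W by fact
  have ne: "{0..T} \<noteq> {}" using \<open>0 < T\<close> by simp
  \<comment> \<open>By compactness the extrema are attained, so they remain strictly between
    \<open>1/2\<close> and 1. This leaves room for a positive margin.\<close>
  have bounds: "\<exists>m M'. m = (INF t\<in>{0..T}. H t) \<and> M' = (SUP t\<in>{0..T}. H t) \<and> 1/2 < m \<and> M' < 1 \<and> (\<forall>t\<in>{0..T}. m \<le> H t \<and> H t \<le> M')"
    if cont: "continuous_on {0..T} H" and img: "H ` {0..T} \<subseteq> {1/2<..<1}" for H :: "real \<Rightarrow> real"
  proof -
    obtain a where a: "a \<in> {0..T}" "\<And>t. t \<in> {0..T} \<Longrightarrow> H a \<le> H t"
      using continuous_attains_inf[OF compact_Icc ne cont] by blast
    obtain b where b: "b \<in> {0..T}" "\<And>t. t \<in> {0..T} \<Longrightarrow> H t \<le> H b"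
      using continuous_attains_sup[OF compact_Icc ne cont] by blast
    have "(INF t\<in>{0..T}. H t) = H a" using a by (intro cInf_eq_minimum) auto
    moreover have "(SUP t\<in>{0..T}. H t) = H b" using b by (intro cSup_eq_maximum) auto
    moreover have "H a \<in> {1/2<..<1}" "H b \<in> {1/2<..<1}" using img a(1) b(1) by blast+
    then have "1/2 < H a" "H b < 1" by simp_all
    ultimately show ?thesis using a(2) b(2) by simp
  qed
  obtain m1 M1 where 1: "m1 = (INF t\<in>{0..T}. H1 t)" "M1 = (SUP t\<in>{0..T}. H1 t)" "1/2 < m1" "M1 < 1"
    "\<And>t. t \<in> {0..T} \<Longrightarrow> m1 \<le> H1 t" "\<And>t. t \<in> {0..T} \<Longrightarrow> H1 t \<le> M1"
    using bounds[OF assms(3,5)] by blast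
  obtain m2 M2 where 2: "m2 = (INF t\<in>{0..T}. H2 t)" "M2 = (SUP t\<in>{0..T}. H2 t)" "1/2 < m2" "M2 < 1"
    "\<And>t. t \<in> {0..T} \<Longrightarrow> m2 \<le> H2 t" "\<And>t. t \<in> {0..T} \<Longrightarrow> H2 t \<le> M2"
    using bounds[OF assms(4,6)] by blast
  have m\<gamma>: "(M1 + M2) / 2 < \<gamma>" and m\<alpha>: "\<alpha> < (m1 + m2) / 2"
    using assms(7,11) by (simp_all add: 1 2)
  have mM: "m1 \<le> M1" "m2 \<le> M2"
    using 1(5,6)[of 0] 2(5,6)[of 0] \<open>0 < T\<close> by auto
  \<comment> \<open>Margin keeping the exponents inside \<open>(-3/4, -1/2)\<close> and the energy exponent \<open>q\<close> above \<open>2 \<alpha>\<close>.\<close>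
  define d where "d = Min {(m1 - 1/2) / 2, (m2 - 1/2) / 2, (1 - M1) / 2, (1 - M2) / 2, (m1 + m2 - 2 * \<alpha>) / 4}"
  have d: "0 < d" using 1 2 m\<alpha> by (simp add: d_def)
  have d_le: "d \<le> (m1 - 1/2) / 2" "d \<le> (m2 - 1/2) / 2" "d \<le> (1 - M1) / 2" "d \<le> (1 - M2) / 2" "d \<le> (m1 + m2 - 2 * \<alpha>) / 4"
    unfolding d_def by (intro Min_le; simp)+
  define e where "e = d / 2"
  have e: "0 < e" and e_lt: "e < (m1 - 1/2) / 2" "e < (m2 - 1/2) / 2" "e < (1 - M1) / 2" "e < (1 - M2) / 2" "e < (m1 + m2 - 2 * \<alpha>) / 4"
    using d d_le unfolding e_def by linarith+
  \<comment> \<open>This is the energy exponent \<open>2 * l1 + 2 * l2 + 4\<close> for the lower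
    exponents \<open>m1 / 2 - 1 - e\<close> and \<open>m2 / 2 - 1 - e\<close> used below.\<close>
  define q where "q = m1 + m2 - 4 * e"
  have q\<alpha>: "2 * \<alpha> < q" using e_lt(5) by (simp add: q_def)
  let ?X = "\<lambda>t. rosenblatt_kernel (H1 t) (H2 t) t"
  have "\<exists>C\<ge>0. \<forall>s\<in>{0..T}. \<forall>t\<in>{0..T}. (L2sq lborel (\<lambda>z. ?X t z - ?X s z)) \<le> ennreal (C * \<bar>t - s\<bar> powr q)"
  proof (rule rosenblatt_kernel_increment_L2[where ?l1.0 = "m1 / 2 - 1 - e" and ?u1.0 = "M1 / 2 - 1 + e"
        and ?l2.0 = "m2 / 2 - 1 - e" and ?u2.0 = "M2 / 2 - 1 + e" and e = e and \<gamma> = \<gamma>])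
    show "H1 t / 2 - 1 \<in> {m1 / 2 - 1 - e + e..M1 / 2 - 1 + e - e}" if "t \<in> {0..T}" for t
      using 1(5,6)[OF that] by simp
    show "H2 t / 2 - 1 \<in> {m2 / 2 - 1 - e + e..M2 / 2 - 1 + e - e}" if "t \<in> {0..T}" for t
      using 2(5,6)[OF that] by simp
    show "\<bar>H1 t - H1 s\<bar> \<le> \<bar>t - s\<bar> powr \<gamma>" if "s \<in> {0..T}" "t \<in> {0..T}" for s t
      using assms(8) that by blast
    show "\<bar>H2 t - H2 s\<bar> \<le> \<bar>t - s\<bar> powr \<gamma>" if "s \<in> {0..T}" "t \<in> {0..T}" for s t
      using assms(9) that by blast
    show "q \<le> 2 * \<gamma>" using m\<gamma> mM e by (simp add: q_def)
  qed (use e e_lt mM \<open>0 < T\<close> in \<open>simp_all add: q_def\<close>)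
  then obtain C where C: "0 \<le> C" "\<And>s t. s \<in> {0..T} \<Longrightarrow> t \<in> {0..T} \<Longrightarrow>
      (L2sq lborel (\<lambda>z. ?X t z - ?X s z)) \<le> ennreal (C * \<bar>t - s\<bar> powr q)"
    by blast
  have L2: "symmetric_L2 (?X t)" if t: "t \<in> {0..T}" for t
  proof -
    \<comment> \<open>The kernel at \<open>t\<close> is compared with the zero kernel at time
      0.\<close>
    have "(L2sq lborel (\<lambda>z. ?X t z)) < \<infinity>"
      using C(2)[OF _ t, of 0] \<open>0 < T\<close> by (simp add: rosenblatt_kernel_0 order_le_less_trans)
    then have "integrable lborel (\<lambda>z. (?X t z)\<^sup>2)"
      using rosenblatt_kernel_measurable by (intro integrableI_nonneg) auto
    then show ?thesis
      unfolding symmetric_L2_def using rosenblatt_kernel_measurable rosenblatt_kernel_sym by blast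
  qed
  define X where "X = multifractional_rosenblatt M W H1 H2"
  have X: "has_I2 M W (?X t) (X t)" if "t \<in> {0..T}" for t
    unfolding X_def multifractional_rosenblatt_def gen_rosenblatt_def
    by (rule has_I2_I2[OF L2[OF that] rosenblatt_kernel_nonneg])
  \<comment> \<open>The bound on \<open>p\<close> is Kolmogorov's condition
    \<open>1 + n \<alpha> < b\<close> with moment order \<open>n = 2 * p\<close> and exponent
    \<open>b = q * p\<close>. Such a \<open>p\<close> exists because \<open>q\<close> exceeds
    \<open>2 * \<alpha>\<close>.\<close>
  obtain p :: nat where p: "1 / (q - 2 * \<alpha>) < real p" using reals_Archimedean2 by blast
  have "0 < 1 / (q - 2 * \<alpha>)" using q\<alpha> by simp
  then have p0: "0 < p" using p by (cases p) auto
  have pq: "1 + real (2 * p) * \<alpha> < q * real p"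
  proof -
    have "1 < real p * (q - 2 * \<alpha>)" using p q\<alpha> by (simp add: divide_less_eq)
    then show ?thesis by (simp add: algebra_simps)
  qed
  have "\<exists>X'. modification_on M {0..T} X X' \<and> (\<forall>\<omega>\<in>space M. holder_continuous_on \<alpha> {0..T} (\<lambda>t. X' t \<omega>))"
  proof (rule kolmogorov_continuity[OF \<open>0 < T\<close> \<open>0 < \<alpha>\<close> _ _ pq])
    show "0 \<le> (chaos_const p * C) ^ p" using C(1) chaos_const_pos[of p] by simp
    show "X t \<in> borel_measurable M" if "t \<in> {0..T}" for t
      using X[OF that] by (simp add: has_I2_def)
    fix s t assume s: "s \<in> {0..T}" and t: "t \<in> {0..T}"
    have "(\<integral>\<^sup>+\<omega>. ennreal (\<bar>X t \<omega> - X s \<omega>\<bar> ^ (2 * p)) \<partial>M) = (\<integral>\<^sup>+\<omega>. ennreal ((X t \<omega> - X s \<omega>) ^ (2 * p)) \<partial>M)"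
      by (simp add: power_even_abs)
    also have "\<dots> \<le> (ennreal (chaos_const p) * (L2sq lborel (\<lambda>z. ?X t z - ?X s z))) ^ p"
      by (rule has_I2_moment[OF X[OF t] X[OF s] p0])
    also have "\<dots> \<le> (ennreal (chaos_const p) * ennreal (C * \<bar>t - s\<bar> powr q)) ^ p"
      by (intro power_mono mult_left_mono C(2)[OF s t]) auto
    also have "\<dots> = ennreal ((chaos_const p * (C * \<bar>t - s\<bar> powr q)) ^ p)"
      using C(1) chaos_const_pos[of p] by (subst ennreal_mult[symmetric]) (auto simp: ennreal_power)
    also have "(chaos_const p * (C * \<bar>t - s\<bar> powr q)) ^ p = (chaos_const p * C) ^ p * \<bar>t - s\<bar> powr (q * real p)"
    proof -
      have "(\<bar>t - s\<bar> powr q) ^ p = \<bar>t - s\<bar> powr (q * real p)"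
      proof (cases "t = s")
        case False
        then have "(\<bar>t - s\<bar> powr q) ^ p = (\<bar>t - s\<bar> powr q) powr real p"
          by (simp add: powr_realpow)
        then show ?thesis by (simp only: powr_powr)
      qed (use p0 in simp)
      then show ?thesis by (simp add: power_mult_distrib)
    qed
    finally show "(\<integral>\<^sup>+\<omega>. ennreal (\<bar>X t \<omega> - X s \<omega>\<bar> ^ (2 * p)) \<partial>M)
      \<le> ennreal ((chaos_const p * C) ^ p * \<bar>t - s\<bar> powr (q * real p))" .
  qed (use p0 in simp)
  then show ?thesis unfolding X_def .
qed

end
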